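(* Let $\mathcal T\in\mathrm{Tree}(N)$ be an $(n,d)$-regular tree with $n\ge2$. Then for every $\mathcal B$-valued law $\mu$, \[ \mathbb{BP}_{\mathcal T,\mathrm{Bool}}(\mu)=\mathbb{BN}_{d/(n-1)}(\mu). \]
   Context: $\mathcal B$ is a unital $C^*$-algebra. A $\mathcal B$-valued probability space $(\mathcal A,E)$ is a unital $C^*$-algebra $\mathcal A\supseteq\mathcal B$ (unital inclusion) with a unital completely positive $\mathcal B$-$\mathcal B$-bimodule map $E:\mathcal A\to\mathcal B$ such that $E[a_1aa_2]=0$ for all $a_1,a_2$ implies $a=0$. Laws: $\mathcal B\langle X\rangle$ is the universal unital $*$-algebra generated by $\mathcal B$ and a self-adjoint indeterminate $X$. A linear map $\sigma:\mathcal B\langle X\rangle\to\mathcal B$ is completely positive if $\sigma^{(m)}(P^*P)\ge0$ for all $P\in M_m(\mathcal B\langle X\rangle)$, exponentially bounded if $\|\sigma(b_0Xb_1\cdots Xb_\ell)\|\le MR^\ell\|b_0\|\cdots\|b_\ell\|$ for some $M,R>0$; $\mathrm{rad}(\sigma)$ is the infimum of admissible $R$. A $\mathcal B$-valued law is a unital, completely positive, exponentially bounded $\mathcal B$-$\mathcal B$-bimodule map; every law is the law $p\mapsto E[p(Y)]$ of a self-adjoint $Y$ in some $(\mathcal A,E)$. Trees: $[N]=\{1,\dots,N\}$. A string on $[N]$ is alternating if consecutive letters differ. $\mathcal T_{N,\mathrm{free}}$ is the graph whose vertices are the alternating strings on $[N]$ (including the empty string $\emptyset$), with an edge between $s$ and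 $js$ whenever $js$ is alternating, rooted at $\emptyset$. $\mathrm{Tree}(N)$ is the set of connected subgraphs containing $\emptyset$, each identified with its vertex set. A rooted tree is $(n,d)$-regular if the root has exactly $n$ neighbors and every other vertex has exactly $d$ children. Partitions: $\mathcal{NC}(S)$ is the set of non-crossing partitions of a finite totally ordered set $S$, $\mathcal{NC}(\ell)=\mathcal{NC}([\ell])$, $|\pi|$ the number of blocks. $W\prec V$ ($V$ nested inside $W$) if there are $j,k\in W$ with $j<v<k$ for all $v\in V$. $\mathrm{chain}(V)=(V,V_1,\dots,V_d)$, where $V\succ V_1\succ\cdots\succ V_d$ are all blocks in which $V$ is nested. $\mathrm{graph}(\pi)$ is the rooted tree on $\pi\sqcup\{\emptyset\}$ with $\emptyset$ joined to the $\prec$-minimal blocks and $V,W$ joined if $V\prec W$ with no block strictly between. For $\chi\in[N]^\pi$, the $\chi$-components of $\pi$ are the connected components of the graph obtained from $\mathrm{graph}(\pi)$ by deleting the root and all edges between blocks of different colors, each regarded as a non-crossing partition of the union of its blocks. $\mathrm{red}(s)$ replaces each run of equal consecutive letters by a single one. $\mathcal X_w(\pi,\mathcal T)$ is the set of $\chi\in[N]^\pi$ with $\mathrm{red}(\chi(V)\chi(V_1)\cdots\chi(V_d))\in\mathcal T$ for every $V\in\pi$. If $\mathcal T$ has $n\ge2$ one-letter strings, $\alpha_{\mathcal T,\pi}$ are the unique numbers with $\alpha_{\mathcal T,\pi}=1$ if $|\pi|=1$ and $\alpha_{\mathcal T,\pi}=n^{-|\pi|}\sum_{\chi\in\mathcal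 X_w(\pi,\mathcal T)}\prod_{\chi\text{-components }\pi'}\alpha_{\mathcal T,\pi'}$. Cumulants: for a sequence $(\Lambda_\ell)$ of maps $\Lambda_\ell:\mathcal A^\ell\to\mathcal B$ that are $\mathcal B$-quasi-multilinear (multilinear, left $\mathcal B$-linear in the first entry, right $\mathcal B$-linear in the last, $\Lambda[\dots,a_jb,a_{j+1},\dots]=\Lambda[\dots,a_j,ba_{j+1},\dots]$), $\Lambda_\pi$ is defined recursively: $1$ for the empty partition, and for an interval block $V=\{j+1,\dots,k\}$ of $\pi\in\mathcal{NC}(\ell)$, $\Lambda_\pi[a_1,\dots,a_\ell]=\Lambda_{\pi\setminus V}[a_1,\dots,a_j,\Lambda_{k-j}[a_{j+1},\dots,a_k]a_{k+1},\dots,a_\ell]$ if $k<\ell$, and $=\Lambda_{\pi\setminus V}[a_1,\dots,a_j]\Lambda_{\ell-j}[a_{j+1},\dots,a_\ell]$ if $k=\ell$. Given coefficients $\alpha_\pi$ (equal to $1$ when $|\pi|=1$), the associated cumulants are the unique $\mathcal B$-quasi-multilinear $K_\ell$ with $E[a_1\cdots a_\ell]=\sum_{\pi\in\mathcal{NC}(\ell)}\alpha_\pi K_\pi[a_1,\dots,a_\ell]$: $\mathcal T$-free cumulants for $\alpha_\pi=\alpha_{\mathcal T,\pi}$; free cumulants for $\alpha_\pi=1$; Boolean cumulants for $\alpha_\pi=1$ if all blocks of $\pi$ are intervals and $0$ otherwise. The corresponding cumulants of a law $\mu$ are $\kappa_\ell(\mu)[b_1,\dots,b_{\ell-1}]=K_\ell[Xb_1,\dots,Xb_{\ell-1},X]$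 for $X$ with law $\mu$; they determine $\mu$. Convolution powers: $\mu^{\uplus t}$ ($t\ge0$) is the law whose Boolean cumulants are $t$ times those of $\mu$ (it exists for every law); $\mu^{\boxplus s}$ ($s\ge1$) is the law whose free cumulants are $s$ times those of $\mu$ (it exists for every law). $\mathbb{BN}_t(\mu)=(\mu^{\boxplus(1+t)})^{\uplus1/(1+t)}$ for $t\ge0$. Bercovici–Pata bijection: for every law $\mu$ there are a unique self-adjoint $c\in\mathcal B$ and completely positive exponentially bounded $\sigma:\mathcal B\langle Y\rangle\to\mathcal B$ with Boolean cumulants $\kappa_1(\mu)=c$, $\kappa_\ell(\mu)[b_1,\dots,b_{\ell-1}]=\sigma(b_1Yb_2\cdots Yb_{\ell-1})$ for $\ell\ge2$; and for every such pair there is a unique law ($\mathcal T$-freely infinitely divisible with bounded support) whose $\mathcal T$-free cumulants are given by $(c,\sigma)$ through the same formulas. $\mathbb{BP}_{\mathcal T,\mathrm{Bool}}(\mu)$ denotes this latter law; i.e. it is the law whose $\mathcal T$-free cumulants equal the Boolean cumulants of $\mu$. *)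

theory Defs
  imports Complex_Main "HOL-Library.Disjoint_Sets" "HOL-Library.FuncSet"
    "Jordan_Normal_Form.Matrix"
begin

section \<open>Unital C*-algebras\<close>

class star_algebra_1 = ring_1 +
  fixes scaleC :: "complex \<Rightarrow> 'a \<Rightarrow> 'a"
    and star :: "'a \<Rightarrow> 'a"
  assumes scaleC_add_right: "scaleC z (x + y) = scaleC z x + scaleC z y"
    and scaleC_add_left: "scaleC (z + w) x = scaleC z x + scaleC w x"
    and scaleC_scaleC: "scaleC z (scaleC w x) = scaleC (z * w) x"
    and scaleC_one: "scaleC 1 x = x"
    and mult_scaleC_left: "scaleC z x * y = scaleC z (x * y)"
    and mult_scaleC_right: "x * scaleC z y = scaleC z (x * y)"
    and star_add: "star (x + y) = star x + star y"
    and star_scaleC: "star (scaleC z x) = scaleC (cnj z) (star x)"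
    and star_mult: "star (x * y) = star y * star x"
    and star_star: "star (star x) = x"

class cstar_algebra_1 = star_algebra_1 + real_normed_algebra_1 + banach +
  assumes scaleR_scaleC: "scaleR r x = scaleC (complex_of_real r) x"
    and norm_scaleC: "norm (scaleC z x) = cmod z * norm x"
    and norm_star_mult_self: "norm (star x * x) = (norm x)\<^sup>2"

instantiation complex :: cstar_algebra_1
begin

definition scaleC_complex :: "complex \<Rightarrow> complex \<Rightarrow> complex" where
  "scaleC_complex z x = z * x"

definition star_complex :: "complex \<Rightarrow> complex" where
  "star_complex = cnj"

instance
  by standard
    (auto simp: scaleC_complex_def star_complex_def algebra_simps norm_mult power2_eq_square
       scaleR_conv_of_real)

end

definition clinear_map :: "('a::star_algebra_1 \<Rightarrow> 'b::star_algebra_1) \<Rightarrow> bool" where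
  "clinear_map \<sigma> \<longleftrightarrow>
     (\<forall>x y. \<sigma> (x + y) = \<sigma> x + \<sigma> y) \<and> (\<forall>z x. \<sigma> (scaleC z x) = scaleC z (\<sigma> x))"

definition star_hom :: "('a::star_algebra_1 \<Rightarrow> 'b::star_algebra_1) \<Rightarrow> bool" where
  "star_hom h \<longleftrightarrow> clinear_map h \<and> h 1 = 1 \<and> (\<forall>x y. h (x * y) = h x * h y) \<and>
     (\<forall>x. h (star x) = star (h x))"

definition adj_mat :: "'a::star_algebra_1 mat \<Rightarrow> 'a mat" where
  "adj_mat A = map_mat star (transpose_mat A)"

definition positive_mat :: "nat \<Rightarrow> 'a::star_algebra_1 mat \<Rightarrow> bool" where
  "positive_mat m A \<longleftrightarrow> (\<exists>C\<in>carrier_mat m m. A = adj_mat C * C)"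

definition completely_positive :: "('a::star_algebra_1 \<Rightarrow> 'b::cstar_algebra_1) \<Rightarrow> bool" where
  "completely_positive \<sigma> \<longleftrightarrow>
     (\<forall>m. \<forall>P\<in>carrier_mat m m. positive_mat m (map_mat \<sigma> (adj_mat P * P)))"

text \<open>Inclusions \<open>\<B> \<subseteq> \<A>\<close> are given by a map \<open>\<iota>\<close>; the bimodule structure of \<open>\<A>\<close> is
  \<open>b\<^sub>1 \<cdot> a \<cdot> b\<^sub>2 = \<iota> b\<^sub>1 * a * \<iota> b\<^sub>2\<close>.\<close>

definition bimodule_map ::
    "('b \<Rightarrow> 'a) \<Rightarrow> ('a::star_algebra_1 \<Rightarrow> 'b::star_algebra_1) \<Rightarrow> bool" where
  "bimodule_map \<iota> \<sigma> \<longleftrightarrow> clinear_map \<sigma> \<and> (\<forall>b a c. \<sigma> (\<iota> b * a * \<iota> c) = b * \<sigma> a * c)"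

definition valued_probability_space ::
    "('b \<Rightarrow> 'a) \<Rightarrow> ('a::cstar_algebra_1 \<Rightarrow> 'b::cstar_algebra_1) \<Rightarrow> bool" where
  "valued_probability_space \<iota> E \<longleftrightarrow> star_hom \<iota> \<and> inj \<iota> \<and>
     bimodule_map \<iota> E \<and> E 1 = 1 \<and> completely_positive E \<and>
     (\<forall>a. (\<forall>a\<^sub>1 a\<^sub>2. E (a\<^sub>1 * a * a\<^sub>2) = 0) \<longrightarrow> a = 0)"


section \<open>The algebra of \<open>\<B>\<close>-valued non-commutative polynomials\<close>

text \<open>\<open>\<B>\<langle>X\<rangle>\<close>, the universal unital *-algebra generated by \<open>\<B>\<close> and a self-adjoint indeterminate,
  is the algebra of all *-algebra terms modulo the smallest congruence that contains the
  axioms of unital complex *-algebras, makes \<open>\<B>\<close> a unital *-subalgebra, and makes the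
  indeterminate self-adjoint.\<close>

datatype 'b ncterm =
    TConst 'b
  | TVar
  | TPlus "'b ncterm" "'b ncterm"
  | TTimes "'b ncterm" "'b ncterm"
  | TScale complex "'b ncterm"
  | TStar "'b ncterm"

inductive nc_cong :: "'b::star_algebra_1 ncterm \<Rightarrow> 'b ncterm \<Rightarrow> bool" (infix \<open>\<simeq>\<close> 50) where
  nc_refl: "p \<simeq> p"
| nc_sym: "p \<simeq> q \<Longrightarrow> q \<simeq> p"
| nc_trans: "p \<simeq> q \<Longrightarrow> q \<simeq> r \<Longrightarrow> p \<simeq> r"
| nc_plus: "p \<simeq> p' \<Longrightarrow> q \<simeq> q' \<Longrightarrow> TPlus p q \<simeq> TPlus p' q'"
| nc_times: "p \<simeq> p' \<Longrightarrow> q \<simeq> q' \<Longrightarrow> TTimes p q \<simeq> TTimes p' q'"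
| nc_scale: "p \<simeq> p' \<Longrightarrow> TScale z p \<simeq> TScale z p'"
| nc_star: "p \<simeq> p' \<Longrightarrow> TStar p \<simeq> TStar p'"
| nc_add_assoc: "TPlus (TPlus p q) r \<simeq> TPlus p (TPlus q r)"
| nc_add_commute: "TPlus p q \<simeq> TPlus q p"
| nc_add_zero: "TPlus (TConst 0) p \<simeq> p"
| nc_add_inverse: "TPlus (TScale (-1) p) p \<simeq> TConst 0"
| nc_mult_assoc: "TTimes (TTimes p q) r \<simeq> TTimes p (TTimes q r)"
| nc_mult_one_left: "TTimes (TConst 1) p \<simeq> p"
| nc_mult_one_right: "TTimes p (TConst 1) \<simeq> p"
| nc_distrib_right: "TTimes (TPlus p q) r \<simeq> TPlus (TTimes p r) (TTimes q r)"
| nc_distrib_left: "TTimes p (TPlus q r) \<simeq> TPlus (TTimes p q) (TTimes p r)"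
| nc_scale_add_right: "TScale z (TPlus p q) \<simeq> TPlus (TScale z p) (TScale z q)"
| nc_scale_add_left: "TScale (z + w) p \<simeq> TPlus (TScale z p) (TScale w p)"
| nc_scale_scale: "TScale z (TScale w p) \<simeq> TScale (z * w) p"
| nc_scale_one: "TScale 1 p \<simeq> p"
| nc_scale_mult_left: "TTimes (TScale z p) q \<simeq> TScale z (TTimes p q)"
| nc_scale_mult_right: "TTimes p (TScale z q) \<simeq> TScale z (TTimes p q)"
| nc_star_add: "TStar (TPlus p q) \<simeq> TPlus (TStar p) (TStar q)"
| nc_star_scale: "TStar (TScale z p) \<simeq> TScale (cnj z) (TStar p)"
| nc_star_mult: "TStar (TTimes p q) \<simeq> TTimes (TStar q) (TStar p)"
| nc_star_star: "TStar (TStar p) \<simeq> p"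
| nc_const_add: "TConst (a + b) \<simeq> TPlus (TConst a) (TConst b)"
| nc_const_mult: "TConst (a * b) \<simeq> TTimes (TConst a) (TConst b)"
| nc_const_scale: "TConst (scaleC z a) \<simeq> TScale z (TConst a)"
| nc_const_star: "TConst (star a) \<simeq> TStar (TConst a)"
| nc_var_star: "TStar TVar \<simeq> TVar"

primrec nc_interp :: "('b \<Rightarrow> 'a::star_algebra_1) \<Rightarrow> 'a \<Rightarrow> 'b ncterm \<Rightarrow> 'a" where
  "nc_interp \<iota> y (TConst b) = \<iota> b"
| "nc_interp \<iota> y TVar = y"
| "nc_interp \<iota> y (TPlus p q) = nc_interp \<iota> y p + nc_interp \<iota> y q"
| "nc_interp \<iota> y (TTimes p q) = nc_interp \<iota> y p * nc_interp \<iota> y q"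
| "nc_interp \<iota> y (TScale z p) = scaleC z (nc_interp \<iota> y p)"
| "nc_interp \<iota> y (TStar p) = star (nc_interp \<iota> y p)"

lemma scaleC_zero_left: "scaleC 0 (x::'a::star_algebra_1) = 0"
  using scaleC_add_left[of 0 0 x] by simp

lemma scaleC_minus_one: "scaleC (-1) (x::'a::star_algebra_1) = - x"
  using scaleC_add_left[of "-1" 1 x]
  by (simp add: scaleC_zero_left scaleC_one eq_neg_iff_add_eq_0)

lemma star_hom_zero: "star_hom h \<Longrightarrow> h 0 = 0"
  unfolding star_hom_def clinear_map_def by (metis add_cancel_right_right)

lemma nc_interp_cong:
  assumes "p \<simeq> q" and \<iota>: "star_hom \<iota>" and y: "star y = y"
  shows "nc_interp \<iota> y p = nc_interp \<iota> y q"
  using assms(1)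
proof induction
qed (use \<iota> y star_hom_zero[OF \<iota>] in \<open>simp_all add: star_hom_def clinear_map_def algebra_simps
      scaleC_minus_one scaleC_add_right scaleC_add_left scaleC_scaleC scaleC_one
      mult_scaleC_left mult_scaleC_right star_add star_scaleC star_mult star_star\<close>)

lemma star_hom_id: "star_hom (\<lambda>x. x)"
  by (simp add: star_hom_def clinear_map_def)

lemma star_zero: "star (0::'a::star_algebra_1) = 0"
  using star_add[of 0 "0::'a"] by simp

quotient_type (overloaded) 'b ncpoly = "'b::star_algebra_1 ncterm" / nc_cong
  by (intro equivpI reflpI sympI transpI) (blast intro: nc_refl nc_sym nc_trans)+

lift_definition nc_const :: "'b::star_algebra_1 \<Rightarrow> 'b ncpoly" is TConst .
lift_definition nc_X :: "'b::star_algebra_1 ncpoly" is TVar .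

instantiation ncpoly :: (star_algebra_1) star_algebra_1
begin

lift_definition zero_ncpoly :: "'a ncpoly" is "TConst 0" .
lift_definition one_ncpoly :: "'a ncpoly" is "TConst 1" .
lift_definition plus_ncpoly :: "'a ncpoly \<Rightarrow> 'a ncpoly \<Rightarrow> 'a ncpoly" is TPlus
  by (rule nc_plus)
lift_definition times_ncpoly :: "'a ncpoly \<Rightarrow> 'a ncpoly \<Rightarrow> 'a ncpoly" is TTimes
  by (rule nc_times)
lift_definition scaleC_ncpoly :: "complex \<Rightarrow> 'a ncpoly \<Rightarrow> 'a ncpoly" is TScale
  by (rule nc_scale)
lift_definition star_ncpoly :: "'a ncpoly \<Rightarrow> 'a ncpoly" is TStar
  by (rule nc_star)
definition uminus_ncpoly :: "'a ncpoly \<Rightarrow> 'a ncpoly" where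
  "uminus_ncpoly p = scaleC (-1) p"
definition minus_ncpoly :: "'a ncpoly \<Rightarrow> 'a ncpoly \<Rightarrow> 'a ncpoly" where
  "minus_ncpoly p q = p + scaleC (-1) q"

instance
proof
  fix p q r :: "'a ncpoly" and z w :: complex
  show "p + q + r = p + (q + r)" by transfer (rule nc_add_assoc)
  show "p + q = q + p" by transfer (rule nc_add_commute)
  show "0 + p = p" by transfer (rule nc_add_zero)
  show "- p + p = 0" unfolding uminus_ncpoly_def by transfer (rule nc_add_inverse)
  show "p - q = p + - q" by (simp add: minus_ncpoly_def uminus_ncpoly_def)
  show "p * q * r = p * (q * r)" by transfer (rule nc_mult_assoc)
  show "1 * p = p" by transfer (rule nc_mult_one_left)
  show "p * 1 = p" by transfer (rule nc_mult_one_right)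
  show "(p + q) * r = p * r + q * r" by transfer (rule nc_distrib_right)
  show "p * (q + r) = p * q + p * r" by transfer (rule nc_distrib_left)
  show "(0::'a ncpoly) \<noteq> 1"
  proof transfer
    show "\<not> TConst (0::'a) \<simeq> TConst 1"
      using nc_interp_cong[OF _ star_hom_id star_zero, of "TConst (0::'a)" "TConst 1"] by auto
  qed
  show "scaleC z (p + q) = scaleC z p + scaleC z q" by transfer (rule nc_scale_add_right)
  show "scaleC (z + w) p = scaleC z p + scaleC w p" by transfer (rule nc_scale_add_left)
  show "scaleC z (scaleC w p) = scaleC (z * w) p" by transfer (rule nc_scale_scale)
  show "scaleC 1 p = p" by transfer (rule nc_scale_one)
  show "scaleC z p * q = scaleC z (p * q)" by transfer (rule nc_scale_mult_left)
  show "p * scaleC z q = scaleC z (p * q)" by transfer (rule nc_scale_mult_right)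
  show "star (p + q) = star p + star q" by transfer (rule nc_star_add)
  show "star (scaleC z p) = scaleC (cnj z) (star p)" by transfer (rule nc_star_scale)
  show "star (p * q) = star q * star p" by transfer (rule nc_star_mult)
  show "star (star p) = p" by transfer (rule nc_star_star)
qed

end

lemma star_hom_nc_const: "star_hom nc_const"
  unfolding star_hom_def clinear_map_def
  by (intro conjI allI; transfer)
    (auto intro: nc_refl nc_const_add nc_const_mult nc_const_scale nc_const_star)

lemma star_nc_X: "star nc_X = nc_X"
  by transfer (rule nc_var_star)


definition nc_eval :: "('b::star_algebra_1 \<Rightarrow> 'a::star_algebra_1) \<Rightarrow> 'a \<Rightarrow> 'b ncpoly \<Rightarrow> 'a" where
  "nc_eval \<iota> y p = nc_interp \<iota> y (rep_ncpoly p)"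

definition nc_monomial :: "'b::star_algebra_1 \<Rightarrow> 'b list \<Rightarrow> 'b ncpoly" where
  "nc_monomial b bs = nc_const b * prod_list (map (\<lambda>b. nc_X * nc_const b) bs)"

definition exponentially_bounded :: "('b::cstar_algebra_1 ncpoly \<Rightarrow> 'b) \<Rightarrow> bool" where
  "exponentially_bounded \<sigma> \<longleftrightarrow> (\<exists>M>0. \<exists>R>0. \<forall>b bs.
     norm (\<sigma> (nc_monomial b bs)) \<le> M * R ^ length bs * (norm b * prod_list (map norm bs)))"

definition valued_law :: "('b::cstar_algebra_1 ncpoly \<Rightarrow> 'b) \<Rightarrow> bool" where
  "valued_law \<mu> \<longleftrightarrow> bimodule_map nc_const \<mu> \<and> \<mu> 1 = 1 \<and> completely_positive \<mu> \<and>
     exponentially_bounded \<mu>"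


section \<open>Non-crossing partitions\<close>

definition NC :: "nat set \<Rightarrow> nat set set set" where
  "NC S = {\<pi>. partition_on S \<pi> \<and>
     (\<forall>V\<in>\<pi>. \<forall>W\<in>\<pi>. \<forall>i j k l. i < j \<and> j < k \<and> k < l \<and> i \<in> V \<and> k \<in> V \<and> j \<in> W \<and> l \<in> W \<longrightarrow> V = W)}"

definition interval_block :: "nat set set \<Rightarrow> nat set \<Rightarrow> bool" where
  "interval_block \<pi> V \<longleftrightarrow> V \<in> \<pi> \<and> (\<forall>i\<in>V. \<forall>k\<in>V. \<forall>j\<in>\<Union>\<pi>. i < j \<and> j < k \<longrightarrow> j \<in> V)"

text \<open>\<open>nested W V\<close> is the relation \<open>W \<prec> V\<close>.\<close>

definition nested :: "nat set \<Rightarrow> nat set \<Rightarrow> bool" where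
  "nested W V \<longleftrightarrow> (\<exists>j\<in>W. \<exists>k\<in>W. \<forall>v\<in>V. j < v \<and> v < k)"

definition chain :: "nat set set \<Rightarrow> nat set \<Rightarrow> nat set list" where
  "chain \<pi> V = (THE Vs. set Vs = insert V {W\<in>\<pi>. nested W V} \<and>
     sorted_wrt (\<lambda>U W. nested W U) Vs)"

definition graph_adjacent :: "nat set set \<Rightarrow> nat set \<Rightarrow> nat set \<Rightarrow> bool" where
  "graph_adjacent \<pi> V W \<longleftrightarrow> V \<in> \<pi> \<and> W \<in> \<pi> \<and>
     (nested V W \<and> \<not> (\<exists>U\<in>\<pi>. nested V U \<and> nested U W) \<or>
      nested W V \<and> \<not> (\<exists>U\<in>\<pi>. nested W U \<and> nested U V))"

definition colour_components :: "nat set set \<Rightarrow> (nat set \<Rightarrow> nat) \<Rightarrow> nat set set set" where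
  "colour_components \<pi> \<chi> =
     (\<lambda>V. {W. (V, W) \<in> {(U, U'). graph_adjacent \<pi> U U' \<and> \<chi> U = \<chi> U'}\<^sup>*}) ` \<pi>"


section \<open>Trees and the associated coefficients\<close>

definition alternating :: "nat \<Rightarrow> nat list \<Rightarrow> bool" where
  "alternating N s \<longleftrightarrow> set s \<subseteq> {1..N} \<and> distinct_adj s"

definition free_adjacent :: "nat list \<Rightarrow> nat list \<Rightarrow> bool" where
  "free_adjacent s t \<longleftrightarrow> (\<exists>j. t = j # s \<or> s = j # t)"

definition Tree :: "nat \<Rightarrow> nat list set set" where
  "Tree N = {T. (\<forall>s\<in>T. alternating N s) \<and> [] \<in> T \<and>
     (\<forall>s\<in>T. \<forall>t\<in>T. (s, t) \<in> {(u, v). u \<in> T \<and> v \<in> T \<and> free_adjacent u v}\<^sup>*)}"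

text \<open>The root \<open>\<emptyset>\<close> has no parent, so its neighbours are its children.\<close>

definition children :: "nat list set \<Rightarrow> nat list \<Rightarrow> nat list set" where
  "children T s = {t\<in>T. \<exists>j. t = j # s}"

definition regular_tree :: "nat \<Rightarrow> nat \<Rightarrow> nat list set \<Rightarrow> bool" where
  "regular_tree n d T \<longleftrightarrow> card (children T []) = n \<and> (\<forall>s\<in>T. s \<noteq> [] \<longrightarrow> card (children T s) = d)"

text \<open>\<^const>\<open>remdups_adj\<close> is the map \<open>red\<close>.\<close>

definition colourings :: "nat \<Rightarrow> nat list set \<Rightarrow> nat set set \<Rightarrow> (nat set \<Rightarrow> nat) set" where
  "colourings N T \<pi> = {\<chi> \<in> \<pi> \<rightarrow>\<^sub>E {1..N}. \<forall>V\<in>\<pi>. remdups_adj (map \<chi> (chain \<pi> V)) \<in> T}"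

abbreviation root_degree :: "nat list set \<Rightarrow> nat" where
  "root_degree T \<equiv> card {j. [j] \<in> T}"

definition tree_coefficients :: "nat \<Rightarrow> nat list set \<Rightarrow> (nat set set \<Rightarrow> real) \<Rightarrow> bool" where
  "tree_coefficients N T \<alpha> \<longleftrightarrow>
     (\<forall>S. finite S \<longrightarrow> (\<forall>\<pi>\<in>NC S.
        (card \<pi> = 1 \<longrightarrow> \<alpha> \<pi> = 1) \<and>
        \<alpha> \<pi> = (1 / real (root_degree T) ^ card \<pi>) *
          (\<Sum>\<chi>\<in>colourings N T \<pi>. \<Prod>\<pi>'\<in>colour_components \<pi> \<chi>. \<alpha> \<pi>')))"

text \<open>Outside the non-crossing partitions of finite sets the value is fixed to be \<open>0\<close>, so that
  the coefficients are unique as a function.\<close>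

definition tree_coeff :: "nat \<Rightarrow> nat list set \<Rightarrow> nat set set \<Rightarrow> real" where
  "tree_coeff N T = (THE \<alpha>. tree_coefficients N T \<alpha> \<and>
     (\<forall>\<pi>. \<not> (\<exists>S. finite S \<and> \<pi> \<in> NC S) \<longrightarrow> \<alpha> \<pi> = 0))"

definition free_coeff :: "nat set set \<Rightarrow> real" where
  "free_coeff \<pi> = 1"

definition boolean_coeff :: "nat set set \<Rightarrow> real" where
  "boolean_coeff \<pi> = (if \<forall>V\<in>\<pi>. interval_block \<pi> V then 1 else 0)"


section \<open>Cumulants\<close>

text \<open>The sequence \<open>(\<Lambda>\<^sub>\<ell>)\<^sub>\<ell>\<^sub>\<ge>\<^sub>1\<close> is a single function on non-empty lists of arguments.\<close>

definition quasi_multilinear ::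
    "('b \<Rightarrow> 'a) \<Rightarrow> ('a::star_algebra_1 list \<Rightarrow> 'b::star_algebra_1) \<Rightarrow> bool" where
  "quasi_multilinear \<iota> \<Lambda> \<longleftrightarrow>
     (\<forall>xs x y ys. \<Lambda> (xs @ (x + y) # ys) = \<Lambda> (xs @ x # ys) + \<Lambda> (xs @ y # ys)) \<and>
     (\<forall>xs z x ys. \<Lambda> (xs @ scaleC z x # ys) = scaleC z (\<Lambda> (xs @ x # ys))) \<and>
     (\<forall>b x xs. \<Lambda> (\<iota> b * x # xs) = b * \<Lambda> (x # xs)) \<and>
     (\<forall>xs x b. \<Lambda> (xs @ [x * \<iota> b]) = \<Lambda> (xs @ [x]) * b) \<and>
     (\<forall>xs x b y ys. \<Lambda> (xs @ x * \<iota> b # y # ys) = \<Lambda> (xs @ x # \<iota> b * y # ys))"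

text \<open>\<open>eval_partition \<iota> \<Lambda> \<pi> a\<close> is \<open>\<Lambda>\<^sub>\<pi>\<close> for a partition \<open>\<pi>\<close> of a finite set \<open>S\<close> of positions, the
  argument at position \<open>s \<in> S\<close> being \<open>a s\<close>; removing a block from \<open>\<pi>\<close> then needs no relabelling.
  The argument that follows the removed interval block \<open>V\<close> is the one at the least element of
  \<open>S\<close> above \<open>V\<close>.  For quasi-multilinear \<open>\<Lambda>\<close> and non-crossing \<open>\<pi>\<close> the choice of the interval block
  is immaterial, see \<open>eval_partition_interval\<close> below.\<close>

definition above_block :: "nat set set \<Rightarrow> nat set \<Rightarrow> nat set" where
  "above_block \<pi> V = {s\<in>\<Union>\<pi>. \<forall>v\<in>V. v < s}"

lemma card_remove_interval_block:
  assumes "finite \<pi> \<and> (\<exists>V. interval_block \<pi> V)" "V = (SOME V. interval_block \<pi> V)"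
  shows "card (\<pi> - {V}) < card \<pi>"
proof -
  have "interval_block \<pi> V"
    unfolding assms(2) by (rule someI_ex[OF conjunct2[OF assms(1)]])
  then have "V \<in> \<pi>" by (simp add: interval_block_def)
  with conjunct1[OF assms(1)] show ?thesis by (rule card_Diff1_less)
qed

function eval_partition ::
    "('b \<Rightarrow> 'a) \<Rightarrow> ('a::star_algebra_1 list \<Rightarrow> 'b::star_algebra_1) \<Rightarrow> nat set set \<Rightarrow> (nat \<Rightarrow> 'a) \<Rightarrow> 'b"
where
  "eval_partition \<iota> \<Lambda> \<pi> a =
    (if finite \<pi> \<and> (\<exists>V. interval_block \<pi> V) then
       let V = (SOME V. interval_block \<pi> V);
           u = \<Lambda> (map a (sorted_list_of_set V));
           R = above_block \<pi> V
       in if R = {} then eval_partition \<iota> \<Lambda> (\<pi> - {V}) a * u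
          else eval_partition \<iota> \<Lambda> (\<pi> - {V}) (a(Min R := \<iota> u * a (Min R)))
     else 1)"
  by pat_completeness auto
termination
  by (relation "measure (\<lambda>(_, _, \<pi>, _). card \<pi>)")
    (rule wf_measure, (simp (no_asm) only: in_measure prod.case, erule (1) card_remove_interval_block)+)

declare eval_partition.simps [simp del]

definition is_cumulants ::
    "(nat set set \<Rightarrow> real) \<Rightarrow> ('b \<Rightarrow> 'a) \<Rightarrow> ('a::star_algebra_1 \<Rightarrow> 'b::cstar_algebra_1) \<Rightarrow>
     ('a list \<Rightarrow> 'b) \<Rightarrow> bool" where
  "is_cumulants \<alpha> \<iota> E K \<longleftrightarrow> quasi_multilinear \<iota> K \<and> K [] = 0 \<and>
     (\<forall>as. as \<noteq> [] \<longrightarrow>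
        E (prod_list as) =
          (\<Sum>\<pi>\<in>NC {1..length as}. \<alpha> \<pi> *\<^sub>R eval_partition \<iota> K \<pi> (\<lambda>i. as ! (i - 1))))"

definition cumulants ::
    "(nat set set \<Rightarrow> real) \<Rightarrow> ('b \<Rightarrow> 'a) \<Rightarrow> ('a::star_algebra_1 \<Rightarrow> 'b::cstar_algebra_1) \<Rightarrow> 'a list \<Rightarrow> 'b"
  where "cumulants \<alpha> \<iota> E = (THE K. is_cumulants \<alpha> \<iota> E K)"

text \<open>As an element with law \<open>\<mu>\<close> we take the indeterminate \<open>X\<close> in \<open>(\<B>\<langle>X\<rangle>, \<mu>)\<close>: the cumulants only depend
  on the algebraic structure, and any other realisation of \<open>\<mu>\<close> has the same ones, see
  \<open>law_cumulants_realisation\<close> below.  \<open>law_cumulants \<alpha> \<mu> [b\<^sub>1, \<dots>, b\<^sub>\<ell>\<^sub>-\<^sub>1]\<close> is \<open>\<kappa>\<^sub>\<ell>(\<mu>)[b\<^sub>1, \<dots>, b\<^sub>\<ell>\<^sub>-\<^sub>1]\<close>.\<close>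

definition law_cumulants ::
    "(nat set set \<Rightarrow> real) \<Rightarrow> ('b::cstar_algebra_1 ncpoly \<Rightarrow> 'b) \<Rightarrow> 'b list \<Rightarrow> 'b" where
  "law_cumulants \<alpha> \<mu> bs = cumulants \<alpha> nc_const \<mu> (map (\<lambda>b. nc_X * nc_const b) bs @ [nc_X])"


section \<open>Convolution powers and the Bercovici--Pata bijection\<close>

text \<open>Already among all unital bimodule maps on \<open>\<B>\<langle>X\<rangle>\<close>, positive or not, at most one has given
  cumulants.  So whenever a law with cumulants \<open>\<kappa>\<close> exists, it is \<open>law_with_cumulants \<alpha> \<kappa>\<close>; see
  \<open>law_with_cumulants_eqI\<close> below.\<close>

definition law_with_cumulants ::
    "(nat set set \<Rightarrow> real) \<Rightarrow> ('b list \<Rightarrow> 'b) \<Rightarrow> 'b::cstar_algebra_1 ncpoly \<Rightarrow> 'b" where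
  "law_with_cumulants \<alpha> \<kappa> = (THE \<nu>. bimodule_map nc_const \<nu> \<and> \<nu> 1 = 1 \<and>
     (\<forall>bs. law_cumulants \<alpha> \<nu> bs = \<kappa> bs))"

definition boolean_power ::
    "real \<Rightarrow> ('b::cstar_algebra_1 ncpoly \<Rightarrow> 'b) \<Rightarrow> 'b ncpoly \<Rightarrow> 'b" where
  "boolean_power t \<mu> =
     law_with_cumulants boolean_coeff (\<lambda>bs. t *\<^sub>R law_cumulants boolean_coeff \<mu> bs)"

definition free_power ::
    "real \<Rightarrow> ('b::cstar_algebra_1 ncpoly \<Rightarrow> 'b) \<Rightarrow> 'b ncpoly \<Rightarrow> 'b" where
  "free_power s \<mu> =
     law_with_cumulants free_coeff (\<lambda>bs. s *\<^sub>R law_cumulants free_coeff \<mu> bs)"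

definition BN :: "real \<Rightarrow> ('b::cstar_algebra_1 ncpoly \<Rightarrow> 'b) \<Rightarrow> 'b ncpoly \<Rightarrow> 'b" where
  "BN t \<mu> = boolean_power (1 / (1 + t)) (free_power (1 + t) \<mu>)"

definition BP_tree_Bool ::
    "nat \<Rightarrow> nat list set \<Rightarrow> ('b::cstar_algebra_1 ncpoly \<Rightarrow> 'b) \<Rightarrow> 'b ncpoly \<Rightarrow> 'b" where
  "BP_tree_Bool N T \<mu> = law_with_cumulants (tree_coeff N T) (law_cumulants boolean_coeff \<mu>)"


section \<open>The definitions above are meaningful\<close>

text \<open>The definite descriptions for cumulants and tree coefficients denote
  (\<open>is_cumulants_cumulants\<close>, \<open>tree_coefficients_unique\<close>), cumulants determine unital bimodule maps
  (\<open>law_determined_by_cumulants\<close>), and the choices made above do not matter.\<close>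


definition arg_block :: "('a::star_algebra_1 list \<Rightarrow> 'b) \<Rightarrow> (nat \<Rightarrow> 'a) \<Rightarrow> nat set \<Rightarrow> 'b" where
  "arg_block \<Lambda> a V = \<Lambda> (map a (sorted_list_of_set V))"


definition remove_block ::
    "('b \<Rightarrow> 'a) \<Rightarrow> ('a::star_algebra_1 list \<Rightarrow> 'b::star_algebra_1) \<Rightarrow> nat set set \<Rightarrow> nat set \<Rightarrow>
     (nat \<Rightarrow> 'a) \<Rightarrow> 'b" where
  "remove_block \<iota> \<Lambda> \<pi> V a =
     (if above_block \<pi> V = {} then eval_partition \<iota> \<Lambda> (\<pi> - {V}) a * arg_block \<Lambda> a V
      else eval_partition \<iota> \<Lambda> (\<pi> - {V})
        (a(Min (above_block \<pi> V) := \<iota> (arg_block \<Lambda> a V) * a (Min (above_block \<pi> V)))))"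

lemma eval_partition_some:
  assumes "finite \<pi>" "\<exists>V. interval_block \<pi> V"
  obtains V where "interval_block \<pi> V" "\<And>\<Lambda> a. eval_partition \<iota> \<Lambda> \<pi> a = remove_block \<iota> \<Lambda> \<pi> V a"
proof
  show "interval_block \<pi> (SOME V. interval_block \<pi> V)"
    using assms(2) by (rule someI_ex)
  show "eval_partition \<iota> \<Lambda> \<pi> a = remove_block \<iota> \<Lambda> \<pi> (SOME V. interval_block \<pi> V) a" for \<Lambda> a
    using assms by (subst eval_partition.simps)
      (simp add: Let_def remove_block_def arg_block_def)
qed

lemma eval_partition_none:
  "\<not> (finite \<pi> \<and> (\<exists>V. interval_block \<pi> V)) \<Longrightarrow> eval_partition \<iota> \<Lambda> \<pi> a = 1"
  by (subst eval_partition.simps) (simp only: if_False)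

lemma eval_partition_empty: "eval_partition \<iota> \<Lambda> {} a = 1"
  by (rule eval_partition_none) (simp add: interval_block_def)

lemma arg_block_cong: "(\<And>v. v \<in> V \<Longrightarrow> a v = a' v) \<Longrightarrow> arg_block \<Lambda> a V = arg_block \<Lambda> a' V"
  unfolding arg_block_def
  by (cases "finite V") (auto intro!: arg_cong[where f = \<Lambda>])

lemma Min_above:
  assumes "finite (\<Union>\<pi>)" "above_block \<pi> V \<noteq> {}"
  shows "Min (above_block \<pi> V) \<in> \<Union>\<pi>" "Min (above_block \<pi> V) \<in> above_block \<pi> V"
    "\<And>s. s \<in> above_block \<pi> V \<Longrightarrow> Min (above_block \<pi> V) \<le> s"
proof -
  have f: "finite (above_block \<pi> V)" by (rule finite_subset[OF _ assms(1)]) (auto simp: above_block_def)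
  show 1: "Min (above_block \<pi> V) \<in> above_block \<pi> V" using Min_in[OF f assms(2)] .
  then show "Min (above_block \<pi> V) \<in> \<Union>\<pi>" by (simp add: above_block_def)
  show "\<And>s. s \<in> above_block \<pi> V \<Longrightarrow> Min (above_block \<pi> V) \<le> s" using f by simp
qed

lemma eval_partition_cong:
  assumes "finite (\<Union>\<pi>)"
    and "\<And>s. s \<in> \<Union>\<pi> \<Longrightarrow> a s = a' s"
    and "\<And>V as. V \<in> \<pi> \<Longrightarrow> length as = card V \<Longrightarrow> \<Lambda> as = \<Lambda>' as"
  shows "eval_partition \<iota> \<Lambda> \<pi> a = eval_partition \<iota> \<Lambda>' \<pi> a'"
  using assms
proof (induction "card \<pi>" arbitrary: \<pi> a a' rule: less_induct)
  case less
  show ?case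
  proof (cases "finite \<pi> \<and> (\<exists>V. interval_block \<pi> V)")
    case True
    then obtain V where V: "interval_block \<pi> V"
      and ev: "\<And>\<Lambda> a. eval_partition \<iota> \<Lambda> \<pi> a = remove_block \<iota> \<Lambda> \<pi> V a"
      using eval_partition_some[of \<pi> \<iota>] by blast
    have V\<pi>: "V \<in> \<pi>" using V by (simp add: interval_block_def)
    have c: "card (\<pi> - {V}) < card \<pi>" using True V\<pi> by (meson card_Diff1_less)
    have fin: "finite (\<Union>(\<pi> - {V}))" by (rule finite_subset[OF _ less.prems(1)]) auto
    have IH: "eval_partition \<iota> \<Lambda> (\<pi> - {V}) f = eval_partition \<iota> \<Lambda>' (\<pi> - {V}) f'"
      if "\<And>s. s \<in> \<Union>\<pi> \<Longrightarrow> f s = f' s" for f f'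
      by (rule less.hyps[OF c fin]) (use less.prems(3) that in auto)
    have "arg_block \<Lambda> a V = arg_block \<Lambda> a' V"
      using less.prems(2) V\<pi> by (intro arg_block_cong) auto
    also have "\<dots> = arg_block \<Lambda>' a' V"
      using less.prems(3)[OF V\<pi>] by (simp add: arg_block_def)
    finally have u: "arg_block \<Lambda> a V = arg_block \<Lambda>' a' V" .
    show ?thesis
    proof (cases "above_block \<pi> V = {}")
      case True
      have "eval_partition \<iota> \<Lambda> (\<pi> - {V}) a = eval_partition \<iota> \<Lambda>' (\<pi> - {V}) a'"
        by (rule IH[OF less.prems(2)])
      then show ?thesis unfolding ev remove_block_def u using True by simp
    next
      case False
      have m: "a (Min (above_block \<pi> V)) = a' (Min (above_block \<pi> V))"
        by (rule less.prems(2)[OF Min_above(1)[OF less.prems(1) False]])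
      have "eval_partition \<iota> \<Lambda> (\<pi> - {V}) (a(Min (above_block \<pi> V) := c * a (Min (above_block \<pi> V))))
        = eval_partition \<iota> \<Lambda>' (\<pi> - {V}) (a'(Min (above_block \<pi> V) := c * a' (Min (above_block \<pi> V))))" for c
        by (rule IH) (simp add: m less.prems(2) del: Union_iff)
      then show ?thesis unfolding ev remove_block_def u using False by simp
    qed
  next
    case False
    then show ?thesis by (simp add: eval_partition_none)
  qed
qed

lemma NC_D:
  assumes "\<pi> \<in> NC S"
  shows "\<Union>\<pi> = S" and "{} \<notin> \<pi>" and "\<And>V W. V \<in> \<pi> \<Longrightarrow> W \<in> \<pi> \<Longrightarrow> V \<noteq> W \<Longrightarrow> V \<inter> W = {}"
    "\<And>V W i j k l. V \<in> \<pi> \<Longrightarrow> W \<in> \<pi> \<Longrightarrow> i < j \<Longrightarrow> j < k \<Longrightarrow> k < l \<Longrightarrow> i \<in> V \<Longrightarrow> k \<in> V \<Longrightarrow> j \<in> W \<Longrightarrow> l \<in> W \<Longrightarrow> V = W"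
proof -
  show "\<Union>\<pi> = S" "{} \<notin> \<pi>" using assms by (auto simp: NC_def partition_on_def)
  show "V \<in> \<pi> \<Longrightarrow> W \<in> \<pi> \<Longrightarrow> V \<noteq> W \<Longrightarrow> V \<inter> W = {}" for V W
    using assms by (auto simp: NC_def partition_on_def disjoint_def)
  fix V W i j k l assume "V \<in> \<pi>" "W \<in> \<pi>" "i < j" "j < k" "k < l" "i \<in> V" "k \<in> V" "j \<in> W" "l \<in> W"
  then show "V = W" using assms unfolding NC_def by blast
qed

lemma NC_remove:
  assumes "\<pi> \<in> NC S" "V \<in> \<pi>"
  shows "\<pi> - {V} \<in> NC (S - V)"
proof -
  note D = NC_D[OF assms(1)]
  have "\<Union>(\<pi> - {V}) = S - V"
  proof (intro equalityI subsetI)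
    fix x assume "x \<in> \<Union>(\<pi> - {V})"
    then obtain W where "W \<in> \<pi>" "W \<noteq> V" "x \<in> W" by blast
    then show "x \<in> S - V" using D(1) D(3)[of W V] assms(2) by blast
  qed (use D(1) in blast)
  moreover have "disjoint (\<pi> - {V})" using D(3) unfolding disjoint_def by blast
  ultimately show ?thesis
    using D(2) assms(1) unfolding NC_def partition_on_def by simp
qed

lemma NC_finite:
  assumes "\<pi> \<in> NC S" "finite S"
  shows "finite \<pi>" "V \<in> \<pi> \<Longrightarrow> finite V" "V \<in> \<pi> \<Longrightarrow> V \<subseteq> S"
  using assms NC_D(1)[OF assms(1)] finite_UnionD by (auto intro: finite_subset)

lemma interval_block_exists:
  assumes "\<pi> \<in> NC S" "finite S" "\<pi> \<noteq> {}"
  shows "\<exists>V. interval_block \<pi> V"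
proof -
  note D = NC_D[OF assms(1)] and fin = NC_finite[OF assms(1,2)]
  define V where "V = arg_min_on Max \<pi>"
  have V: "V \<in> \<pi>" and min: "\<And>W. W \<in> \<pi> \<Longrightarrow> Max V \<le> Max W"
    unfolding V_def using fin(1) assms(3) arg_min_if_finite[of \<pi> Max]
    by (auto simp: arg_min_least)
  have "j \<in> V" if "i \<in> V" "k \<in> V" "j \<in> \<Union>\<pi>" "i < j" "j < k" for i j k
  proof (rule ccontr)
    assume "j \<notin> V"
    from that obtain W where W: "W \<in> \<pi>" "j \<in> W" by blast
    have fV: "finite V" "finite W" using fin V W by auto
    have "Max V \<in> V" "Max W \<in> W" using fV that W by (auto intro!: Max_in)
    moreover have "Max V \<noteq> Max W" using calculation D(3)[OF V W(1)] W \<open>j \<notin> V\<close> by (metis IntI empty_iff)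
    moreover have "Max V \<le> Max W" using min W by blast
    moreover have "k \<le> Max V" using fV that by simp
    ultimately have "V = W" using D(4)[OF V W(1) that(4), of "Max V" "Max W"] that W by auto
    then show False using W \<open>j \<notin> V\<close> by simp
  qed
  with V show ?thesis unfolding interval_block_def by blast
qed

lemma interval_block_remove:
  "interval_block \<pi> V \<Longrightarrow> V \<noteq> W \<Longrightarrow> interval_block (\<pi> - {W}) V"
  unfolding interval_block_def by blast

lemma sorted_list_of_set_append:
  assumes "finite A" "finite B" "\<And>x y. x \<in> A \<Longrightarrow> y \<in> B \<Longrightarrow> x < (y::nat)"
  shows "sorted_list_of_set (A \<union> B) = sorted_list_of_set A @ sorted_list_of_set B"
proof (rule sorted_distinct_set_unique)
  show "sorted (sorted_list_of_set A @ sorted_list_of_set B)"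
    using assms by (auto simp: sorted_append intro: less_imp_le)
  show "distinct (sorted_list_of_set A @ sorted_list_of_set B)"
    using assms(1,2) by (auto dest: assms(3))
qed (use assms in auto)

lemma sorted_list_of_set_split:
  assumes "finite V" "s \<in> V"
  shows "sorted_list_of_set V =
    sorted_list_of_set {v\<in>V. v < s} @ s # sorted_list_of_set {v\<in>V. (s::nat) < v}"
proof -
  have V: "V = {v\<in>V. v < s} \<union> ({s} \<union> {v\<in>V. s < v})" using assms by auto
  have "sorted_list_of_set ({s} \<union> {v\<in>V. s < v}) = [s] @ sorted_list_of_set {v\<in>V. s < v}"
    using assms by (subst sorted_list_of_set_append) auto
  moreover have "sorted_list_of_set ({v\<in>V. v < s} \<union> ({s} \<union> {v\<in>V. s < v})) =
      sorted_list_of_set {v\<in>V. v < s} @ sorted_list_of_set ({s} \<union> {v\<in>V. s < v})"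
    using assms by (intro sorted_list_of_set_append) auto
  ultimately show ?thesis using V by simp
qed

context
  fixes \<iota> :: "'b::star_algebra_1 \<Rightarrow> 'a::star_algebra_1" and \<Lambda>
  assumes \<iota>: "star_hom \<iota>" and \<Lambda>: "quasi_multilinear \<iota> \<Lambda>"
begin

lemma \<iota>_simps: "\<iota> (b + c) = \<iota> b + \<iota> c" "\<iota> (b * c) = \<iota> b * \<iota> c" "\<iota> (scaleC z b) = scaleC z (\<iota> b)" "\<iota> 1 = 1"
  using \<iota> by (auto simp: star_hom_def clinear_map_def)

lemma arg_block_upd:
  assumes "finite V" "s \<in> V"
  shows "arg_block \<Lambda> (a(s := x)) V =
    \<Lambda> (map a (sorted_list_of_set {v\<in>V. v < s}) @ x # map a (sorted_list_of_set {v\<in>V. s < v}))"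
  unfolding arg_block_def sorted_list_of_set_split[OF assms] using assms(1)
  by (auto intro!: arg_cong[where f = \<Lambda>])

lemma arg_block_add:
  assumes "finite V" "s \<in> V"
  shows "arg_block \<Lambda> (a(s := x + y)) V = arg_block \<Lambda> (a(s := x)) V + arg_block \<Lambda> (a(s := y)) V"
  using \<Lambda> unfolding arg_block_upd[OF assms] quasi_multilinear_def by blast

lemma arg_block_scale:
  assumes "finite V" "s \<in> V"
  shows "arg_block \<Lambda> (a(s := scaleC z x)) V = scaleC z (arg_block \<Lambda> (a(s := x)) V)"
  using \<Lambda> unfolding arg_block_upd[OF assms] quasi_multilinear_def by blast

lemma arg_block_left:
  assumes "finite V" "s \<in> V" "\<And>v. v \<in> V \<Longrightarrow> s \<le> v"
  shows "arg_block \<Lambda> (a(s := \<iota> b * x)) V = b * arg_block \<Lambda> (a(s := x)) V"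
proof -
  have *: "{v\<in>V. v < s} = {}" using assms(3) by force
  show ?thesis
  using \<Lambda> unfolding arg_block_upd[OF assms(1,2)] * quasi_multilinear_def by simp
qed

lemma arg_block_right:
  assumes "finite V" "s \<in> V" "\<And>v. v \<in> V \<Longrightarrow> v \<le> s"
  shows "arg_block \<Lambda> (a(s := x * \<iota> b)) V = arg_block \<Lambda> (a(s := x)) V * b"
proof -
  have *: "{v\<in>V. s < v} = {}" using assms(3) by force
  show ?thesis
  using \<Lambda> unfolding arg_block_upd[OF assms(1,2)] * quasi_multilinear_def by simp
qed

lemma arg_block_middle:
  assumes "finite V" "s \<in> V" "t \<in> V" "s < t" "\<And>v. v \<in> V \<Longrightarrow> s < v \<Longrightarrow> t \<le> v"
  shows "arg_block \<Lambda> (a(s := a s * \<iota> b)) V = arg_block \<Lambda> (a(t := \<iota> b * a t)) V"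
proof -
  have 1: "sorted_list_of_set {v\<in>V. s < v} = t # sorted_list_of_set {v\<in>V. t < v}"
  proof -
    have "{v\<in>{v\<in>V. s < v}. v < t} = {}" "{v\<in>{v\<in>V. s < v}. t < v} = {v\<in>V. t < v}"
      using assms by force+
    then show ?thesis
      using assms by (subst sorted_list_of_set_split[of _ t]) auto
  qed
  have 2: "sorted_list_of_set {v\<in>V. v < t} = sorted_list_of_set {v\<in>V. v < s} @ [s]"
  proof -
    have "{v\<in>{v\<in>V. v < t}. s < v} = {}" "{v\<in>{v\<in>V. v < t}. v < s} = {v\<in>V. v < s}"
      using assms by force+
    then show ?thesis
      using assms by (subst sorted_list_of_set_split[of _ s]) auto
  qed
  show ?thesis
    using \<Lambda> unfolding arg_block_upd[OF assms(1,2)] arg_block_upd[OF assms(1,3)] 1 2 quasi_multilinear_def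
    by simp
qed

end

lemma remove_block_commute:
  assumes \<iota>: "star_hom \<iota>" and \<Lambda>: "quasi_multilinear \<iota> \<Lambda>" and \<pi>: "\<pi> \<in> NC S" "finite S"
    and V: "interval_block \<pi> V" and W: "interval_block \<pi> W"
    and less: "\<And>v w. v \<in> V \<Longrightarrow> w \<in> W \<Longrightarrow> v < w"
    and evW: "\<And>a. eval_partition \<iota> \<Lambda> (\<pi> - {V}) a = remove_block \<iota> \<Lambda> (\<pi> - {V}) W a"
    and evV: "\<And>a. eval_partition \<iota> \<Lambda> (\<pi> - {W}) a = remove_block \<iota> \<Lambda> (\<pi> - {W}) V a"
  shows "remove_block \<iota> \<Lambda> \<pi> V a = remove_block \<iota> \<Lambda> \<pi> W a"
proof -
  note D = NC_D[OF \<pi>(1)] and fin = NC_finite[OF \<pi>]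
  have VW: "V \<in> \<pi>" "W \<in> \<pi>" using V W by (auto simp: interval_block_def)
  have ne: "V \<noteq> {}" "W \<noteq> {}" using D(2) VW by auto
  have fV: "finite V" "finite W" using fin VW by auto
  have VneW: "V \<noteq> W" using less ne by fastforce
  have U: "\<Union>(\<pi> - {V}) = S - V" "\<Union>(\<pi> - {W}) = S - W" "\<Union>(\<pi> - {V} - {W}) = S - V - W"
    using NC_D(1)[OF NC_remove[OF \<pi>(1) VW(1)]] NC_D(1)[OF NC_remove[OF \<pi>(1) VW(2)]]
      NC_D(1)[OF NC_remove[OF NC_remove[OF \<pi>(1) VW(1)], of W]] VneW VW by auto
  have eq: "\<pi> - {W} - {V} = \<pi> - {V} - {W}" by auto
  have WS: "W \<subseteq> S" "V \<subseteq> S" using fin VW by auto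
  have aV: "above_block \<pi> V = {s\<in>S. \<forall>v\<in>V. v < s}" and aW: "above_block \<pi> W = {s\<in>S. \<forall>v\<in>W. v < s}"
    using D(1) by (auto simp: above_block_def)
  have aW': "above_block (\<pi> - {V}) W = above_block \<pi> W"
    unfolding above_block_def U D(1) using less ne by fastforce
  have aV': "above_block (\<pi> - {W}) V = above_block \<pi> V - W"
    unfolding above_block_def U D(1) by auto
  have Wsub: "W \<subseteq> above_block \<pi> V" unfolding aV using WS less by auto
  then have neV: "above_block \<pi> V \<noteq> {}" using ne by auto
  have finU: "finite (\<Union>\<pi>)" using D(1) \<pi>(2) by simp
  define n where "n = Min (above_block \<pi> V)"
  note n = Min_above[OF finU neV, folded n_def]
  have nV: "n \<notin> V" using n(2) by (auto simp: above_block_def)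
  define u where "u = arg_block \<Lambda> a V"
  define w where "w = arg_block \<Lambda> a W"
  have u_upd: "arg_block \<Lambda> (a(s := x)) V = u" if "s \<notin> V" for s x
    unfolding u_def using that by (intro arg_block_cong) auto
  have w_upd: "arg_block \<Lambda> (a(s := x)) W = w" if "s \<notin> W" for s x
    unfolding w_def using that by (intro arg_block_cong) auto
  define m where "m = Min (above_block \<pi> W)"
  have m: "m \<in> S" "\<And>w. w \<in> W \<Longrightarrow> w < m" "m \<notin> W" "m \<notin> V" if "above_block \<pi> W \<noteq> {}"
  proof -
    have "m \<in> above_block \<pi> W" using Min_above(2)[OF finU that] by (simp add: m_def)
    then show "m \<in> S" "\<And>w. w \<in> W \<Longrightarrow> w < m" "m \<notin> W" by (auto simp: aW)
    then show "m \<notin> V" using less ne by fastforce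
  qed
  have cong: "eval_partition \<iota> \<Lambda> (\<pi> - {V} - {W}) f = eval_partition \<iota> \<Lambda> (\<pi> - {V} - {W}) g"
    if "\<And>s. s \<in> S - V - W \<Longrightarrow> f s = g s" for f g
    using that U(3) \<pi>(2) by (intro eval_partition_cong) auto
  have L: "remove_block \<iota> \<Lambda> \<pi> V a = remove_block \<iota> \<Lambda> (\<pi> - {V}) W (a(n := \<iota> u * a n))"
    unfolding remove_block_def[of _ _ \<pi> V] n_def[symmetric] u_def[symmetric] evW using neV by simp
  show ?thesis
  proof (cases "n \<in> W")
    case False
    have n': "above_block \<pi> V - W \<noteq> {}" "Min (above_block \<pi> V - W) = n"
      using n False finU by (auto intro!: Min_eqI finite_subset[OF _ finU] simp: above_block_def)
    have nm: "n \<noteq> m" if "above_block \<pi> W \<noteq> {}"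
    proof -
      obtain x where "x \<in> W" using ne by blast
      then show ?thesis using n(3)[of x] Wsub m(2)[OF that, of x] by auto
    qed
    show ?thesis
    proof (cases "above_block \<pi> W = {}")
      case True
      show ?thesis
        unfolding L unfolding remove_block_def aW' w_upd[OF False]
        using True by (simp add: evV remove_block_def aV' n' n'(1)[simplified] eq flip: u_def w_def)
    next
      case F: False
      show ?thesis
        unfolding L unfolding remove_block_def aW' w_upd[OF False] m_def[symmetric]
        using F nm[OF F] m(4)[OF F] 
        by (simp add: evV remove_block_def aV' n' n'(1)[simplified] eq u_upd fun_upd_twist flip: u_def w_def m_def)
    qed
  next
    case True
    have nmin: "\<And>x. x \<in> W \<Longrightarrow> n \<le> x" using n(3) Wsub by auto
    have w1: "arg_block \<Lambda> (a(n := \<iota> u * a n)) W = u * w"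
      using arg_block_left[OF \<iota> \<Lambda> fV(2) True nmin, of a u "a n"] by (simp add: w_def)
    have aVW: "above_block \<pi> V - W = above_block \<pi> W"
    proof (intro equalityI subsetI)
      fix x assume x: "x \<in> above_block \<pi> V - W"
      have "y < x" if "y \<in> W" for y
      proof (rule ccontr)
        assume "\<not> y < x"
        moreover have "n \<le> x" using n(3) x by auto
        moreover have "n \<noteq> x" "x \<noteq> y" using True x that by auto
        ultimately have "n < x" "x < y" by auto
        moreover have "x \<in> \<Union>\<pi>" using x by (simp add: above_block_def)
        ultimately have "x \<in> W"
          using W True that unfolding interval_block_def by blast
        then show False using x by simp
      qed
      then show "x \<in> above_block \<pi> W" using x by (auto simp: aV aW)
    next
      fix x assume "x \<in> above_block \<pi> W"
      moreover obtain y where "y \<in> W" using ne by blast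
      ultimately show "x \<in> above_block \<pi> V - W"
        using less by (auto simp: aV aW intro: less_trans)
    qed
    show ?thesis
    proof (cases "above_block \<pi> W = {}")
      case T: True
      have "eval_partition \<iota> \<Lambda> (\<pi> - {V} - {W}) (a(n := \<iota> u * a n)) = eval_partition \<iota> \<Lambda> (\<pi> - {V} - {W}) a"
        using True by (intro cong) auto
      then show ?thesis
        unfolding L unfolding remove_block_def aW' w1
        using T by (simp add: evV remove_block_def aV' aVW eq mult.assoc flip: u_def w_def)
    next
      case F: False
      have mn: "m \<noteq> n" using m(3)[OF F] True by auto
      have "eval_partition \<iota> \<Lambda> (\<pi> - {V} - {W}) (a(n := \<iota> u * a n, m := \<iota> (u * w) * a m)) =
          eval_partition \<iota> \<Lambda> (\<pi> - {V} - {W}) (a(m := \<iota> u * (\<iota> w * a m)))"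
        using True by (intro cong) (auto simp: \<iota>_simps[OF \<iota> \<Lambda>] mult.assoc)
      then show ?thesis
        unfolding L unfolding remove_block_def aW' w1 m_def[symmetric]
        using F mn m(4)[OF F]
        by (simp add: evV remove_block_def aV' aVW eq u_upd flip: u_def w_def m_def)
    qed
  qed
qed

lemma eval_partition_interval:
  assumes \<iota>: "star_hom \<iota>" and \<Lambda>: "quasi_multilinear \<iota> \<Lambda>" and \<pi>: "\<pi> \<in> NC S" "finite S"
    and V: "interval_block \<pi> V"
  shows "eval_partition \<iota> \<Lambda> \<pi> a = remove_block \<iota> \<Lambda> \<pi> V a"
  using \<pi> V
proof (induction "card \<pi>" arbitrary: \<pi> S V a rule: less_induct)
  case less
  note fin = NC_finite[OF less.prems(1,2)] and D = NC_D[OF less.prems(1)]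
  obtain W where W: "interval_block \<pi> W"
    and ev: "\<And>\<Lambda> a. eval_partition \<iota> \<Lambda> \<pi> a = remove_block \<iota> \<Lambda> \<pi> W a"
    using eval_partition_some[of \<pi> \<iota>] fin(1) less.prems(3) by blast
  show ?case
  proof (cases "V = W")
    case True
    then show ?thesis by (simp add: ev)
  next
    case False
    have VW: "V \<in> \<pi>" "W \<in> \<pi>" using less.prems(3) W by (auto simp: interval_block_def)
    have c: "card (\<pi> - {V}) < card \<pi>" "card (\<pi> - {W}) < card \<pi>"
      using fin(1) VW by (meson card_Diff1_less)+
    have evW: "eval_partition \<iota> \<Lambda> (\<pi> - {V}) a = remove_block \<iota> \<Lambda> (\<pi> - {V}) W a" for a
      using less.hyps[OF c(1) NC_remove[OF less.prems(1) VW(1)]] less.prems(2)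
        interval_block_remove[OF W] False by auto
    have evV: "eval_partition \<iota> \<Lambda> (\<pi> - {W}) a = remove_block \<iota> \<Lambda> (\<pi> - {W}) V a" for a
      using less.hyps[OF c(2) NC_remove[OF less.prems(1) VW(2)]] less.prems(2)
        interval_block_remove[OF less.prems(3)] False by auto
    have ne: "V \<noteq> {}" "W \<noteq> {}" using D(2) VW by auto
    have dis: "V \<inter> W = {}" using D(3) VW False by auto
    have "(\<forall>v\<in>V. \<forall>w\<in>W. v < w) \<or> (\<forall>v\<in>V. \<forall>w\<in>W. w < v)"
    proof (rule ccontr)
      assume "\<not> ?thesis"
      then obtain v w v' w' where vw: "v \<in> V" "w \<in> W" "\<not> v < w" "v' \<in> V" "w' \<in> W" "\<not> w' < v'" by blast
      have *: "x < y \<or> y < x" if "x \<in> V" "y \<in> W" for x y using dis that by (metis IntI empty_iff nat_neq_iff)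
      have iV: "y \<in> V" if "x \<in> V" "z \<in> V" "x < y" "y < z" "y \<in> W" for x y z
        using less.prems(3) that VW unfolding interval_block_def by blast
      have iW: "y \<in> W" if "x \<in> W" "z \<in> W" "x < y" "y < z" "y \<in> V" for x y z
        using W that VW unfolding interval_block_def by blast
      have 1: "w < v" "v' < w'" using vw * by blast+
      show False
      proof (cases "v' < w")
        case True then show False using iV[OF vw(4,1) True 1(1) vw(2)] vw dis by auto
      next
        case F: False
        then have "w < v'" using *[OF vw(4,2)] by auto
        then show False using iW[OF vw(2,5) _ 1(2) vw(4)] vw dis by auto
      qed
    qed
    then show ?thesis
    proof
      assume l: "\<forall>v\<in>V. \<forall>w\<in>W. v < w"
      show ?thesis unfolding ev
        by (rule remove_block_commute[OF \<iota> \<Lambda> less.prems(1,2,3) W _ evW evV, symmetric]) (use l in auto)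
    next
      assume l: "\<forall>v\<in>V. \<forall>w\<in>W. w < v"
      show ?thesis unfolding ev
        by (rule remove_block_commute[OF \<iota> \<Lambda> less.prems(1,2) W less.prems(3) _ evV evW]) (use l in auto)
    qed
  qed
qed

lemma scaleC_zero_right: "scaleC z (0::'a::star_algebra_1) = 0"
  using scaleC_add_right[of z "0::'a" 0] by simp

lemma NC_cases:
  fixes \<iota> :: "'b::star_algebra_1 \<Rightarrow> 'a::star_algebra_1"
  assumes \<pi>: "\<pi> \<in> NC S" "finite S" "\<pi> \<noteq> {}"
  obtains V n where "V \<in> \<pi>" "interval_block \<pi> V" "V \<noteq> {}" "finite V" "V \<subseteq> S" "\<pi> - {V} \<in> NC (S - V)"
    "card (\<pi> - {V}) < card \<pi>" "above_block \<pi> V \<noteq> {}" "n = Min (above_block \<pi> V)"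
    "n \<in> S - V" "\<And>v. v \<in> V \<Longrightarrow> v < n" "\<And>s. s \<in> S \<Longrightarrow> (\<And>v. v \<in> V \<Longrightarrow> v < s) \<Longrightarrow> n \<le> s"
    "\<And>\<Lambda> a. eval_partition \<iota> \<Lambda> \<pi> a =
       eval_partition \<iota> \<Lambda> (\<pi> - {V}) (a(n := \<iota> (arg_block \<Lambda> a V) * a n))"
  | V where "V \<in> \<pi>" "interval_block \<pi> V" "V \<noteq> {}" "finite V" "V \<subseteq> S" "\<pi> - {V} \<in> NC (S - V)"
    "card (\<pi> - {V}) < card \<pi>" "\<And>s v. s \<in> S - V \<Longrightarrow> v \<in> V \<Longrightarrow> s < v"
    "\<And>\<Lambda> a. eval_partition \<iota> \<Lambda> \<pi> a = eval_partition \<iota> \<Lambda> (\<pi> - {V}) a * arg_block \<Lambda> a V"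
proof -
  note D = NC_D[OF \<pi>(1)] and fin = NC_finite[OF \<pi>(1,2)]
  obtain V where V: "interval_block \<pi> V"
    and ev: "\<And>\<Lambda> a. eval_partition \<iota> \<Lambda> \<pi> a = remove_block \<iota> \<Lambda> \<pi> V a"
    using eval_partition_some[of \<pi> \<iota>] fin(1) interval_block_exists[OF \<pi>] by blast
  have V\<pi>: "V \<in> \<pi>" using V by (simp add: interval_block_def)
  have ne: "V \<noteq> {}" using D(2) V\<pi> by auto
  have fV: "finite V" "V \<subseteq> S" using fin V\<pi> by auto
  have c: "card (\<pi> - {V}) < card \<pi>" by (rule card_Diff1_less[OF fin(1) V\<pi>])
  have finU: "finite (\<Union>\<pi>)" using D(1) \<pi>(2) by simp
  show thesis
  proof (cases "above_block \<pi> V = {}")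
    case True
    have "s < v" if s: "s \<in> S - V" and v: "v \<in> V" for s v
    proof (rule ccontr)
      assume "\<not> s < v"
      with s v have vs: "v < s" using nat_neq_iff by blast
      have "w < s" if "w \<in> V" for w
      proof (rule ccontr)
        assume "\<not> w < s"
        with that s have "s < w" using nat_neq_iff by blast
        moreover have "s \<in> \<Union>\<pi>" using s D(1) by simp
        ultimately have "s \<in> V" using V v that vs unfolding interval_block_def by blast
        then show False using s by simp
      qed
      then have "s \<in> above_block \<pi> V" using s D(1) by (simp add: above_block_def)
      then show False using True by simp
    qed
    then show thesis
      by (rule that(2)[OF V\<pi> V ne fV NC_remove[OF \<pi>(1) V\<pi>] c]) (use True in \<open>simp_all add: ev remove_block_def\<close>)
  next
    case False
    note n = Min_above[OF finU False]
    show thesis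
    proof (rule that(1)[OF V\<pi> V ne fV NC_remove[OF \<pi>(1) V\<pi>] c False refl])
      show "Min (above_block \<pi> V) \<in> S - V" using n(2) D(1) by (auto simp: above_block_def)
      show "v < Min (above_block \<pi> V)" if "v \<in> V" for v using n(2) that by (auto simp: above_block_def)
      show "Min (above_block \<pi> V) \<le> s" if "s \<in> S" "\<And>v. v \<in> V \<Longrightarrow> v < s" for s
        using n(3)[of s] that D(1) by (auto simp: above_block_def)
      show "eval_partition \<iota> \<Lambda> \<pi> a = eval_partition \<iota> \<Lambda> (\<pi> - {V})
          (a(Min (above_block \<pi> V) := \<iota> (arg_block \<Lambda> a V) * a (Min (above_block \<pi> V))))" for \<Lambda> a
        unfolding ev remove_block_def using False by simp
    qed
  qed
qed

lemma eval_NC_cong: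
  assumes "\<pi> \<in> NC S" "finite S" "\<And>s. s \<in> S \<Longrightarrow> a s = a' s"
  shows "eval_partition \<iota> \<Lambda> \<pi> a = eval_partition \<iota> \<Lambda> \<pi> a'"
  using assms NC_D(1)[OF assms(1)] by (intro eval_partition_cong) auto

context
  fixes \<iota> :: "'b::star_algebra_1 \<Rightarrow> 'a::star_algebra_1" and \<Lambda>
  assumes \<iota>: "star_hom \<iota>" and \<Lambda>: "quasi_multilinear \<iota> \<Lambda>"
begin

lemma arg_block_other: "s \<notin> V \<Longrightarrow> arg_block \<Lambda> (a(s := x)) V = arg_block \<Lambda> a V"
  by (intro arg_block_cong) auto

lemma eval_partition_linear:
  assumes "\<pi> \<in> NC S" "finite S" "s \<in> S"
  shows "eval_partition \<iota> \<Lambda> \<pi> (a(s := scaleC z x + y)) =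
    scaleC z (eval_partition \<iota> \<Lambda> \<pi> (a(s := x))) + eval_partition \<iota> \<Lambda> \<pi> (a(s := y))"
  using assms
proof (induction "card \<pi>" arbitrary: \<pi> S a x y s rule: less_induct)
  case less
  have "\<pi> \<noteq> {}" using NC_D(1)[OF less.prems(1)] less.prems(3) by auto
  note lin = arg_block_add[OF \<iota> \<Lambda>] arg_block_scale[OF \<iota> \<Lambda>] \<iota>_simps[OF \<iota> \<Lambda>]
    scaleC_add_right mult_scaleC_left mult_scaleC_right distrib_left distrib_right
  from less.prems(1,2) \<open>\<pi> \<noteq> {}\<close> show ?case
  proof (cases rule: NC_cases[where \<iota> = \<iota>])
    case (1 V n)
    have fin: "finite (S - V)" using less.prems(2) by simp
    note IH = less.hyps[OF 1(7,6) fin] and ev = 1(13)[of \<Lambda>]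
    note cong = eval_NC_cong[OF 1(6) fin, of _ _ \<iota> \<Lambda>]
    show ?thesis
    proof (cases "s \<in> V")
      case True
      then have sn: "n \<noteq> s" using 1 by auto
      have drop: "eval_partition \<iota> \<Lambda> (\<pi> - {V}) (a(s := c, n := d)) = eval_partition \<iota> \<Lambda> (\<pi> - {V}) (a(n := d))" for c d
        by (rule cong) (use True in auto)
      show ?thesis
        unfolding ev using sn True 1(4) IH[OF 1(10), of a]
        by (simp add: drop lin)
    next
      case False
      show ?thesis
      proof (cases "s = n")
        case True
        then show ?thesis
          unfolding ev using IH[OF 1(10), of a] False by (simp add: arg_block_other lin)
      next
        case F: False
        have tw: "a(s := c, n := d) = a(n := d, s := c)" for c d using F by (simp add: fun_upd_twist)
        show ?thesis
          unfolding ev using F False IH[of s] less.prems(3) by (simp add: tw arg_block_other del: fun_upd_apply) (simp add: tw)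
      qed
    qed
  next
    case (2 V)
    have fin: "finite (S - V)" using less.prems(2) by simp
    note IH = less.hyps[OF 2(7,6) fin] and ev = 2(9)[of \<Lambda>]
    note cong = eval_NC_cong[OF 2(6) fin, of _ _ \<iota> \<Lambda>]
    show ?thesis
    proof (cases "s \<in> V")
      case True
      have drop: "eval_partition \<iota> \<Lambda> (\<pi> - {V}) (a(s := c)) = eval_partition \<iota> \<Lambda> (\<pi> - {V}) a" for c
        by (rule cong) (use True in auto)
      show ?thesis unfolding ev using True 2(4) by (simp add: drop lin)
    next
      case False
      then show ?thesis unfolding ev using IH[of s a] less.prems(3) by (simp add: arg_block_other lin)
    qed
  qed
qed

lemma eval_partition_left:
  assumes "\<pi> \<in> NC S" "finite S" "s \<in> S" "\<And>t. t \<in> S \<Longrightarrow> s \<le> t"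
  shows "eval_partition \<iota> \<Lambda> \<pi> (a(s := \<iota> b * x)) = b * eval_partition \<iota> \<Lambda> \<pi> (a(s := x))"
  using assms
proof (induction "card \<pi>" arbitrary: \<pi> S a x s b rule: less_induct)
  case less
  have "\<pi> \<noteq> {}" using NC_D(1)[OF less.prems(1)] less.prems(3) by auto
  note lin = \<iota>_simps[OF \<iota> \<Lambda>]
  from less.prems(1,2) \<open>\<pi> \<noteq> {}\<close> show ?case
  proof (cases rule: NC_cases[where \<iota> = \<iota>])
    case (1 V n)
    have fin: "finite (S - V)" using less.prems(2) by simp
    note IH = less.hyps[OF 1(7,6) fin] and ev = 1(13)[of \<Lambda>]
    note cong = eval_NC_cong[OF 1(6) fin, of _ _ \<iota> \<Lambda>]
    have sn: "n \<noteq> s" using 1(3,5,11) less.prems(4) by (metis all_not_in_conv leD subsetD)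
    show ?thesis
    proof (cases "s \<in> V")
      case True
      have drop: "eval_partition \<iota> \<Lambda> (\<pi> - {V}) (a(s := c, n := d)) = eval_partition \<iota> \<Lambda> (\<pi> - {V}) (a(n := d))" for c d
        by (rule cong) (use True in auto)
      have sV: "v \<in> V \<Longrightarrow> s \<le> v" for v using 1(5) less.prems(4) by auto
      have nmin: "n \<le> t" if t: "t \<in> S - V" for t
      proof (rule 1(12))
        show "t \<in> S" using t by simp
        show "v < t" if "v \<in> V" for v
        proof (rule ccontr)
          assume "\<not> v < t"
          moreover have "v \<noteq> t" using t that by auto
          ultimately have "t < v" by simp
          moreover have "s < t" using t True less.prems(4)[of t] by (cases "s = t") auto
          moreover have "t \<in> \<Union>\<pi>" using t NC_D(1)[OF less.prems(1)] by simp
          ultimately have "t \<in> V" using 1(2) True that unfolding interval_block_def by blast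
          then show False using t by simp
        qed
      qed
      show ?thesis
        unfolding ev using sn True IH[OF 1(10) nmin, of a]
        by (simp add: drop lin arg_block_left[OF \<iota> \<Lambda> 1(4) True sV] mult.assoc)
    next
      case False
      have tw: "a(s := c, n := d) = a(n := d, s := c)" for c d using sn by (simp add: fun_upd_twist)
      have "s \<in> S - V" using less.prems(3) False by simp
      from IH[OF this] less.prems(4) show ?thesis
        unfolding ev using sn False by (simp add: tw arg_block_other)
    qed
  next
    case (2 V)
    have fin: "finite (S - V)" using less.prems(2) by simp
    note IH = less.hyps[OF 2(7,6) fin] and ev = 2(9)[of \<Lambda>]
    show ?thesis
    proof (cases "s \<in> V")
      case True
      have "S - V = {}" using 2(8)[OF _ True] less.prems(4) by fastforce
      then have "\<Union>(\<pi> - {V}) = {}" using NC_D(1)[OF 2(6)] by simp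
      then have e: "\<pi> - {V} = {}" using NC_D(2)[OF 2(6)] by (metis Union_empty_conv ex_in_conv)
      have sV: "v \<in> V \<Longrightarrow> s \<le> v" for v using 2(5) less.prems(4) by auto
      show ?thesis unfolding ev e eval_partition_empty
        by (simp add: arg_block_left[OF \<iota> \<Lambda> 2(4) True sV])
    next
      case False
      then show ?thesis unfolding ev using IH[of s] less.prems(3,4) by (simp add: arg_block_other mult.assoc)
    qed
  qed
qed

lemma eval_partition_right:
  assumes "\<pi> \<in> NC S" "finite S" "s \<in> S" "\<And>t. t \<in> S \<Longrightarrow> t \<le> s"
  shows "eval_partition \<iota> \<Lambda> \<pi> (a(s := x * \<iota> b)) = eval_partition \<iota> \<Lambda> \<pi> (a(s := x)) * b"
  using assms
proof (induction "card \<pi>" arbitrary: \<pi> S a x s b rule: less_induct)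
  case less
  have "\<pi> \<noteq> {}" using NC_D(1)[OF less.prems(1)] less.prems(3) by auto
  from less.prems(1,2) \<open>\<pi> \<noteq> {}\<close> show ?case
  proof (cases rule: NC_cases[where \<iota> = \<iota>])
    case (1 V n)
    have fin: "finite (S - V)" using less.prems(2) by simp
    note IH = less.hyps[OF 1(7,6) fin] and ev = 1(13)[of \<Lambda>]
    have sV: "s \<notin> V" using 1(10,11) less.prems(4) by fastforce
    have s: "s \<in> S - V" using less.prems(3) sV by simp
    show ?thesis
    proof (cases "s = n")
      case True
      from IH[OF s, of a "\<iota> c * x" b for c] less.prems(4) show ?thesis
        unfolding ev using sV True by (simp add: arg_block_other mult.assoc)
    next
      case False
      have tw: "a(s := c, n := d) = a(n := d, s := c)" for c d using False by (simp add: fun_upd_twist)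
      from IH[OF s] less.prems(4) show ?thesis
        unfolding ev using sV False by (simp add: tw arg_block_other)
    qed
  next
    case (2 V)
    have fin: "finite (S - V)" using less.prems(2) by simp
    note ev = 2(9)[of \<Lambda>]
    note cong = eval_NC_cong[OF 2(6) fin, of _ _ \<iota> \<Lambda>]
    have True: "s \<in> V"
      using 2(3,5,8) less.prems(3,4) by (metis Diff_iff all_not_in_conv leD subsetD)
    have drop: "eval_partition \<iota> \<Lambda> (\<pi> - {V}) (a(s := c)) = eval_partition \<iota> \<Lambda> (\<pi> - {V}) a" for c
      by (rule cong) (use True in auto)
    have sV: "v \<in> V \<Longrightarrow> v \<le> s" for v using 2(5) less.prems(4) by auto
    show ?thesis unfolding ev by (simp add: drop arg_block_right[OF \<iota> \<Lambda> 2(4) True sV] mult.assoc)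
  qed
qed

lemma eval_partition_middle:
  assumes "\<pi> \<in> NC S" "finite S" "s \<in> S" "t \<in> S" "s < t" "\<And>r. r \<in> S \<Longrightarrow> s < r \<Longrightarrow> t \<le> r"
  shows "eval_partition \<iota> \<Lambda> \<pi> (a(s := a s * \<iota> b)) = eval_partition \<iota> \<Lambda> \<pi> (a(t := \<iota> b * a t))"
  using assms
proof (induction "card \<pi>" arbitrary: \<pi> S a s t b rule: less_induct)
  case less
  have "\<pi> \<noteq> {}" using NC_D(1)[OF less.prems(1)] less.prems(3) by auto
  note lin = \<iota>_simps[OF \<iota> \<Lambda>]
  note st = less.prems(3-6)
  from less.prems(1,2) \<open>\<pi> \<noteq> {}\<close> show ?case
  proof (cases rule: NC_cases[where \<iota> = \<iota>])
    case (1 V n)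
    have fin: "finite (S - V)" using less.prems(2) by simp
    note IH = less.hyps[OF 1(7,6) fin] and ev = 1(13)[of \<Lambda>]
    note cong = eval_NC_cong[OF 1(6) fin, of _ _ \<iota> \<Lambda>]
    have drop: "eval_partition \<iota> \<Lambda> (\<pi> - {V}) (a(r := c, n := d)) = eval_partition \<iota> \<Lambda> (\<pi> - {V}) (a(n := d))"
      if "r \<in> V" for r c d
      by (rule cong) (use that in auto)
    have nV: "n \<notin> V" using 1(10) by simp
    consider (both) "s \<in> V" "t \<in> V" | (s) "s \<in> V" "t \<notin> V" | (t) "s \<notin> V" "t \<in> V" | (none) "s \<notin> V" "t \<notin> V"
      by blast
    then show ?thesis
    proof cases
      case both
      have "v \<in> V \<Longrightarrow> s < v \<Longrightarrow> t \<le> v" for v using st 1(5) by auto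
      from arg_block_middle[OF \<iota> \<Lambda> 1(4) both st(3) this] both nV show ?thesis
        unfolding ev by (auto simp: drop)
    next
      case s
      have nt: "n = t"
      proof (rule antisym)
        show "t \<le> n" by (rule st(4)) (use 1(10,11) s in auto)
        show "n \<le> t"
        proof (rule 1(12)[OF st(2)])
          fix v assume v: "v \<in> V"
          show "v < t"
          proof (rule ccontr)
            assume "\<not> v < t"
            moreover have "v \<noteq> t" using v s by auto
            ultimately have "t < v" by simp
            moreover have "t \<in> \<Union>\<pi>" using st NC_D(1)[OF less.prems(1)] by simp
            ultimately have "t \<in> V" using 1(2) s(1) v st(3) unfolding interval_block_def by blast
            then show False using s by simp
          qed
        qed
      qed
      have "v \<le> s" if "v \<in> V" for v using st(4)[of v] 1(5,11) that nt by fastforce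
      from arg_block_right[OF \<iota> \<Lambda> 1(4) s(1) this] s nV nt st(3) show ?thesis
        unfolding ev by (simp add: drop[OF s(1), unfolded nt] lin arg_block_other mult.assoc)
    next
      case t
      have tV: "t \<le> v" if v: "v \<in> V" for v
      proof (rule ccontr)
        assume "\<not> t \<le> v"
        then have "v < t" "v \<le> s" using st(4)[of v] 1(5) v by fastforce+
        then have "v < s" using t v by (auto simp: le_less)
        moreover have "s \<in> \<Union>\<pi>" using st NC_D(1)[OF less.prems(1)] by simp
        ultimately have "s \<in> V" using 1(2) t v st(3) unfolding interval_block_def by blast
        then show False using t by simp
      qed
      have sn: "s < n" using 1(11)[OF t(2)] st(3) by simp
      have "n \<le> r" if r: "r \<in> S - V" "s < r" for r
      proof (rule 1(12))
        show "r \<in> S" using r by simp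
        show "v < r" if v: "v \<in> V" for v
        proof (rule ccontr)
          assume "\<not> v < r"
          moreover have "v \<noteq> r" using v r by auto
          ultimately have "r < v" by simp
          moreover have "t < r" using st(4)[of r] r t by (cases "t = r") auto
          moreover have "r \<in> \<Union>\<pi>" using r NC_D(1)[OF less.prems(1)] by simp
          ultimately have "r \<in> V" using 1(2) t v unfolding interval_block_def by blast
          then show False using r by simp
        qed
      qed
      then have IH': "eval_partition \<iota> \<Lambda> (\<pi> - {V}) (f(s := f s * \<iota> b)) = eval_partition \<iota> \<Lambda> (\<pi> - {V}) (f(n := \<iota> b * f n))" for f
        using IH[of s n f b] st(1) t(1) 1(10) sn by auto
      have tw: "a(s := c, n := d) = a(n := d, s := c)" for c d using sn by (simp add: fun_upd_twist)
      have "n \<noteq> t" using t nV by auto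
      then show ?thesis
        unfolding ev using IH'[of "a(n := d)" for d] t sn
        by (simp add: arg_block_other arg_block_left[OF \<iota> \<Lambda> 1(4) t(2) tV] drop tw lin mult.assoc)
    next
      case none
      have nt: "n \<noteq> t"
      proof
        assume "n = t"
        obtain v where v: "v \<in> V" using 1(3) by blast
        have "v \<le> s" if "v \<in> V" for v using st(4)[of v] 1(5,11) that \<open>n = t\<close> by fastforce
        then have "v < s" if "v \<in> V" for v using that none by (auto simp: le_less)
        then have "n \<le> s" using 1(12)[OF st(1)] by simp
        then show False using st(3) \<open>n = t\<close> by simp
      qed
      have IH': "eval_partition \<iota> \<Lambda> (\<pi> - {V}) (f(s := f s * \<iota> b)) = eval_partition \<iota> \<Lambda> (\<pi> - {V}) (f(t := \<iota> b * f t))" for f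
        using IH[of s t f b] st none by auto
      show ?thesis
      proof (cases "n = s")
        case True
        then show ?thesis
          unfolding ev using IH'[of "a(n := \<iota> (arg_block \<Lambda> a V) * a n)"] none nt
            fun_upd_twist[OF nt, of a]
          by (simp add: arg_block_other mult.assoc)
      next
        case False
        have tw: "a(s := c, n := d) = a(n := d, s := c)" "a(t := c, n := d) = a(n := d, t := c)" for c d
          using False nt by (simp_all add: fun_upd_twist)
        show ?thesis
          unfolding ev using IH'[of "a(n := d)" for d] none nt False
          by (simp add: arg_block_other tw)
      qed
    qed
  next
    case (2 V)
    have fin: "finite (S - V)" using less.prems(2) by simp
    note IH = less.hyps[OF 2(7,6) fin] and ev = 2(9)[of \<Lambda>]
    note cong = eval_NC_cong[OF 2(6) fin, of _ _ \<iota> \<Lambda>]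
    have drop: "eval_partition \<iota> \<Lambda> (\<pi> - {V}) (a(r := c)) = eval_partition \<iota> \<Lambda> (\<pi> - {V}) a"
      if "r \<in> V" for r c
      by (rule cong) (use that in auto)
    consider (both) "s \<in> V" "t \<in> V" | (s) "s \<in> V" "t \<notin> V" | (t) "s \<notin> V" "t \<in> V" | (none) "s \<notin> V" "t \<notin> V"
      by blast
    then show ?thesis
    proof cases
      case both
      have "v \<in> V \<Longrightarrow> s < v \<Longrightarrow> t \<le> v" for v using st 2(5) by auto
      from arg_block_middle[OF \<iota> \<Lambda> 2(4) both st(3) this] both show ?thesis
        unfolding ev by (simp add: drop)
    next
      case s
      then show ?thesis using 2(8)[of t s] st by auto
    next
      case t
      have tV: "t \<le> v" if v: "v \<in> V" for v using st(4)[of v] 2(8)[of s v] v st(1) t 2(5) by auto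
      have "r \<le> s" if r: "r \<in> S - V" for r using st(4)[of r] r 2(8)[OF r t(2)] by fastforce
      then have "eval_partition \<iota> \<Lambda> (\<pi> - {V}) (a(s := a s * \<iota> b)) = eval_partition \<iota> \<Lambda> (\<pi> - {V}) (a(s := a s)) * b"
        using st(1) t by (intro eval_partition_right[OF 2(6) fin]) auto
      then show ?thesis
        unfolding ev using t by (simp add: arg_block_other arg_block_left[OF \<iota> \<Lambda> 2(4) t(2) tV] drop mult.assoc)
    next
      case none
      then show ?thesis unfolding ev using IH[of s t a b] st by (auto simp: arg_block_other)
    qed
  qed
qed

end

definition eval_list ::
    "('b \<Rightarrow> 'a) \<Rightarrow> ('a::star_algebra_1 list \<Rightarrow> 'b::star_algebra_1) \<Rightarrow> nat set set \<Rightarrow> 'a list \<Rightarrow> 'b" where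
  "eval_list \<iota> \<Lambda> \<pi> as = eval_partition \<iota> \<Lambda> \<pi> (\<lambda>i. as ! (i - 1))"

lemma nth_upd:
  assumes "i \<in> {1..length (xs @ x # ys)}"
  shows "(xs @ x # ys) ! (i - 1) = ((\<lambda>i. (xs @ z # ys) ! (i - 1))(Suc (length xs) := x)) i"
  using assms by (auto simp: nth_append nth_Cons split: nat.split)

lemma eval_list_upd:
  assumes "\<pi> \<in> NC {1..length (xs @ x # ys)}"
  shows "eval_list \<iota> \<Lambda> \<pi> (xs @ x # ys) =
    eval_partition \<iota> \<Lambda> \<pi> ((\<lambda>i. (xs @ z # ys) ! (i - 1))(Suc (length xs) := x))"
  unfolding eval_list_def
  by (rule eval_NC_cong[OF assms finite_atLeastAtMost nth_upd])

context
  fixes \<iota> :: "'b::star_algebra_1 \<Rightarrow> 'a::star_algebra_1" and \<Lambda>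
  assumes \<iota>: "star_hom \<iota>" and \<Lambda>: "quasi_multilinear \<iota> \<Lambda>"
begin

lemma eval_list_linear:
  assumes "\<pi> \<in> NC {1..length (xs @ x # ys)}"
  shows "eval_list \<iota> \<Lambda> \<pi> (xs @ (scaleC z x + y) # ys) =
    scaleC z (eval_list \<iota> \<Lambda> \<pi> (xs @ x # ys)) + eval_list \<iota> \<Lambda> \<pi> (xs @ y # ys)"
proof -
  have \<pi>: "\<pi> \<in> NC {1..length (xs @ u # ys)}" for u using assms by simp
  show ?thesis
    unfolding eval_list_upd[OF \<pi>, where z = x]
    by (rule eval_partition_linear[OF \<iota> \<Lambda> assms]) auto
qed

lemma eval_list_add:
  assumes "\<pi> \<in> NC {1..length (xs @ x # ys)}"
  shows "eval_list \<iota> \<Lambda> \<pi> (xs @ (x + y) # ys) =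
    eval_list \<iota> \<Lambda> \<pi> (xs @ x # ys) + eval_list \<iota> \<Lambda> \<pi> (xs @ y # ys)"
  using eval_list_linear[OF assms, of 1 y] by (simp add: scaleC_one)

lemma eval_list_scale:
  assumes "\<pi> \<in> NC {1..length (xs @ x # ys)}"
  shows "eval_list \<iota> \<Lambda> \<pi> (xs @ scaleC z x # ys) = scaleC z (eval_list \<iota> \<Lambda> \<pi> (xs @ x # ys))"
proof -
  have "eval_list \<iota> \<Lambda> \<pi> (xs @ 0 # ys) = 0"
    using eval_list_add[of \<pi> xs 0 ys 0] assms by simp
  then show ?thesis using eval_list_linear[OF assms, of z 0] by simp
qed

lemma eval_list_left:
  assumes "\<pi> \<in> NC {1..length (x # xs)}"
  shows "eval_list \<iota> \<Lambda> \<pi> (\<iota> b * x # xs) = b * eval_list \<iota> \<Lambda> \<pi> (x # xs)"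
proof -
  have \<pi>: "\<pi> \<in> NC {1..length ([] @ u # xs)}" for u using assms by simp
  note u = eval_list_upd[OF \<pi>, where z = x and \<iota> = \<iota> and \<Lambda> = \<Lambda>, simplified]
  show ?thesis
    unfolding u by (rule eval_partition_left[OF \<iota> \<Lambda> assms]) auto
qed

lemma eval_list_right:
  assumes "\<pi> \<in> NC {1..length (xs @ [x])}"
  shows "eval_list \<iota> \<Lambda> \<pi> (xs @ [x * \<iota> b]) = eval_list \<iota> \<Lambda> \<pi> (xs @ [x]) * b"
proof -
  have \<pi>: "\<pi> \<in> NC {1..length (xs @ u # [])}" for u using assms by simp
  show ?thesis
    unfolding eval_list_upd[OF \<pi>, where z = x]
    by (rule eval_partition_right[OF \<iota> \<Lambda> assms]) auto
qed

lemma eval_list_middle: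
  assumes "\<pi> \<in> NC {1..length (xs @ x # y # ys)}"
  shows "eval_list \<iota> \<Lambda> \<pi> (xs @ x * \<iota> b # y # ys) = eval_list \<iota> \<Lambda> \<pi> (xs @ x # \<iota> b * y # ys)"
proof -
  define a where "a = (\<lambda>i. (xs @ x # y # ys) ! (i - 1))"
  have ax: "a (Suc (length xs)) = x" "a (Suc (Suc (length xs))) = y"
    by (simp_all add: a_def nth_append)
  have \<pi>: "\<pi> \<in> NC {1..length (xs @ u # y # ys)}" "\<pi> \<in> NC {1..length ((xs @ [x]) @ u # ys)}" for u
    using assms by simp_all
  have "eval_list \<iota> \<Lambda> \<pi> (xs @ x * \<iota> b # y # ys) =
      eval_partition \<iota> \<Lambda> \<pi> (a(Suc (length xs) := a (Suc (length xs)) * \<iota> b))"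
    using eval_list_upd[OF \<pi>(1)[of "x * \<iota> b"], where z = x and \<iota> = \<iota> and \<Lambda> = \<Lambda>] by (simp add: a_def nth_append)
  also have "\<dots> = eval_partition \<iota> \<Lambda> \<pi> (a(Suc (Suc (length xs)) := \<iota> b * a (Suc (Suc (length xs)))))"
    by (rule eval_partition_middle[OF \<iota> \<Lambda> assms]) auto
  also have "\<dots> = eval_list \<iota> \<Lambda> \<pi> (xs @ x # \<iota> b * y # ys)"
    using eval_list_upd[OF \<pi>(2)[of "\<iota> b * y"], where z = y and \<iota> = \<iota> and \<Lambda> = \<Lambda>] ax by (simp add: a_def)
  finally show ?thesis .
qed

end

lemma finite_NC: "finite S \<Longrightarrow> finite (NC S)"
  by (rule finite_subset[of _ "Pow (Pow S)"]) (auto simp: NC_def partition_on_def)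

lemma NC_top: "S \<noteq> {} \<Longrightarrow> {S} \<in> NC S"
  by (auto simp: NC_def partition_on_def)

lemma eval_list_top:
  assumes "as \<noteq> []"
  shows "eval_list \<iota> \<Lambda> {{1..length as}} as = \<Lambda> as"
proof -
  have i: "\<exists>V. interval_block {{1..length as}} V" by (auto simp: interval_block_def)
  obtain V where V: "interval_block {{1..length as}} V"
    and ev: "\<And>\<Lambda> a. eval_partition \<iota> \<Lambda> {{1..length as}} a = remove_block \<iota> \<Lambda> {{1..length as}} V a"
    using eval_partition_some[OF _ i, where \<iota> = \<iota>] by blast
  have V': "V = {1..length as}" using V by (simp add: interval_block_def)
  have "1 \<in> V" "length as \<in> V" using assms V' by (auto simp: Suc_le_eq)
  then have a: "above_block {{1..length as}} V = {}"
    unfolding above_block_def using V' by auto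
  have "map (\<lambda>i. as ! (i - 1)) [1..<Suc (length as)] = as"
    by (rule nth_equalityI) (auto simp del: upt_Suc)
  moreover have "sorted_list_of_set V = [1..<Suc (length as)]"
    unfolding V' by (metis atLeastLessThanSuc_atLeastAtMost sorted_list_of_set_range)
  ultimately show ?thesis
    unfolding eval_list_def ev remove_block_def a by (simp add: V' eval_partition_empty arg_block_def)
qed

lemma NC_block_card:
  assumes "\<pi> \<in> NC S" "finite S" "\<pi> \<noteq> {S}" "V \<in> \<pi>"
  shows "card V < card S"
proof -
  note D = NC_D[OF assms(1)] and fin = NC_finite[OF assms(1,2)]
  have "V \<noteq> S"
  proof
    assume VS: "V = S"
    have "W = S" if W: "W \<in> \<pi>" for W
    proof (rule ccontr)
      assume "W \<noteq> S"
      then have "W \<inter> S = {}" using D(3)[OF W assms(4)] VS by simp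
      then show False using fin(3)[OF W] D(2) W by (metis inf.absorb1)
    qed
    then show False using assms(3,4) VS by blast
  qed
  then show ?thesis using fin(3)[OF assms(4)] assms(2) by (meson psubsetI psubset_card_mono)
qed

lemma eval_list_cong:
  assumes "\<pi> \<in> NC {1..length as}" "\<pi> \<noteq> {{1..length as}}"
    "\<And>bs. length bs < length as \<Longrightarrow> \<Lambda> bs = \<Lambda>' bs"
  shows "eval_list \<iota> \<Lambda> \<pi> as = eval_list \<iota> \<Lambda>' \<pi> as"
  unfolding eval_list_def
proof (rule eval_partition_cong)
  show "finite (\<Union>\<pi>)" using NC_D(1)[OF assms(1)] by simp
  show "\<Lambda> bs = \<Lambda>' bs" if "V \<in> \<pi>" "length bs = card V" for V bs
    using NC_block_card[OF assms(1) _ assms(2) that(1)] that(2) assms(3) by simp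
qed simp

definition lower_terms ::
    "(nat set set \<Rightarrow> real) \<Rightarrow> ('b \<Rightarrow> 'a) \<Rightarrow> ('a::star_algebra_1 list \<Rightarrow> 'b::cstar_algebra_1) \<Rightarrow> 'a list \<Rightarrow> 'b" where
  "lower_terms \<alpha> \<iota> \<Lambda> as =
     (\<Sum>\<pi>\<in>NC {1..length as} - {{{1..length as}}}. \<alpha> \<pi> *\<^sub>R eval_list \<iota> \<Lambda> \<pi> as)"

lemma lower_cong:
  assumes "\<And>bs. length bs < length as \<Longrightarrow> \<Lambda> bs = \<Lambda>' bs"
  shows "lower_terms \<alpha> \<iota> \<Lambda> as = lower_terms \<alpha> \<iota> \<Lambda>' as"
  unfolding lower_terms_def
  by (rule sum.cong[OF refl]) (use assms in \<open>auto intro!: arg_cong2[where f = scaleR] eval_list_cong\<close>)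

lemma moment_split:
  assumes "as \<noteq> []" "\<alpha> {{1..length as}} = 1"
  shows "(\<Sum>\<pi>\<in>NC {1..length as}. \<alpha> \<pi> *\<^sub>R eval_partition \<iota> \<Lambda> \<pi> (\<lambda>i. as ! (i - 1))) =
    \<Lambda> as + lower_terms \<alpha> \<iota> \<Lambda> as"
proof -
  have "{1..length as} \<noteq> {}" using assms(1) by (simp add: Suc_le_eq)
  then have t: "{{1..length as}} \<in> NC {1..length as}" by (rule NC_top)
  show ?thesis
    unfolding lower_terms_def eval_list_def[symmetric]
    by (subst sum.remove[OF finite_NC t]) (simp_all add: assms(2) eval_list_top[OF assms(1)] del: One_nat_def)
qed

function cumulant_rec ::
    "(nat set set \<Rightarrow> real) \<Rightarrow> ('b \<Rightarrow> 'a) \<Rightarrow> ('a::star_algebra_1 \<Rightarrow> 'b::cstar_algebra_1) \<Rightarrow> 'a list \<Rightarrow> 'b" where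
  "cumulant_rec \<alpha> \<iota> E as = (if as = [] then 0 else E (prod_list as) -
     lower_terms \<alpha> \<iota> (\<lambda>bs. if length bs < length as then cumulant_rec \<alpha> \<iota> E bs else 0) as)"
  by pat_completeness auto
termination by (relation "measure (\<lambda>(_, _, _, as). length as)") auto

declare cumulant_rec.simps [simp del]

lemma cumulant_rec_eq:
  assumes "as \<noteq> []"
  shows "cumulant_rec \<alpha> \<iota> E as = E (prod_list as) - lower_terms \<alpha> \<iota> (cumulant_rec \<alpha> \<iota> E) as"
proof -
  have "lower_terms \<alpha> \<iota> (\<lambda>bs. if length bs < length as then cumulant_rec \<alpha> \<iota> E bs else 0) as =
      lower_terms \<alpha> \<iota> (cumulant_rec \<alpha> \<iota> E) as"
    by (rule lower_cong) simp
  then show ?thesis using assms by (subst cumulant_rec.simps) simp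
qed

lemma is_cumulants_unique:
  assumes "\<And>l. l \<ge> 1 \<Longrightarrow> \<alpha> {{1..l}} = 1" "is_cumulants \<alpha> \<iota> E K" "is_cumulants \<alpha> \<iota> E K'"
  shows "K = K'"
proof
  fix as
  have step: "K as = E (prod_list as) - lower_terms \<alpha> \<iota> K as"
    if "is_cumulants \<alpha> \<iota> E K" "as \<noteq> []" for K as
  proof -
    have l: "1 \<le> length as" using that(2) by (simp add: Suc_le_eq)
    show ?thesis
      using that moment_split[where as = as and \<alpha> = \<alpha> and \<iota> = \<iota> and \<Lambda> = K, OF that(2) assms(1)[OF l]]
      by (simp add: is_cumulants_def)
  qed
  show "K as = K' as"
  proof (induction "length as" arbitrary: as rule: less_induct)
    case less
    show ?case
    proof (cases "as = []")
      case True
      then show ?thesis using assms(2,3) by (simp add: is_cumulants_def)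
    next
      case False
      have "lower_terms \<alpha> \<iota> K as = lower_terms \<alpha> \<iota> K' as" by (rule lower_cong) (rule less)
      then show ?thesis using step[OF assms(2) False] step[OF assms(3) False] by simp
    qed
  qed
qed

lemma scaleC_sum:
  fixes f :: "'i \<Rightarrow> 'b::cstar_algebra_1"
  shows "scaleC z (\<Sum>i\<in>I. f i) = (\<Sum>i\<in>I. scaleC z (f i))"
  by (induction I rule: infinite_finite_induct) (simp_all add: scaleC_zero_right scaleC_add_right)

lemma scaleC_scaleR: "scaleC z (scaleR r x) = scaleR r (scaleC z (x::'b::cstar_algebra_1))"
  by (simp add: scaleR_scaleC scaleC_scaleC mult.commute)

lemma scaleC_diff: "scaleC z (x - y) = scaleC z x - scaleC z (y::'b::star_algebra_1)"
  by (metis add_diff_cancel diff_add_cancel scaleC_add_right)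

context
  fixes \<iota> :: "'b::cstar_algebra_1 \<Rightarrow> 'a::star_algebra_1" and \<alpha> :: "nat set set \<Rightarrow> real"
  assumes \<iota>: "star_hom \<iota>"
begin

lemma lower_add:
  assumes \<Lambda>: "quasi_multilinear \<iota> \<Lambda>"
  shows "lower_terms \<alpha> \<iota> \<Lambda> (xs @ (x + y) # ys) = lower_terms \<alpha> \<iota> \<Lambda> (xs @ x # ys) + lower_terms \<alpha> \<iota> \<Lambda> (xs @ y # ys)"
proof -
  define I where "I = NC {1..length (xs @ x # ys)} - {{{1..length (xs @ x # ys)}}}"
  have I: "lower_terms \<alpha> \<iota> \<Lambda> (xs @ u # ys) = (\<Sum>\<pi>\<in>I. \<alpha> \<pi> *\<^sub>R eval_list \<iota> \<Lambda> \<pi> (xs @ u # ys))" for u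
    by (simp add: lower_terms_def I_def)
  show ?thesis
    unfolding I sum.distrib[symmetric] scaleR_add_right[symmetric]
    by (rule sum.cong[OF refl]) (simp add: I_def eval_list_add[OF \<iota> \<Lambda>])
qed

lemma lower_scale:
  assumes \<Lambda>: "quasi_multilinear \<iota> \<Lambda>"
  shows "lower_terms \<alpha> \<iota> \<Lambda> (xs @ scaleC z x # ys) = scaleC z (lower_terms \<alpha> \<iota> \<Lambda> (xs @ x # ys))"
  unfolding lower_terms_def scaleC_sum
  by (rule sum.cong) (auto simp: eval_list_scale[OF \<iota> \<Lambda>] scaleC_scaleR)

lemma lower_left:
  assumes \<Lambda>: "quasi_multilinear \<iota> \<Lambda>"
  shows "lower_terms \<alpha> \<iota> \<Lambda> (\<iota> b * x # xs) = b * lower_terms \<alpha> \<iota> \<Lambda> (x # xs)"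
  unfolding lower_terms_def sum_distrib_left
  by (rule sum.cong) (auto simp: eval_list_left[OF \<iota> \<Lambda>])

lemma lower_right:
  assumes \<Lambda>: "quasi_multilinear \<iota> \<Lambda>"
  shows "lower_terms \<alpha> \<iota> \<Lambda> (xs @ [x * \<iota> b]) = lower_terms \<alpha> \<iota> \<Lambda> (xs @ [x]) * b"
  unfolding lower_terms_def sum_distrib_right
  by (rule sum.cong) (auto simp: eval_list_right[OF \<iota> \<Lambda>])

lemma lower_middle:
  assumes \<Lambda>: "quasi_multilinear \<iota> \<Lambda>"
  shows "lower_terms \<alpha> \<iota> \<Lambda> (xs @ x * \<iota> b # y # ys) = lower_terms \<alpha> \<iota> \<Lambda> (xs @ x # \<iota> b * y # ys)"
  unfolding lower_terms_def
  by (rule sum.cong) (auto simp: eval_list_middle[OF \<iota> \<Lambda>])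

lemma quasi_D:
  assumes "quasi_multilinear \<iota> \<Lambda>"
  shows "\<Lambda> (xs @ (x + y) # ys) = \<Lambda> (xs @ x # ys) + \<Lambda> (xs @ y # ys)"
    "\<Lambda> (xs @ scaleC z x # ys) = scaleC z (\<Lambda> (xs @ x # ys))"
    "\<Lambda> (\<iota> b * x # xs) = b * \<Lambda> (x # xs)"
    "\<Lambda> (xs @ [x * \<iota> b]) = \<Lambda> (xs @ [x]) * b"
    "\<Lambda> (xs @ x * \<iota> b # y # ys) = \<Lambda> (xs @ x # \<iota> b * y # ys)"
  using assms unfolding quasi_multilinear_def by blast+

lemma bimodule_map_D:
  assumes "bimodule_map \<iota> E"
  shows "E (x + y) = E x + E y" "E (scaleC z x) = scaleC z (E x)" "E (\<iota> b * x) = b * E x" "E (x * \<iota> b) = E x * b"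
proof -
  show "E (x + y) = E x + E y" "E (scaleC z x) = scaleC z (E x)"
    using assms by (auto simp: bimodule_map_def clinear_map_def)
  have "E (\<iota> b * x * \<iota> c) = b * E x * c" for b c using assms by (simp add: bimodule_map_def)
  from this[of b 1] this[of 1 b] show "E (\<iota> b * x) = b * E x" "E (x * \<iota> b) = E x * b"
    using \<iota> by (simp_all add: star_hom_def)
qed

lemma cumulant_rec_quasi_trunc:
  assumes E: "bimodule_map \<iota> E"
  shows "quasi_multilinear \<iota> (\<lambda>as. if length as < m then cumulant_rec \<alpha> \<iota> E as else 0)"
proof (induction m)
  case 0
  show ?case by (simp add: quasi_multilinear_def scaleC_zero_right)
next
  case (Suc m)
  define \<Lambda> where "\<Lambda> = (\<lambda>as. if length as < m then cumulant_rec \<alpha> \<iota> E as else 0)"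
  have \<Lambda>: "quasi_multilinear \<iota> \<Lambda>" using Suc by (simp add: \<Lambda>_def)
  define F where "F as = E (prod_list as) - lower_terms \<alpha> \<iota> \<Lambda> as" for as
  have F: "cumulant_rec \<alpha> \<iota> E as = F as" if "length as = m" "as \<noteq> []" for as
  proof -
    have "lower_terms \<alpha> \<iota> (cumulant_rec \<alpha> \<iota> E) as = lower_terms \<alpha> \<iota> \<Lambda> as"
      by (rule lower_cong) (simp add: \<Lambda>_def that)
    then show ?thesis unfolding F_def cumulant_rec_eq[OF that(2)] by simp
  qed
  note E' = bimodule_map_D[OF E]
  have F1: "F (xs @ (x + y) # ys) = F (xs @ x # ys) + F (xs @ y # ys)" for xs x y ys
    by (simp add: F_def lower_add[OF \<Lambda>] distrib_left distrib_right E' mult.assoc)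
  have F2: "F (xs @ scaleC z x # ys) = scaleC z (F (xs @ x # ys))" for xs z x ys
    by (simp add: F_def lower_scale[OF \<Lambda>] mult_scaleC_left mult_scaleC_right E' scaleC_diff)
  have F3: "F (\<iota> b * x # xs) = b * F (x # xs)" for b x xs
    by (simp add: F_def lower_left[OF \<Lambda>] E' mult.assoc right_diff_distrib)
  have F4: "F (xs @ [x * \<iota> b]) = F (xs @ [x]) * b" for xs x b
    using E'(4)[of "prod_list xs * x" b]
    by (simp add: F_def lower_right[OF \<Lambda>] mult.assoc left_diff_distrib)
  have F5: "F (xs @ x * \<iota> b # y # ys) = F (xs @ x # \<iota> b * y # ys)" for xs x b y ys
    by (simp add: F_def lower_middle[OF \<Lambda>] mult.assoc)
  define \<Lambda>' where "\<Lambda>' = (\<lambda>as. if length as < Suc m then cumulant_rec \<alpha> \<iota> E as else 0)"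
  have \<Lambda>': "\<Lambda>' as = (if length as < m then \<Lambda> as else if length as = m then F as else 0)" if "as \<noteq> []" for as
    using F[OF _ that] by (simp add: \<Lambda>_def \<Lambda>'_def less_Suc_eq)
  have "quasi_multilinear \<iota> \<Lambda>'"
    using \<Lambda> unfolding quasi_multilinear_def by (simp add: \<Lambda>' F1 F2 F3 F4 F5 scaleC_zero_right)
  then show ?case by (simp add: \<Lambda>'_def)
qed

lemma cumulant_rec_quasi:
  assumes E: "bimodule_map \<iota> E"
  shows "quasi_multilinear \<iota> (cumulant_rec \<alpha> \<iota> E)"
proof -
  have *: "quasi_multilinear \<iota> (\<lambda>as. if length as < m then cumulant_rec \<alpha> \<iota> E as else 0)" for m
    by (rule cumulant_rec_quasi_trunc[OF E])
  have 1: "cumulant_rec \<alpha> \<iota> E (xs @ (x + y) # ys) =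
      cumulant_rec \<alpha> \<iota> E (xs @ x # ys) + cumulant_rec \<alpha> \<iota> E (xs @ y # ys)" for xs x y ys
    using quasi_D(1)[OF *[of "Suc (length (xs @ x # ys))"], of xs x y ys] by simp
  have 2: "cumulant_rec \<alpha> \<iota> E (xs @ scaleC z x # ys) = scaleC z (cumulant_rec \<alpha> \<iota> E (xs @ x # ys))" for xs z x ys
    using quasi_D(2)[OF *[of "Suc (length (xs @ x # ys))"], of xs z x ys] by simp
  have 3: "cumulant_rec \<alpha> \<iota> E (\<iota> b * x # xs) = b * cumulant_rec \<alpha> \<iota> E (x # xs)" for b x xs
    using quasi_D(3)[OF *[of "Suc (length (x # xs))"], of b x xs] by simp
  have 4: "cumulant_rec \<alpha> \<iota> E (xs @ [x * \<iota> b]) = cumulant_rec \<alpha> \<iota> E (xs @ [x]) * b" for xs x b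
    using quasi_D(4)[OF *[of "Suc (length (xs @ [x]))"], of xs x b] by simp
  have 5: "cumulant_rec \<alpha> \<iota> E (xs @ x * \<iota> b # y # ys) = cumulant_rec \<alpha> \<iota> E (xs @ x # \<iota> b * y # ys)" for xs x b y ys
    using quasi_D(5)[OF *[of "Suc (length (xs @ x # y # ys))"], of xs x b y ys] by simp
  show ?thesis unfolding quasi_multilinear_def using 1 2 3 4 5 by blast
qed

lemma is_cumulants_cumulants:
  assumes E: "bimodule_map \<iota> E" and \<alpha>: "\<And>l. l \<ge> 1 \<Longrightarrow> \<alpha> {{1..l}} = 1"
  shows "is_cumulants \<alpha> \<iota> E (cumulants \<alpha> \<iota> E)"
proof -
  have "cumulant_rec \<alpha> \<iota> E [] = 0" by (subst cumulant_rec.simps) simp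
  moreover have "E (prod_list as) =
      (\<Sum>\<pi>\<in>NC {1..length as}. \<alpha> \<pi> *\<^sub>R eval_partition \<iota> (cumulant_rec \<alpha> \<iota> E) \<pi> (\<lambda>i. as ! (i - 1)))"
    if "as \<noteq> []" for as
  proof -
    have l: "1 \<le> length as" using that by (simp add: Suc_le_eq)
    show ?thesis
      unfolding moment_split[where as = as and \<alpha> = \<alpha>, OF that \<alpha>[OF l]] cumulant_rec_eq[OF that] by simp
  qed
  ultimately have rec: "is_cumulants \<alpha> \<iota> E (cumulant_rec \<alpha> \<iota> E)"
    unfolding is_cumulants_def using cumulant_rec_quasi[OF E] by blast
  have "\<exists>!K. is_cumulants \<alpha> \<iota> E K"
  proof (rule ex1I)
    show "is_cumulants \<alpha> \<iota> E (cumulant_rec \<alpha> \<iota> E)" by (rule rec)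
    show "K = cumulant_rec \<alpha> \<iota> E" if "is_cumulants \<alpha> \<iota> E K" for K
      by (rule is_cumulants_unique[where \<alpha> = \<alpha>, OF \<alpha> that rec])
  qed
  then show ?thesis unfolding cumulants_def by (rule theI')
qed

end

lemma nc_eval_simps:
  assumes \<iota>: "star_hom \<iota>" and y: "star y = y"
  shows "nc_eval \<iota> y (nc_const b) = \<iota> b" "nc_eval \<iota> y nc_X = y"
    "nc_eval \<iota> y (p + q) = nc_eval \<iota> y p + nc_eval \<iota> y q"
    "nc_eval \<iota> y (p * q) = nc_eval \<iota> y p * nc_eval \<iota> y q"
    "nc_eval \<iota> y (scaleC z p) = scaleC z (nc_eval \<iota> y p)"
    "nc_eval \<iota> y (star p) = star (nc_eval \<iota> y p)"
    "nc_eval \<iota> y 1 = 1"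
proof -
  have r: "nc_interp \<iota> y (rep_ncpoly (abs_ncpoly t)) = nc_interp \<iota> y t" for t
    by (rule nc_interp_cong[OF _ \<iota> y])
      (rule Quotient3_rep_abs[OF Quotient3_ncpoly] nc_refl)+
  have a: "abs_ncpoly (rep_ncpoly p) = p" for p
    by (rule Quotient3_abs_rep[OF Quotient3_ncpoly])
  show "nc_eval \<iota> y (nc_const b) = \<iota> b" "nc_eval \<iota> y nc_X = y" "nc_eval \<iota> y 1 = 1"
    using \<iota> by (simp_all add: nc_eval_def nc_const.abs_eq nc_X_def one_ncpoly_def r star_hom_def)
  show "nc_eval \<iota> y (p + q) = nc_eval \<iota> y p + nc_eval \<iota> y q"
    using r[of "TPlus (rep_ncpoly p) (rep_ncpoly q)"] plus_ncpoly.abs_eq[of "rep_ncpoly p" "rep_ncpoly q"]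
    by (simp add: nc_eval_def a)
  show "nc_eval \<iota> y (p * q) = nc_eval \<iota> y p * nc_eval \<iota> y q"
    using r[of "TTimes (rep_ncpoly p) (rep_ncpoly q)"] times_ncpoly.abs_eq[of "rep_ncpoly p" "rep_ncpoly q"]
    by (simp add: nc_eval_def a)
  show "nc_eval \<iota> y (scaleC z p) = scaleC z (nc_eval \<iota> y p)"
    using r[of "TScale z (rep_ncpoly p)"] scaleC_ncpoly.abs_eq[of z "rep_ncpoly p"]
    by (simp add: nc_eval_def a)
  show "nc_eval \<iota> y (star p) = star (nc_eval \<iota> y p)"
    using r[of "TStar (rep_ncpoly p)"] star_ncpoly.abs_eq[of "rep_ncpoly p"]
    by (simp add: nc_eval_def a)
qed

lemma eval_partition_map:
  assumes h: "\<And>p q. h (p * q) = h p * h q" "\<And>b. h (\<iota> b) = \<iota>' b"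
    and \<pi>: "\<pi> \<in> NC S" "finite S"
  shows "eval_partition \<iota> (\<lambda>as. \<Lambda> (map h as)) \<pi> a = eval_partition \<iota>' \<Lambda> \<pi> (\<lambda>i. h (a i))"
  using \<pi>
proof (induction "card \<pi>" arbitrary: \<pi> S a rule: less_induct)
  case less
  show ?case
  proof (cases "\<exists>V. interval_block \<pi> V")
    case False
    then show ?thesis by (simp add: eval_partition_none)
  next
    case True
    define V where "V = (SOME V. interval_block \<pi> V)"
    have "V \<in> \<pi>" using someI_ex[OF True] by (simp add: V_def interval_block_def)
    have fin: "finite \<pi>" by (rule NC_finite[OF less.prems])
    have ev: "eval_partition \<iota> \<Lambda> \<pi> a = remove_block \<iota> \<Lambda> \<pi> V a" for \<iota> \<Lambda> and a :: "nat \<Rightarrow> 'x::star_algebra_1"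
      using fin True by (subst eval_partition.simps)
        (simp add: Let_def remove_block_def arg_block_def V_def)
    note IH = less.hyps[OF card_Diff1_less[OF fin \<open>V \<in> \<pi>\<close>] NC_remove[OF less.prems(1) \<open>V \<in> \<pi>\<close>]]
    have ab: "arg_block (\<lambda>as. \<Lambda> (map h as)) a V = arg_block \<Lambda> (\<lambda>i. h (a i)) V"
      by (simp add: arg_block_def comp_def)
    have upd: "(\<lambda>i. h ((a(n := c)) i)) = (\<lambda>i. h (a i))(n := h c)" for n c by auto
    show ?thesis
      unfolding ev remove_block_def ab using less.prems(2) by (simp only: IH finite_Diff upd h)
  qed
qed

lemma law_cumulants_realisation:
  assumes "valued_probability_space \<iota> E" "star y = y"
    and \<mu>: "\<mu> = (\<lambda>p. E (nc_eval \<iota> y p))"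
    and \<alpha>: "\<And>l. l \<ge> 1 \<Longrightarrow> \<alpha> {{1..l}} = 1"
  shows "law_cumulants \<alpha> \<mu> bs = cumulants \<alpha> \<iota> E (map (\<lambda>b. y * \<iota> b) bs @ [y])"
proof -
  have \<iota>: "star_hom \<iota>" and E: "bimodule_map \<iota> E"
    using assms(1) by (auto simp: valued_probability_space_def)
  note ev = nc_eval_simps[OF \<iota> assms(2)]
  define K where "K = cumulants \<alpha> \<iota> E"
  have K: "is_cumulants \<alpha> \<iota> E K"
    unfolding K_def by (rule is_cumulants_cumulants[where \<alpha> = \<alpha>, OF \<iota> E \<alpha>])
  define K' where "K' as = K (map (nc_eval \<iota> y) as)" for as
  have "quasi_multilinear nc_const K'"
    using K unfolding is_cumulants_def quasi_multilinear_def by (simp add: K'_def ev)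
  moreover have prod: "nc_eval \<iota> y (prod_list as) = prod_list (map (nc_eval \<iota> y) as)" for as
    by (induction as) (simp_all add: ev)
  moreover have "\<mu> (prod_list as) =
      (\<Sum>\<pi>\<in>NC {1..length as}. \<alpha> \<pi> *\<^sub>R eval_partition nc_const K' \<pi> (\<lambda>i. as ! (i - 1)))" if "as \<noteq> []" for as
  proof -
    have "\<mu> (prod_list as) = (\<Sum>\<pi>\<in>NC {1..length as}. \<alpha> \<pi> *\<^sub>R
        eval_partition \<iota> K \<pi> (\<lambda>i. map (nc_eval \<iota> y) as ! (i - 1)))"
      using K that unfolding is_cumulants_def by (simp add: \<mu> prod)
    also have "\<dots> = (\<Sum>\<pi>\<in>NC {1..length as}. \<alpha> \<pi> *\<^sub>R eval_partition nc_const K' \<pi> (\<lambda>i. as ! (i - 1)))"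
    proof (rule sum.cong[OF refl])
      fix \<pi> assume \<pi>: "\<pi> \<in> NC {1..length as}"
      have "eval_partition nc_const K' \<pi> (\<lambda>i. as ! (i - 1)) =
          eval_partition \<iota> K \<pi> (\<lambda>i. nc_eval \<iota> y (as ! (i - 1)))"
        unfolding K'_def by (rule eval_partition_map[OF ev(4,1) \<pi>]) simp
      also have "\<dots> = eval_partition \<iota> K \<pi> (\<lambda>i. map (nc_eval \<iota> y) as ! (i - 1))"
        by (rule eval_NC_cong[OF \<pi>]) auto
      finally show "\<alpha> \<pi> *\<^sub>R eval_partition \<iota> K \<pi> (\<lambda>i. map (nc_eval \<iota> y) as ! (i - 1)) =
          \<alpha> \<pi> *\<^sub>R eval_partition nc_const K' \<pi> (\<lambda>i. as ! (i - 1))" by simp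
    qed
    finally show ?thesis .
  qed
  moreover have "K' [] = 0" using K by (simp add: K'_def is_cumulants_def)
  ultimately have K': "is_cumulants \<alpha> nc_const \<mu> K'" unfolding is_cumulants_def by blast
  have "cumulants \<alpha> nc_const \<mu> = K'"
    unfolding cumulants_def
  proof (rule the_equality)
    show "is_cumulants \<alpha> nc_const \<mu> K'" by (rule K')
    show "L = K'" if "is_cumulants \<alpha> nc_const \<mu> L" for L
      by (rule is_cumulants_unique[where \<alpha> = \<alpha>, OF \<alpha> that K'])
  qed
  then show ?thesis
    unfolding law_cumulants_def by (simp add: K'_def K_def ev comp_def)
qed

lemma nc_const_simps:
  "nc_const (a * b) = nc_const a * nc_const b" "nc_const (scaleC z a) = scaleC z (nc_const a)"
  "nc_const 1 = 1" "nc_const (star a) = star (nc_const a)"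
  by (simp_all add: star_hom_nc_const[unfolded star_hom_def clinear_map_def])

inductive nc_mon :: "'b::star_algebra_1 ncpoly \<Rightarrow> bool" where
  nc_mon_const: "nc_mon (nc_const b)"
| nc_mon_X: "nc_mon p \<Longrightarrow> nc_mon (nc_const b * nc_X * p)"

inductive nc_span :: "'b::star_algebra_1 ncpoly \<Rightarrow> bool" where
  nc_span_mon: "nc_mon p \<Longrightarrow> nc_span p"
| nc_span_add: "nc_span p \<Longrightarrow> nc_span q \<Longrightarrow> nc_span (p + q)"

lemma nc_mon_mult: "nc_mon p \<Longrightarrow> nc_mon q \<Longrightarrow> nc_mon (p * q)"
proof (induction rule: nc_mon.induct)
  case (nc_mon_const b)
  then show ?case
  proof cases
    case (nc_mon_const c)
    then show ?thesis using nc_mon.nc_mon_const[of "b * c"] by (simp add: nc_const_simps)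
  next
    case (nc_mon_X p c)
    then show ?thesis using nc_mon.nc_mon_X[of p "b * c"] by (simp add: nc_const_simps mult.assoc)
  qed
next
  case (nc_mon_X p b)
  then show ?case using nc_mon.nc_mon_X[of "p * q" b] by (simp add: mult.assoc)
qed

lemma nc_mon_var: "nc_mon (nc_X * nc_const b)"
  using nc_mon_X[OF nc_mon_const, of 1 b] by (simp add: nc_const_simps)

lemma nc_mon_star: "nc_mon p \<Longrightarrow> nc_mon (star p)"
proof (induction rule: nc_mon.induct)
  case (nc_mon_const b)
  then show ?case by (metis nc_const_simps(4) nc_mon.nc_mon_const)
next
  case (nc_mon_X p b)
  then show ?case
    using nc_mon_mult[OF nc_mon_X.IH nc_mon_var[of "star b"]]
    by (simp add: star_mult star_nc_X nc_const_simps)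
qed

lemma nc_span_mult:
  assumes "nc_span p" "nc_span q"
  shows "nc_span (p * q)"
  using assms(1)
proof induction
  case (nc_span_mon p)
  note p = this
  from assms(2) show ?case
    by induction (auto intro: nc_span.intros nc_mon_mult p simp: distrib_left)
qed (auto intro: nc_span.intros simp: distrib_right)

lemma nc_span_all: "nc_span (p :: 'b::star_algebra_1 ncpoly)"
proof -
  have star: "nc_span p \<Longrightarrow> nc_span (star p)" for p :: "'b ncpoly"
    by (induction rule: nc_span.induct) (auto intro: nc_span.intros nc_mon_star simp: star_add)
  have scale: "nc_span p \<Longrightarrow> nc_span (scaleC z p)" for p :: "'b ncpoly" and z
    using nc_span_mult[OF nc_span_mon[OF nc_mon_const[of "scaleC z 1"]], of p]
    by (simp add: nc_const_simps mult_scaleC_left)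
  have "nc_span (abs_ncpoly t)" for t :: "'b ncterm"
  proof (induction t)
    case (TConst b)
    show ?case using nc_span_mon[OF nc_mon_const] by (simp add: nc_const.abs_eq)
  next
    case TVar
    show ?case using nc_span_mon[OF nc_mon_var[of 1]] by (simp add: nc_X_def nc_const_simps)
  next
    case (TPlus t u)
    then show ?case using nc_span_add by (metis plus_ncpoly.abs_eq)
  next
    case (TTimes t u)
    then show ?case using nc_span_mult by (metis times_ncpoly.abs_eq)
  next
    case (TScale z t)
    then show ?case using scale by (metis scaleC_ncpoly.abs_eq)
  next
    case (TStar t)
    then show ?case using star by (metis star_ncpoly.abs_eq)
  qed
  from this[of "rep_ncpoly p"] show ?thesis
    by (simp add: Quotient3_abs_rep[OF Quotient3_ncpoly])
qed

definition nc_letter :: "'b::star_algebra_1 ncpoly \<Rightarrow> bool" where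
  "nc_letter p \<longleftrightarrow> (\<exists>b c. p = nc_const b * (nc_X * nc_const c))"

lemma nc_letter_left: "nc_letter p \<Longrightarrow> nc_letter (nc_const b * p)"
  unfolding nc_letter_def by (metis mult.assoc nc_const_simps(1))

lemma nc_mon_cases:
  assumes "nc_mon p"
  shows "(\<exists>b. p = nc_const b) \<or> (\<exists>as. as \<noteq> [] \<and> (\<forall>a\<in>set as. nc_letter a) \<and> p = prod_list as)"
  using assms
proof induction
  case (nc_mon_X p b)
  from nc_mon_X.IH show ?case
  proof (elim disjE exE conjE)
    fix c assume "p = nc_const c"
    then show ?thesis
      by (intro disjI2 exI[of _ "[nc_const b * (nc_X * nc_const c)]"]) (auto simp: nc_letter_def mult.assoc)
  next
    fix as assume "\<forall>a\<in>set as. nc_letter a" "p = prod_list as"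
    moreover have "nc_letter (nc_const b * (nc_X * nc_const 1))" unfolding nc_letter_def by blast
    ultimately show ?thesis
      by (intro disjI2 exI[of _ "(nc_const b * (nc_X * nc_const 1)) # as"])
        (auto simp: nc_const_simps(3) mult.assoc)
  qed
qed blast

fun letters_nf :: "'b::star_algebra_1 \<Rightarrow> 'b list \<Rightarrow> 'b \<Rightarrow> 'b ncpoly list" where
  "letters_nf b [] c = [nc_const b * (nc_X * nc_const c)]"
| "letters_nf b (b' # bs) c = (nc_const b * (nc_X * nc_const b')) # letters_nf 1 bs c"

lemma letters_nf_Cons: "\<exists>y ys. \<forall>b. letters_nf b bs c = (nc_const b * y) # ys"
  by (cases bs) auto

lemma letters_nf_one: "letters_nf 1 bs c = map (\<lambda>b. nc_X * nc_const b) bs @ [nc_X * nc_const c]"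
  by (induction bs) (simp_all add: nc_const_simps)

lemma letters_normal_form:
  assumes "as \<noteq> []" "\<forall>a\<in>set as. nc_letter a"
  shows "\<exists>b bs c. \<forall>\<Lambda> xs. quasi_multilinear nc_const \<Lambda> \<longrightarrow> \<Lambda> (xs @ as) = \<Lambda> (xs @ letters_nf b bs c)"
  using assms
proof (induction as)
  case (Cons a as)
  obtain b0 c0 where a: "a = nc_const b0 * (nc_X * nc_const c0)"
    using Cons.prems(2) by (auto simp: nc_letter_def)
  show ?case
  proof (cases "as = []")
    case True
    then show ?thesis
      by (intro exI[of _ b0] exI[of _ "[]"] exI[of _ c0]) (simp add: a)
  next
    case False
    then have "\<exists>b bs c. \<forall>\<Lambda> xs. quasi_multilinear nc_const \<Lambda> \<longrightarrow>
        \<Lambda> (xs @ as) = \<Lambda> (xs @ letters_nf b bs c)"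
      using Cons.IH Cons.prems(2) by auto
    then obtain b bs c where nf:
      "\<And>\<Lambda> xs. quasi_multilinear nc_const \<Lambda> \<Longrightarrow> \<Lambda> (xs @ as) = \<Lambda> (xs @ letters_nf b bs c)"
      by blast
    obtain y ys where y: "\<And>b. letters_nf b bs c = (nc_const b * y) # ys"
      using letters_nf_Cons[of bs c] by blast
    have "\<Lambda> (xs @ a # as) = \<Lambda> (xs @ letters_nf b0 ((c0 * b) # bs) c)"
      if \<Lambda>: "quasi_multilinear nc_const \<Lambda>" for \<Lambda> xs
    proof -
      have "\<Lambda> (xs @ a # as) = \<Lambda> (xs @ a # nc_const b * y # ys)"
        using nf[OF \<Lambda>, of "xs @ [a]"] by (simp add: y)
      also have "\<dots> = \<Lambda> (xs @ a * nc_const b # y # ys)"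
        using \<Lambda> unfolding quasi_multilinear_def by simp
      also have "\<dots> = \<Lambda> (xs @ letters_nf b0 ((c0 * b) # bs) c)"
        by (simp add: y a nc_const_simps mult.assoc)
      finally show ?thesis .
    qed
    then show ?thesis by blast
  qed
qed simp

lemma letters_agree:
  assumes K: "quasi_multilinear nc_const K" and K': "quasi_multilinear nc_const K'"
    and eq: "\<And>bs. K (map (\<lambda>b. nc_X * nc_const b) bs @ [nc_X]) = K' (map (\<lambda>b. nc_X * nc_const b) bs @ [nc_X])"
    and as: "as \<noteq> []" "\<forall>a\<in>set as. nc_letter a"
  shows "K as = K' as"
proof -
  obtain b bs c where nf:
      "\<And>\<Lambda> xs. quasi_multilinear nc_const \<Lambda> \<Longrightarrow> \<Lambda> (xs @ as) = \<Lambda> (xs @ letters_nf b bs c)"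
    using letters_normal_form[OF as] by blast
  obtain y ys where y: "\<And>b. letters_nf b bs c = (nc_const b * y) # ys"
    using letters_nf_Cons[of bs c] by blast
  have "\<Lambda> as = b * (\<Lambda> (map (\<lambda>b. nc_X * nc_const b) bs @ [nc_X]) * c)"
    if \<Lambda>: "quasi_multilinear nc_const \<Lambda>" for \<Lambda>
  proof -
    have "\<Lambda> as = \<Lambda> (nc_const b * y # ys)" using nf[OF \<Lambda>, of "[]"] y by simp
    also have "\<dots> = b * \<Lambda> (y # ys)" using \<Lambda> unfolding quasi_multilinear_def by simp
    also have "y # ys = map (\<lambda>b. nc_X * nc_const b) bs @ [nc_X * nc_const c]"
      using y[of 1] letters_nf_one[of bs c] by (simp add: nc_const_simps)
    also have "\<Lambda> \<dots> = \<Lambda> (map (\<lambda>b. nc_X * nc_const b) bs @ [nc_X]) * c"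
      using \<Lambda> unfolding quasi_multilinear_def by simp
    finally show ?thesis .
  qed
  from this[OF K] this[OF K'] show ?thesis by (simp add: eq)
qed

lemma eval_partition_letters:
  fixes K K' :: "'b::star_algebra_1 ncpoly list \<Rightarrow> 'b"
  assumes "\<And>as. as \<noteq> [] \<Longrightarrow> \<forall>a\<in>set as. nc_letter a \<Longrightarrow> K as = K' as"
    and "\<pi> \<in> NC S" "finite S" "\<And>s. s \<in> S \<Longrightarrow> nc_letter (a s)"
  shows "eval_partition nc_const K \<pi> a = eval_partition nc_const K' \<pi> a"
  using assms(2-)
proof (induction "card \<pi>" arbitrary: \<pi> S a rule: less_induct)
  case less
  have ab: "arg_block K a V = arg_block K' a V" if "V \<subseteq> S" "V \<noteq> {}" "finite V" for V
    unfolding arg_block_def by (rule assms(1)) (use that less.prems(3) in auto)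
  show ?case
  proof (cases "\<pi> = {}")
    case True
    then show ?thesis by (simp add: eval_partition_empty)
  next
    case False
    from less.prems(1,2) False show ?thesis
    proof (cases rule: NC_cases[where \<iota> = "nc_const :: 'b \<Rightarrow> _"])
      case (1 V n)
      show ?thesis
        unfolding 1(13) ab[OF 1(5,3,4)]
        by (rule less.hyps[OF 1(7,6)]) (use less.prems 1(10) in \<open>auto intro: nc_letter_left\<close>)
    next
      case (2 V)
      have "eval_partition nc_const K (\<pi> - {V}) a = eval_partition nc_const K' (\<pi> - {V}) a"
        by (rule less.hyps[OF 2(7,6)]) (use less.prems in auto)
      then show ?thesis unfolding 2(9) ab[OF 2(5,3,4)] by simp
    qed
  qed
qed

lemma law_determined_by_cumulants:
  assumes \<alpha>: "\<And>l. l \<ge> 1 \<Longrightarrow> \<alpha> {{1..l}} = 1"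
    and \<mu>: "bimodule_map nc_const \<mu>" "\<mu> 1 = 1" and \<nu>: "bimodule_map nc_const \<nu>" "\<nu> 1 = 1"
    and eq: "\<And>bs. law_cumulants \<alpha> \<mu> bs = law_cumulants \<alpha> \<nu> bs"
  shows "\<mu> = \<nu>"
proof
  define K where "K = cumulants \<alpha> nc_const \<mu>"
  define L where "L = cumulants \<alpha> nc_const \<nu>"
  have K: "is_cumulants \<alpha> nc_const \<mu> K" and L: "is_cumulants \<alpha> nc_const \<nu> L"
    unfolding K_def L_def
    using is_cumulants_cumulants[where \<alpha> = \<alpha>, OF star_hom_nc_const \<mu>(1) \<alpha>]
      is_cumulants_cumulants[where \<alpha> = \<alpha>, OF star_hom_nc_const \<nu>(1) \<alpha>] by blast+
  have KL: "K as = L as" if "as \<noteq> []" "\<forall>a\<in>set as. nc_letter a" for as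
    by (rule letters_agree[OF _ _ _ that])
      (use K L eq in \<open>auto simp: is_cumulants_def law_cumulants_def K_def L_def\<close>)
  have mon: "\<mu> p = \<nu> p" if "nc_mon p" for p
    using nc_mon_cases[OF that]
  proof (elim disjE exE conjE)
    fix b assume "p = nc_const b"
    then show ?thesis
      using bimodule_map_D(3)[OF star_hom_nc_const \<mu>(1), of b 1]
        bimodule_map_D(3)[OF star_hom_nc_const \<nu>(1), of b 1] \<mu>(2) \<nu>(2) by simp
  next
    fix as assume as: "as \<noteq> []" "\<forall>a\<in>set as. nc_letter a" and p: "p = prod_list as"
    have "eval_partition nc_const K \<pi> (\<lambda>i. as ! (i - 1)) = eval_partition nc_const L \<pi> (\<lambda>i. as ! (i - 1))"
      if "\<pi> \<in> NC {1..length as}" for \<pi>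
      by (rule eval_partition_letters[OF KL that]) (use as(2) in \<open>auto simp: Suc_le_eq\<close>)
    then show ?thesis using K L as(1) unfolding is_cumulants_def p by simp
  qed
  show "\<mu> p = \<nu> p" for p
    using nc_span_all[of p]
    by induction (simp_all add: mon bimodule_map_D(1)[OF star_hom_nc_const \<mu>(1)]
      bimodule_map_D(1)[OF star_hom_nc_const \<nu>(1)])
qed

lemma law_with_cumulants_eqI:
  assumes \<alpha>: "\<And>l. l \<ge> 1 \<Longrightarrow> \<alpha> {{1..l}} = 1"
    and \<nu>: "valued_law \<nu>" "\<And>bs. law_cumulants \<alpha> \<nu> bs = \<kappa> bs"
  shows "law_with_cumulants \<alpha> \<kappa> = \<nu>"
  unfolding law_with_cumulants_def
proof (rule the_equality)
  show *: "bimodule_map nc_const \<nu> \<and> \<nu> 1 = 1 \<and> (\<forall>bs. law_cumulants \<alpha> \<nu> bs = \<kappa> bs)"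
    using \<nu> by (simp add: valued_law_def)
  show "\<mu> = \<nu>" if "bimodule_map nc_const \<mu> \<and> \<mu> 1 = 1 \<and> (\<forall>bs. law_cumulants \<alpha> \<mu> bs = \<kappa> bs)" for \<mu>
    using that * by (intro law_determined_by_cumulants[where \<alpha> = \<alpha>, OF \<alpha>]) auto
qed

definition same_colour :: "nat set set \<Rightarrow> (nat set \<Rightarrow> nat) \<Rightarrow> (nat set \<times> nat set) set" where
  "same_colour \<pi> \<chi> = {(U, U'). graph_adjacent \<pi> U U' \<and> \<chi> U = \<chi> U'}"

lemma same_colour_rtrancl:
  assumes "(V, W) \<in> (same_colour \<pi> \<chi>)\<^sup>*" "V \<in> \<pi>"
  shows "W \<in> \<pi> \<and> \<chi> W = \<chi> V"
  using assms by induction (auto simp: same_colour_def graph_adjacent_def)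

lemma same_colour_sym: "sym ((same_colour \<pi> \<chi>)\<^sup>*)"
  by (rule sym_rtrancl) (auto simp: sym_def same_colour_def graph_adjacent_def)

lemma colour_components_alt:
  "colour_components \<pi> \<chi> = (\<lambda>V. {W. (V, W) \<in> (same_colour \<pi> \<chi>)\<^sup>*}) ` \<pi>"
  by (simp add: colour_components_def same_colour_def)

lemma component_subset: "C \<in> colour_components \<pi> \<chi> \<Longrightarrow> C \<subseteq> \<pi>"
  unfolding colour_components_alt using same_colour_rtrancl by blast

lemma component_top:
  assumes "\<pi> \<in> colour_components \<pi> \<chi>"
  shows "colour_components \<pi> \<chi> = {\<pi>}" "\<And>V W. V \<in> \<pi> \<Longrightarrow> W \<in> \<pi> \<Longrightarrow> \<chi> V = \<chi> W"
proof -
  obtain V where V: "V \<in> \<pi>" "\<pi> = {W. (V, W) \<in> (same_colour \<pi> \<chi>)\<^sup>*}"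
    using assms unfolding colour_components_alt by blast
  have U: "{W. (U, W) \<in> (same_colour \<pi> \<chi>)\<^sup>*} = \<pi>" if "U \<in> \<pi>" for U
  proof (intro equalityI subsetI)
    fix W assume "W \<in> {W. (U, W) \<in> (same_colour \<pi> \<chi>)\<^sup>*}"
    then show "W \<in> \<pi>" using same_colour_rtrancl that by blast
  next
    fix W assume "W \<in> \<pi>"
    then have "(V, W) \<in> (same_colour \<pi> \<chi>)\<^sup>*" "(V, U) \<in> (same_colour \<pi> \<chi>)\<^sup>*" using V(2) that by blast+
    then have "(U, W) \<in> (same_colour \<pi> \<chi>)\<^sup>*" using same_colour_sym by (metis rtrancl_trans symD)
    then show "W \<in> {W. (U, W) \<in> (same_colour \<pi> \<chi>)\<^sup>*}" by simp
  qed
  show "colour_components \<pi> \<chi> = {\<pi>}"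
    unfolding colour_components_alt using U V(1) by (auto simp: image_iff)
  show "\<chi> V = \<chi> W" if "V \<in> \<pi>" "W \<in> \<pi>" for V W
  proof -
    have "W \<in> {W. (V, W) \<in> (same_colour \<pi> \<chi>)\<^sup>*}" unfolding U[OF that(1)] by (rule that(2))
    then show ?thesis using same_colour_rtrancl[of V W \<pi> \<chi>] that(1) by simp
  qed
qed

lemma chain_outer:
  assumes "V \<noteq> {}" "finite V" "\<And>W. W \<in> \<pi> \<Longrightarrow> \<not> nested W V"
  shows "chain \<pi> V = [V]"
proof -
  have e: "insert V {W\<in>\<pi>. nested W V} = {V}" using assms(3) by auto
  have irr: "\<not> nested V V" using assms(1) unfolding nested_def by (meson less_irrefl)
  show ?thesis
    unfolding chain_def e
  proof (rule the_equality)
    show "set [V] = {V} \<and> sorted_wrt (\<lambda>U W. nested W U) [V]" by simp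
    fix Vs assume Vs: "set Vs = {V} \<and> sorted_wrt (\<lambda>U W. nested W U) Vs"
    show "Vs = [V]"
    proof (cases Vs)
      case (Cons a as)
      then have "a = V" using Vs by auto
      moreover have "as = []"
      proof (cases as)
        case (Cons b bs)
        then have "nested b a" "b = V" using Vs \<open>Vs = a # as\<close> by auto
        then show ?thesis using irr \<open>a = V\<close> by simp
      qed
      ultimately show ?thesis using Cons by simp
    qed (use Vs in simp)
  qed
qed

lemma outer_block_exists:
  assumes "\<pi> \<in> NC S" "finite S" "\<pi> \<noteq> {}"
  obtains V where "V \<in> \<pi>" "chain \<pi> V = [V]"
proof -
  note D = NC_D[OF assms(1)] and fin = NC_finite[OF assms(1,2)]
  have "S \<noteq> {}" using D(1,2) assms(3) by auto
  then have "Min S \<in> S" using assms(2) by simp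
  then obtain V where V: "V \<in> \<pi>" "Min S \<in> V" using D(1) by blast
  have "\<not> nested W V" if "W \<in> \<pi>" for W
  proof
    assume "nested W V"
    then obtain j where "j \<in> W" "j < Min S" using V(2) unfolding nested_def by blast
    moreover have "j \<in> S" using fin(3)[OF that] \<open>j \<in> W\<close> by blast
    ultimately show False using assms(2) by (simp add: leD)
  qed
  then show thesis using that[OF V(1)] chain_outer[of V \<pi>] V fin(2) by blast
qed

lemma finite_colourings: "finite \<pi> \<Longrightarrow> finite (colourings N T \<pi>)"
  by (rule finite_subset[of _ "\<pi> \<rightarrow>\<^sub>E {1..N}"]) (auto simp: colourings_def intro!: finite_PiE)

definition connected_colourings where
  "connected_colourings N T \<pi> = {\<chi>\<in>colourings N T \<pi>. colour_components \<pi> \<chi> = {\<pi>}}"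

context
  fixes N :: nat and T :: "nat list set"
  assumes T: "T \<in> Tree N" and n: "root_degree T \<ge> 2"
begin

lemma roots: "{j. [j] \<in> T} \<subseteq> {1..N}"
  using T unfolding Tree_def alternating_def by fastforce

lemma card_connected_colourings:
  assumes \<pi>: "\<pi> \<in> NC S" "finite S" "\<pi> \<noteq> {}"
  shows "card (connected_colourings N T \<pi>) \<le> root_degree T"
proof -
  obtain V where V: "V \<in> \<pi>" "chain \<pi> V = [V]" by (rule outer_block_exists[OF \<pi>])
  have "inj_on (\<lambda>\<chi>. \<chi> V) (connected_colourings N T \<pi>)"
  proof (rule inj_onI)
    fix \<chi> \<psi> assume a: "\<chi> \<in> connected_colourings N T \<pi>" "\<psi> \<in> connected_colourings N T \<pi>" "\<chi> V = \<psi> V"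
    have "\<chi> W = \<chi> V" "\<psi> W = \<psi> V" if "W \<in> \<pi>" for W
      using component_top(2)[of \<pi> \<chi> W V] component_top(2)[of \<pi> \<psi> W V] a that V(1)
      by (auto simp: connected_colourings_def)
    then show "\<chi> = \<psi>" using a
      by (intro PiE_ext[of \<chi> \<pi> "\<lambda>_. {1..N}" \<psi>]) (auto simp: connected_colourings_def colourings_def)
  qed
  moreover have "(\<lambda>\<chi>. \<chi> V) ` connected_colourings N T \<pi> \<subseteq> {j. [j] \<in> T}"
    using V by (auto simp: connected_colourings_def colourings_def dest!: bspec[of _ _ V])
  moreover have "finite {j. [j] \<in> T}" using roots finite_subset by blast
  ultimately show ?thesis by (rule card_inj_on_le)
qed

lemma denominator_pos:
  assumes \<pi>: "\<pi> \<in> NC S" "finite S" "card \<pi> \<noteq> 1"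
  shows "real (card (connected_colourings N T \<pi>)) < real (root_degree T) ^ card \<pi>"
proof (cases "\<pi> = {}")
  case True
  then have "connected_colourings N T \<pi> = {}" by (auto simp: connected_colourings_def colour_components_def)
  then show ?thesis using True by simp
next
  case False
  have "finite \<pi>" using NC_finite[OF \<pi>(1,2)] by blast
  then have "card \<pi> \<noteq> 0" using False by simp
  then have "1 < card \<pi>" using \<pi>(3) by linarith
  then have "root_degree T ^ 1 < root_degree T ^ card \<pi>" using n by (intro power_strict_increasing) auto
  then have "card (connected_colourings N T \<pi>) < root_degree T ^ card \<pi>"
    using card_connected_colourings[OF \<pi>(1,2) False] by simp
  then have "real (card (connected_colourings N T \<pi>)) < real (root_degree T ^ card \<pi>)" by (rule of_nat_less_iff[THEN iffD2])
  then show ?thesis by simp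
qed

lemma single_block:
  assumes \<pi>: "\<pi> \<in> NC S" "finite S" "card \<pi> = 1"
  shows "card (colourings N T \<pi>) = root_degree T" "\<And>\<chi>. colour_components \<pi> \<chi> = {\<pi>}"
proof -
  obtain V where V: "\<pi> = {V}" using \<pi>(3) by (rule card_1_singletonE)
  then obtain V' where "V' \<in> \<pi>" "chain \<pi> V' = [V']" using outer_block_exists[OF \<pi>(1,2)] by blast
  then have ch: "chain {V} V = [V]" using V by simp
  have "bij_betw (\<lambda>\<chi>. \<chi> V) (colourings N T \<pi>) {j. [j] \<in> T}"
  proof (rule bij_betw_byWitness[where f' = "\<lambda>j. \<lambda>x\<in>{V}. j"])
    show "\<forall>\<chi>\<in>colourings N T \<pi>. (\<lambda>x\<in>{V}. \<chi> V) = \<chi>"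
      by (auto simp: colourings_def V PiE_def extensional_def fun_eq_iff)
    show "(\<lambda>\<chi>. \<chi> V) ` colourings N T \<pi> \<subseteq> {j. [j] \<in> T}" by (auto simp: colourings_def V ch)
    show "(\<lambda>j. \<lambda>x\<in>{V}. j) ` {j. [j] \<in> T} \<subseteq> colourings N T \<pi>"
      using roots by (auto simp: colourings_def V ch split: if_split_asm)
  qed auto
  then show "card (colourings N T \<pi>) = root_degree T" by (rule bij_betw_same_card)
  have "\<pi> \<in> colour_components \<pi> \<chi>" for \<chi>
    using same_colour_rtrancl[of V _ \<pi> \<chi>] unfolding colour_components_alt V by auto
  then show "colour_components \<pi> \<chi> = {\<pi>}" for \<chi> by (rule component_top(1))
qed

lemma coefficient_sum_split:
  assumes \<pi>: "\<pi> \<in> NC S" "finite S"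
  shows "(\<Sum>\<chi>\<in>colourings N T \<pi>. \<Prod>\<pi>'\<in>colour_components \<pi> \<chi>. \<alpha> \<pi>') =
    real (card (connected_colourings N T \<pi>)) * \<alpha> \<pi> +
    (\<Sum>\<chi>\<in>colourings N T \<pi> - connected_colourings N T \<pi>. \<Prod>\<pi>'\<in>colour_components \<pi> \<chi>.
       (if card \<pi>' < card \<pi> then \<alpha> \<pi>' else 0))"
proof -
  have finp: "finite \<pi>" using NC_finite[OF \<pi>] by blast
  have fin: "finite (colourings N T \<pi>)" by (rule finite_colourings[OF finp])
  have "card C < card \<pi>" if "\<chi> \<in> colourings N T \<pi> - connected_colourings N T \<pi>" "C \<in> colour_components \<pi> \<chi>" for C \<chi>
  proof -
    have "C \<noteq> \<pi>" using that component_top(1)[of \<pi> \<chi>] by (auto simp: connected_colourings_def)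
    then show ?thesis using component_subset[OF that(2)] finp by (meson psubsetI psubset_card_mono)
  qed
  then have "(\<Sum>\<chi>\<in>colourings N T \<pi> - connected_colourings N T \<pi>. \<Prod>\<pi>'\<in>colour_components \<pi> \<chi>. \<alpha> \<pi>') =
    (\<Sum>\<chi>\<in>colourings N T \<pi> - connected_colourings N T \<pi>. \<Prod>\<pi>'\<in>colour_components \<pi> \<chi>.
       (if card \<pi>' < card \<pi> then \<alpha> \<pi>' else 0))"
    by (intro sum.cong prod.cong) auto
  moreover have "(\<Sum>\<chi>\<in>connected_colourings N T \<pi>. \<Prod>\<pi>'\<in>colour_components \<pi> \<chi>. \<alpha> \<pi>') =
      (\<Sum>\<chi>\<in>connected_colourings N T \<pi>. \<alpha> \<pi>)"
    by (rule sum.cong) (auto simp: connected_colourings_def)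
  moreover have "(\<Sum>\<chi>\<in>colourings N T \<pi>. \<Prod>\<pi>'\<in>colour_components \<pi> \<chi>. \<alpha> \<pi>') =
      (\<Sum>\<chi>\<in>colourings N T \<pi> - connected_colourings N T \<pi>. \<Prod>\<pi>'\<in>colour_components \<pi> \<chi>. \<alpha> \<pi>') +
      (\<Sum>\<chi>\<in>connected_colourings N T \<pi>. \<Prod>\<pi>'\<in>colour_components \<pi> \<chi>. \<alpha> \<pi>')"
    by (rule sum.subset_diff[OF _ fin]) (auto simp: connected_colourings_def)
  ultimately show ?thesis by simp
qed

lemma coefficient_equation:
  assumes \<pi>: "\<pi> \<in> NC S" "finite S"
  shows "((card \<pi> = 1 \<longrightarrow> \<alpha> \<pi> = 1) \<and> \<alpha> \<pi> = (1 / real (root_degree T) ^ card \<pi>) *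
          (\<Sum>\<chi>\<in>colourings N T \<pi>. \<Prod>\<pi>'\<in>colour_components \<pi> \<chi>. \<alpha> \<pi>')) \<longleftrightarrow>
    \<alpha> \<pi> = (if card \<pi> = 1 then 1 else
      (\<Sum>\<chi>\<in>colourings N T \<pi> - connected_colourings N T \<pi>. \<Prod>\<pi>'\<in>colour_components \<pi> \<chi>.
        (if card \<pi>' < card \<pi> then \<alpha> \<pi>' else 0)) / (real (root_degree T) ^ card \<pi> - real (card (connected_colourings N T \<pi>))))"
proof (cases "card \<pi> = 1")
  case True
  have "(\<Sum>\<chi>\<in>colourings N T \<pi>. \<Prod>\<pi>'\<in>colour_components \<pi> \<chi>. \<alpha> \<pi>') = real (root_degree T) * \<alpha> \<pi>"
    by (simp add: single_block[OF \<pi> True])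
  then show ?thesis using True n by auto
next
  case False
  have pos: "real (root_degree T) ^ card \<pi> > 0" using n by simp
  have "x = (1 / p) * (c * x + s) \<longleftrightarrow> x = s / (p - c)" if "p > 0" "c < p" for x p c s :: real
    using that by (auto simp: field_simps)
  from this[OF pos denominator_pos[OF \<pi> False]] False show ?thesis
    unfolding coefficient_sum_split[OF \<pi>] by simp
qed

end

function tree_coeff_rec :: "nat \<Rightarrow> nat list set \<Rightarrow> nat set set \<Rightarrow> real" where
  "tree_coeff_rec N T \<pi> = (if \<exists>S. finite S \<and> \<pi> \<in> NC S then
     (if card \<pi> = 1 then 1 else
      (\<Sum>\<chi>\<in>colourings N T \<pi> - connected_colourings N T \<pi>. \<Prod>\<pi>'\<in>colour_components \<pi> \<chi>.
        (if card \<pi>' < card \<pi> then tree_coeff_rec N T \<pi>' else 0)) /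
      (real (root_degree T) ^ card \<pi> - real (card (connected_colourings N T \<pi>)))) else 0)"
  by pat_completeness auto
termination by (relation "measure (\<lambda>(_, _, \<pi>). card \<pi>)") auto

declare tree_coeff_rec.simps [simp del]

lemma tree_coeff_rec_outside:
  "\<not> (\<exists>S. finite S \<and> \<pi> \<in> NC S) \<Longrightarrow> tree_coeff_rec N T \<pi> = 0"
  by (subst tree_coeff_rec.simps) (simp only: if_False)

lemma tree_coefficients_unique:
  assumes T: "T \<in> Tree N" and n: "root_degree T \<ge> 2"
  shows "\<exists>!\<alpha>. tree_coefficients N T \<alpha> \<and> (\<forall>\<pi>. \<not> (\<exists>S. finite S \<and> \<pi> \<in> NC S) \<longrightarrow> \<alpha> \<pi> = 0)"
proof (rule ex1I)
  have "tree_coefficients N T (tree_coeff_rec N T)"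
    unfolding tree_coefficients_def
  proof (intro allI impI ballI)
    fix S \<pi> assume S: "finite S" "\<pi> \<in> NC S"
    show "(card \<pi> = 1 \<longrightarrow> tree_coeff_rec N T \<pi> = 1) \<and>
       tree_coeff_rec N T \<pi> = 1 / real (root_degree T) ^ card \<pi> *
       (\<Sum>\<chi>\<in>colourings N T \<pi>. \<Prod>\<pi>'\<in>colour_components \<pi> \<chi>. tree_coeff_rec N T \<pi>')"
      unfolding coefficient_equation[OF T n S(2,1)]
      by (subst tree_coeff_rec.simps) (use S in auto)
  qed
  then show "tree_coefficients N T (tree_coeff_rec N T) \<and>
      (\<forall>\<pi>. \<not> (\<exists>S. finite S \<and> \<pi> \<in> NC S) \<longrightarrow> tree_coeff_rec N T \<pi> = 0)"
    using tree_coeff_rec_outside by blast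
next
  fix \<alpha>
  assume a: "tree_coefficients N T \<alpha> \<and> (\<forall>\<pi>. \<not> (\<exists>S. finite S \<and> \<pi> \<in> NC S) \<longrightarrow> \<alpha> \<pi> = 0)"
  have "\<alpha> \<pi> = tree_coeff_rec N T \<pi>" for \<pi>
  proof (induction "card \<pi>" arbitrary: \<pi> rule: less_induct)
    case less
    show ?case
    proof (cases "\<exists>S. finite S \<and> \<pi> \<in> NC S")
      case False
      then have "\<alpha> \<pi> = 0" using a by blast
      moreover have "tree_coeff_rec N T \<pi> = 0" by (rule tree_coeff_rec_outside[OF False])
      ultimately show ?thesis by simp
    next
      case True
      then obtain S where S: "finite S" "\<pi> \<in> NC S" by blast
      have eq: "(if card \<pi>' < card \<pi> then \<alpha> \<pi>' else 0) = (if card \<pi>' < card \<pi> then tree_coeff_rec N T \<pi>' else 0)" for \<pi>'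
        using less by simp
      have "(card \<pi> = 1 \<longrightarrow> \<alpha> \<pi> = 1) \<and> \<alpha> \<pi> = 1 / real (root_degree T) ^ card \<pi> *
         (\<Sum>\<chi>\<in>colourings N T \<pi>. \<Prod>\<pi>'\<in>colour_components \<pi> \<chi>. \<alpha> \<pi>')"
        using a S unfolding tree_coefficients_def by blast
      then show ?thesis
        unfolding coefficient_equation[OF T n S(2,1)] eq
        by (subst tree_coeff_rec.simps) (use True in simp)
    qed
  qed
  then show "\<alpha> = tree_coeff_rec N T" by blast
qed

lemma coeff_top:
  assumes "l \<ge> 1"
  shows "free_coeff {{1..l}} = 1" "boolean_coeff {{1..l}} = 1"
    "T \<in> Tree N \<Longrightarrow> root_degree T \<ge> 2 \<Longrightarrow> tree_coeff N T {{1..l}} = 1"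
proof -
  show "free_coeff {{1..l}} = 1" "boolean_coeff {{1..l}} = 1"
    by (simp_all add: free_coeff_def boolean_coeff_def interval_block_def)
  assume T: "T \<in> Tree N" "root_degree T \<ge> 2"
  have "tree_coefficients N T (tree_coeff N T)"
    unfolding tree_coeff_def using theI'[OF tree_coefficients_unique[OF T]] by blast
  moreover have "{{1..l}} \<in> NC {1..l}" using assms by (intro NC_top) auto
  ultimately show "tree_coeff N T {{1..l}} = 1"
    unfolding tree_coefficients_def by (metis One_nat_def card.empty card.insert empty_iff finite.emptyI finite_atLeastAtMost)
qed

end

(*
Weight a non-crossing partition by 1 for every outer block and by t for every inner one.  Removing
an innermost block shows that these weights satisfy the recursion for the coefficients of an
(n,d)-regular tree exactly if t + d = n t: such a block either keeps the colour of its parent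
(factor t) or takes one of d new colours (factor 1).  So t = d/(n-1).

A weighted moment series M = sum over non-crossing partitions (weight x outer, y inner) of K_pi
satisfies M = 1 + x M I, where the irreducible part I = I_y(K) sums over the block containing the
first and the last argument and fills the gaps of that block with 1/(1 - y I).  Let B and F be the
Boolean and the free cumulants of mu, so that B = I_1(F).  A gap of a block of F inside I_t(B) is
filled with H = 1/(1 - (1+t) I_t(B)), hence I_t(B) = I_{1+t}(F) by uniqueness of the solution, and
the latter is the Boolean cumulant of BN_t(mu).  Thus the moments of BN_t(mu) are the sums of
t^(number of inner blocks) B_pi, which says that its T-free cumulants are B.

The description of a law by its cumulants denotes because every quasi-multilinear family is the
moment family of a unital bimodule map on B<X>; positivity plays no role.
*)

theory Submission
  imports Defs
begin

section \<open>Sums over splittings and selections of a list\<close>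

text \<open>The coefficients do not commute, and the value of a gap multiplies the argument that
  follows the gap, so the series of the overview cannot be composed like power series. They are kept
  as functions on lists of arguments. A product becomes a sum over \<open>splits\<close>; filling
  the gaps of a block becomes \<open>selection\<close>, which scans the list and pushes the weight
  of each finished gap into the next selected argument. Inverses 1/(1 - C) are never formed:
  \<open>renewal\<close> records M = 1 + M * C, which by induction on the length determines M from C
  and C from M. A second obstacle is that the maps in the theorem are definite descriptions. Their
  moments become accessible only once a map with the given cumulants has been constructed, and such
  a construction prescribes moments only on products of letters b X c. The identities between series
  are therefore stated for lists over a set \<open>A\<close> that is closed under multiplication by
  coefficients from the left, since gap weights enter the arguments on that side.\<close>

primrec splits :: "('a list \<Rightarrow> 'a list \<Rightarrow> 'c::comm_monoid_add) \<Rightarrow> 'a list \<Rightarrow> 'c" where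
  "splits f [] = f [] []"
| "splits f (c # xs) = f [] (c # xs) + splits (\<lambda>p q. f (c # p) q) xs"

lemma splits_cong:
  "(\<And>p q. as = p @ q \<Longrightarrow> f p q = g p q) \<Longrightarrow> splits f as = splits g as"
proof (induction as arbitrary: f g)
  case (Cons a as)
  have "splits (\<lambda>p q. f (a # p) q) as = splits (\<lambda>p q. g (a # p) q) as"
    by (rule Cons.IH) (use Cons.prems in auto)
  then show ?case using Cons.prems[of "[]" "a # as"] by simp
qed simp

lemma splits_add: "splits (\<lambda>p q. f p q + g p q) as = splits f as + splits g as"
  by (induction as arbitrary: f g) (simp_all add: ac_simps)

lemma splits_hom:
  assumes "\<And>x y. h (x + y) = h x + h y"
  shows "h (splits f as) = splits (\<lambda>p q. h (f p q)) as"
  by (induction as arbitrary: f) (simp_all add: assms)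

lemma splits_zero: "splits (\<lambda>p q. 0) as = 0"
  by (induction as) simp_all

text \<open>Cutting a list twice can be organised by the first or by the second cut. This is the
  associativity of the convolution of series.\<close>

lemma splits_assoc:
  "splits (\<lambda>p q. splits (\<lambda>g r. \<phi> p g r) q) as = splits (\<lambda>s r. splits (\<lambda>p g. \<phi> p g r) s) as"
  by (induction as arbitrary: \<phi>) (simp_all add: splits_add ac_simps)

lemma splits_left_Nil:
  "(\<And>p q. p \<noteq> [] \<Longrightarrow> f p q = 0) \<Longrightarrow> splits f as = f [] as"
  by (cases as) (simp_all add: splits_zero)

lemma splits_right_Nil:
  "(\<And>p q. q \<noteq> [] \<Longrightarrow> f p q = 0) \<Longrightarrow> splits f as = f as []"
  by (induction as arbitrary: f) simp_all

section \<open>Subsequences with weighted gaps\<close>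

definition multiadditive :: "('a::ab_semigroup_add list \<Rightarrow> 'b::ab_semigroup_add) \<Rightarrow> bool" where
  "multiadditive h \<longleftrightarrow> (\<forall>xs x y ys. h (xs @ (x + y) # ys) = h (xs @ x # ys) + h (xs @ y # ys))"

lemma multiadditive_Cons:
  assumes "multiadditive h"
  shows "multiadditive (\<lambda>xs. h (c # xs))" "h ((x + y) # ys) = h (x # ys) + h (y # ys)"
  using assms append_Cons[of c] append_Nil unfolding multiadditive_def by metis+

text \<open>\<open>selection \<iota> m h g as\<close> sums over all subsequences of \<open>as\<close> that contain its last entry; the
  entries skipped before a selected entry (the first gap is preceded by \<open>g\<close>) enter through \<open>m\<close>.\<close>

primrec selection ::
    "('b \<Rightarrow> 'a::semigroup_mult) \<Rightarrow> ('a list \<Rightarrow> 'b) \<Rightarrow> ('a list \<Rightarrow> 'c::comm_monoid_add) \<Rightarrow> 'a list \<Rightarrow> 'a list \<Rightarrow> 'c" where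
  "selection \<iota> m h g [] = (if g = [] then h [] else 0)"
| "selection \<iota> m h g (a # as) =
     selection \<iota> m (\<lambda>xs. h (\<iota> (m g) * a # xs)) [] as + selection \<iota> m h (g @ [a]) as"

lemma selection_add:
  "selection \<iota> m (\<lambda>xs. h xs + h' xs) g as = selection \<iota> m h g as + selection \<iota> m h' g as"
  by (induction as arbitrary: h h' g) (simp_all add: ac_simps)

lemma selection_hom:
  assumes "\<And>x y. \<theta> (x + y) = \<theta> x + \<theta> y" "\<theta> 0 = 0"
  shows "selection \<iota> m (\<lambda>xs. \<theta> (h xs)) g as = \<theta> (selection \<iota> m h g as)"
  by (induction as arbitrary: h g) (simp_all add: assms)

lemma selection_zero: "selection \<iota> m (\<lambda>xs. 0) g as = 0"
  by (induction as arbitrary: g) simp_all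

lemma selection_delta:
  "selection \<iota> m (\<lambda>xs. if xs = [] then c else 0) g as = (if g = [] \<and> as = [] then c else 0)"
  by (induction as arbitrary: g) (simp_all add: selection_zero)

text \<open>Every gap that is weighed is closed by a selected entry, so \<open>m\<close> is read
  only on lists strictly shorter than the input. The strict bound is what allows gap weights to be
  compared by induction on the length.\<close>

lemma selection_cong:
  assumes "\<And>xs. length xs < length (g @ as) \<Longrightarrow> xs \<in> lists A \<Longrightarrow> m xs = m' xs"
    and "\<And>xs. xs \<in> lists A \<Longrightarrow> h xs = h' xs" and A: "\<And>b a. a \<in> A \<Longrightarrow> \<iota> b * a \<in> A"
    and "g \<in> lists A" "as \<in> lists A"
  shows "selection \<iota> m h g as = selection \<iota> m' h' g as"
  using assms(1,2,4,5)
proof (induction as arbitrary: h h' g)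
  case (Cons a as)
  have a: "a \<in> A" "as \<in> lists A" using Cons.prems(4) by auto
  have "m g = m' g" using Cons.prems(1)[of g] Cons.prems(3) by simp
  moreover have "selection \<iota> m (\<lambda>xs. h (\<iota> (m g) * a # xs)) [] as = selection \<iota> m' (\<lambda>xs. h' (\<iota> (m g) * a # xs)) [] as"
    by (rule Cons.IH) (use Cons.prems(1,2) A a in auto)
  moreover have "selection \<iota> m h (g @ [a]) as = selection \<iota> m' h' (g @ [a]) as"
    by (rule Cons.IH) (use Cons.prems a in auto)
  ultimately show ?case by simp
qed simp

text \<open>Expansion at the first selected entry: \<open>p\<close> is skipped before it, and a
  fresh gap begins after it.\<close>

lemma selection_expand:
  "selection \<iota> m h g as = (if g = [] \<and> as = [] then h [] else 0) +
     splits (\<lambda>p q. case q of [] \<Rightarrow> 0 | a # r \<Rightarrow> selection \<iota> m (\<lambda>xs. h (\<iota> (m (g @ p)) * a # xs)) [] r) as"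
  by (induction as arbitrary: g) simp_all

lemma selection_expand_Nil:
  "selection \<iota> m h [] as = (if as = [] then h [] else 0) +
     splits (\<lambda>p q. case q of [] \<Rightarrow> 0 | a # r \<Rightarrow> selection \<iota> m (\<lambda>xs. h (\<iota> (m p) * a # xs)) [] r) as"
  unfolding selection_expand[of \<iota> m h "[]"] by (simp only: append_Nil simp_thms)

text \<open>A cut of the selected list is a cut of the original list just after the last selected
  entry of the left part. Hence the left part is again a selection and the right part starts with an
  empty gap. If the left part is empty there is no such entry and the initial gap \<open>g\<close>
  stays with the right part, whence the case distinction.\<close>

lemma selection_splits:
  assumes \<psi>: "\<And>x y q. \<psi> (x + y) q = \<psi> x q + \<psi> y q" "\<And>q. \<psi> 0 q = 0"
  shows "selection \<iota> m (splits (\<lambda>p. \<psi> (f p))) g as =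
    splits (\<lambda>p q. if p = [] then selection \<iota> m (\<psi> (f [])) g q
                  else selection \<iota> m (\<psi> (selection \<iota> m f g p)) [] q) as"
proof (induction as arbitrary: f g)
  case (Cons a as)
  define c where "c = \<iota> (m g) * a"
  have [simp]: "\<psi> (x + y) = (\<lambda>q. \<psi> x q + \<psi> y q)" for x y by (rule ext) (rule \<psi>)
  have [simp]: "\<psi> 0 = (\<lambda>q. 0)" by (rule ext) (rule \<psi>)
  \<comment> \<open>With an empty initial gap both branches of the case distinction
    coincide.\<close>
  have g0: "selection \<iota> m (splits (\<lambda>p. \<psi> (f p))) [] as = splits (\<lambda>p q. selection \<iota> m (\<psi> (selection \<iota> m f [] p)) [] q) as" for f
    unfolding Cons.IH by (rule splits_cong) simp
  have "selection \<iota> m (\<lambda>xs. splits (\<lambda>p. \<psi> (f p)) (c # xs)) [] as =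
      selection \<iota> m (\<lambda>xs. \<psi> (f []) (c # xs)) [] as +
      splits (\<lambda>p q. selection \<iota> m (\<psi> (selection \<iota> m (\<lambda>xs. f (c # xs)) [] p)) [] q) as"
    using g0[of "\<lambda>p. f (c # p)"] by (simp add: selection_add)
  moreover have "selection \<iota> m (splits (\<lambda>p. \<psi> (f p))) (g @ [a]) as =
     selection \<iota> m (\<psi> (f [])) (g @ [a]) as +
     splits (\<lambda>p q. selection \<iota> m (\<psi> (selection \<iota> m f (g @ [a]) p)) [] q) as"
    unfolding Cons.IH by (cases as) (simp_all add: selection_zero)
  ultimately show ?case by (simp add: c_def[symmetric] selection_add splits_add ac_simps)
qed simp

text \<open>Before an entry that survives both selections lies a part \<open>p\<close> that ends
  with an entry kept by the first selection only (or is empty), followed by a part \<open>q\<close>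
  that the first selection skips. The second selection weighs the survivors of \<open>p\<close> by
  \<open>M\<close>, while \<open>q\<close> has the weight \<open>m q\<close> already, so the merged
  gap has the product as weight.\<close>

lemma selection_selection:
  fixes \<iota> :: "'b::ring_1 \<Rightarrow> 'a::ring_1" and h :: "'a list \<Rightarrow> 'c::ab_group_add"
  assumes \<iota>: "\<And>x y. \<iota> (x + y) = \<iota> x + \<iota> y" "\<And>x y. \<iota> (x * y) = \<iota> x * \<iota> y"
    and h: "multiadditive h"
  shows "selection \<iota> m (selection \<iota> M h []) [] as =
    selection \<iota> (splits (\<lambda>p q. selection \<iota> m M [] p * m q)) h [] as"
  using h
proof (induction "length as" arbitrary: as h rule: less_induct)
  case less
  define H where "H = splits (\<lambda>p q. selection \<iota> m M [] p * m q)"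
  \<comment> \<open>The tail of an expansion at a selected entry: the head of \<open>q\<close> is
    taken with coefficient \<open>\<beta>\<close> on its left, and the scan goes on with gap weight
    \<open>N\<close>.\<close>
  define \<psi> where "\<psi> N \<beta> q = (case q of [] \<Rightarrow> 0 | a # r \<Rightarrow> selection \<iota> N (\<lambda>xs. h (\<iota> \<beta> * a # xs)) [] r)"
    for N \<beta> q
  note h = multiadditive_Cons[OF less.prems]
  have add: "\<psi> N (x + y) q = \<psi> N x q + \<psi> N y q" for N x y q
    by (cases q) (simp_all add: \<psi>_def \<iota> distrib_right h(2) selection_add)
  have zero: "\<psi> N 0 q = 0" for N q using add[of N 0 0 q] by simp
  have ex: "selection \<iota> N h [] = (\<lambda>xs. (if xs = [] then h [] else 0) + splits (\<lambda>p. \<psi> N (N p)) xs)" for N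
    by (rule ext) (simp add: selection_expand_Nil[of \<iota> N h] \<psi>_def[abs_def])
  \<comment> \<open>The head that both selections keep collects \<open>\<beta>\<close> and the
    weight of its gap. It is consumed, so the rest is shorter and the induction hypothesis replaces
    the double selection by a single one with weight \<open>H\<close>.\<close>
  have IH: "selection \<iota> m (\<psi> M \<beta>) [] q = splits (\<lambda>g r. \<psi> H (\<beta> * m g) r) q" if "length q \<le> length as" for \<beta> q
  proof -
    have "splits (\<lambda>p r. case r of [] \<Rightarrow> 0
        | a # r \<Rightarrow> selection \<iota> m (\<lambda>xs. \<psi> M \<beta> (\<iota> (m p) * a # xs)) [] r) q = splits (\<lambda>g r. \<psi> H (\<beta> * m g) r) q"
    proof (rule splits_cong)
      fix p r assume q: "q = p @ r"
      show "(case r of [] \<Rightarrow> 0 | a # r \<Rightarrow> selection \<iota> m (\<lambda>xs. \<psi> M \<beta> (\<iota> (m p) * a # xs)) [] r) =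
        \<psi> H (\<beta> * m p) r"
      proof (cases r)
        case (Cons a r')
        have "length r' < length as" using that q Cons by simp
        from less.hyps[OF this h(1), of "\<iota> \<beta> * (\<iota> (m p) * a)"] show ?thesis
          by (simp add: Cons \<psi>_def H_def \<iota> mult.assoc)
      qed (simp add: \<psi>_def)
    qed
    moreover have "\<psi> N x [] = 0" for N x by (simp add: \<psi>_def)
    ultimately show ?thesis by (simp add: selection_expand_Nil[of \<iota> m "\<psi> M \<beta>"])
  qed
  have "selection \<iota> m (selection \<iota> M h []) [] as = (if as = [] then h [] else 0) +
      splits (\<lambda>p q. selection \<iota> m (\<psi> M (selection \<iota> m M [] p)) [] q) as"
    unfolding ex[of M] selection_add selection_delta
      selection_splits[of "\<psi> M", OF add zero] by (auto intro!: splits_cong)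
  also have "splits (\<lambda>p q. selection \<iota> m (\<psi> M (selection \<iota> m M [] p)) [] q) as =
      splits (\<lambda>p. splits (\<lambda>g r. \<psi> H (selection \<iota> m M [] p * m g) r)) as"
    by (rule splits_cong) (simp add: IH)
  also have "\<dots> = splits (\<lambda>s r. \<psi> H (H s) r) as"
    unfolding splits_assoc H_def splits_hom[of "\<lambda>x. \<psi> N x r" for N r, OF add] ..
  finally show ?case by (simp add: ex H_def)
qed

text \<open>The contribution of the partitions whose first and last argument share a block: the
  first entry belongs to it outright, \<open>selection\<close> forces the last one, and
  \<open>m\<close> fills the gaps.\<close>

definition irreducible_part ::
    "('b \<Rightarrow> 'a::semigroup_mult) \<Rightarrow> ('a list \<Rightarrow> 'b) \<Rightarrow> ('a list \<Rightarrow> 'b::comm_monoid_add) \<Rightarrow> 'a list \<Rightarrow> 'b" where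
  "irreducible_part \<iota> m K as = (case as of [] \<Rightarrow> 0 | a # r \<Rightarrow> selection \<iota> m (\<lambda>xs. K (a # xs)) [] r)"

lemma irreducible_part_simps [simp]:
  "irreducible_part \<iota> m K [] = 0"
  "irreducible_part \<iota> m K (a # r) = selection \<iota> m (\<lambda>xs. K (a # xs)) [] r"
  by (simp_all add: irreducible_part_def)

lemma irreducible_part_cong:
  assumes "\<And>xs. length xs < length as \<Longrightarrow> xs \<in> lists A \<Longrightarrow> m xs = m' xs"
    and "\<And>xs. xs \<in> lists A \<Longrightarrow> xs \<noteq> [] \<Longrightarrow> K xs = K' xs"
    and "\<And>b a. a \<in> A \<Longrightarrow> \<iota> b * a \<in> A" "as \<in> lists A"
  shows "irreducible_part \<iota> m K as = irreducible_part \<iota> m' K' as"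
proof (cases as)
  case (Cons a r)
  show ?thesis
    unfolding Cons irreducible_part_simps
    by (rule selection_cong[where A = A]) (use assms Cons in auto)
qed simp

lemma irreducible_part_irreducible_part:
  fixes \<iota> :: "'b::ring_1 \<Rightarrow> 'a::ring_1"
  assumes \<iota>: "\<And>x y. \<iota> (x + y) = \<iota> x + \<iota> y" "\<And>x y. \<iota> (x * y) = \<iota> x * \<iota> y"
    and h: "multiadditive h"
  shows "irreducible_part \<iota> m (irreducible_part \<iota> M h) as =
    irreducible_part \<iota> (splits (\<lambda>p q. selection \<iota> m M [] p * m q)) h as"
  by (cases as) (simp_all add: selection_selection[OF \<iota> multiadditive_Cons(1)[OF h]])

section \<open>Renewal equations, that is, M = 1/(1 - C) for the convolution of series\<close>

definition renewal :: "'a set \<Rightarrow> ('a list \<Rightarrow> 'b::ring_1) \<Rightarrow> ('a list \<Rightarrow> 'b) \<Rightarrow> bool" where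
  "renewal A M C \<longleftrightarrow> C [] = 0 \<and>
     (\<forall>as\<in>lists A. M as = (if as = [] then 1 else 0) + splits (\<lambda>p q. M p * C q) as)"

lemma renewalD: "renewal A M C \<Longrightarrow> as \<in> lists A \<Longrightarrow>
    M as = (if as = [] then 1 else 0) + splits (\<lambda>p q. M p * C q) as"
  by (simp add: renewal_def)

lemma renewal_zero: "renewal A M C \<Longrightarrow> C [] = 0"
  unfolding renewal_def by (rule conjunct1)

lemma renewal_Nil:
  assumes "renewal A M C"
  shows "M [] = 1"
  by (subst renewalD[OF assms]) (simp_all add: renewal_zero[OF assms])

text \<open>Subtracting the two equations gives M * (C - C') = 0. By induction only the cut with an
  empty left part contributes to this convolution, and there \<open>M [] = 1\<close>.\<close>

lemma renewal_increments_unique: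
  assumes M: "renewal A M C" "renewal A M C'" and as: "as \<in> lists A"
  shows "C as = C' as"
  using as
proof (induction "length as" arbitrary: as rule: less_induct)
  case less
  \<comment> \<open>The left side is written as a convolution concentrated at \<open>p = []\<close>,
    so that it can be compared cut by cut.\<close>
  have "C as - C' as = splits (\<lambda>p q. M p * (C q - C' q)) as"
  proof (subst splits_left_Nil[where f = "\<lambda>p q. if p = [] then C q - C' q else 0", of as, simplified, symmetric])
    show "splits (\<lambda>p q. if p = [] then C q - C' q else 0) as = splits (\<lambda>p q. M p * (C q - C' q)) as"
    proof (rule splits_cong)
      fix p q assume pq: "as = p @ q"
      then have "p \<noteq> [] \<Longrightarrow> C q = C' q" using less by auto
      then show "(if p = [] then C q - C' q else 0) = M p * (C q - C' q)"
        using renewal_Nil[OF M(1)] by auto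
    qed
  qed
  also have "\<dots> = splits (\<lambda>p q. M p * C q) as - splits (\<lambda>p q. M p * C' q) as"
    using splits_add[of "\<lambda>p q. M p * (C q - C' q)" "\<lambda>p q. M p * C' q" as] by (simp add: right_diff_distrib)
  also have "\<dots> = 0" using renewalD[OF M(1) less.prems] renewalD[OF M(2) less.prems] by simp
  finally show ?case by simp
qed

text \<open>The increments may themselves depend on the solutions, as irreducible parts do whose
  gaps are weighed by the solution. It suffices that they agree at a list once the solutions agree
  on shorter lists, because gaps are shorter than the list.\<close>

lemma renewal_unique:
  assumes M: "renewal A M C" "renewal A M' C'"
    and eq: "\<And>as. (\<And>xs. xs \<in> lists A \<Longrightarrow> length xs < length as \<Longrightarrow> M xs = M' xs) \<Longrightarrow>
      as \<in> lists A \<Longrightarrow> C as = C' as"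
    and as: "as \<in> lists A"
  shows "M as = M' as"
  using as
proof (induction "length as" arbitrary: as rule: less_induct)
  case less
  have "splits (\<lambda>p q. M p * C q) as = splits (\<lambda>p q. M' p * C' q) as"
  proof (rule splits_cong)
    fix p q assume pq: "as = p @ q"
    have "C q = C' q" by (rule eq) (use less pq in auto)
    moreover have "q \<noteq> [] \<Longrightarrow> M p = M' p" using less pq by auto
    moreover note renewal_zero[OF M(1)] renewal_zero[OF M(2)]
    ultimately show "M p * C q = M' p * C' q" by (cases "q = []") auto
  qed
  then show ?case using renewalD[OF M(1) less.prems] renewalD[OF M(2) less.prems] by simp
qed

text \<open>With \<open>m = 1/(1 - tI)\<close> and \<open>M = 1/(1 - B)\<close> (renewal equations), the gap weight of the composed
  selection is \<open>1/(1 - (1 + t)I)\<close>.\<close>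

lemma renewal_composition:
  fixes \<iota> :: "'b::real_algebra_1 \<Rightarrow> 'a::ring_1" and t :: real
  assumes B: "\<And>b x xs. B (\<iota> b * x # xs) = b * B (x # xs)"
    and A: "\<And>b a. a \<in> A \<Longrightarrow> \<iota> b * a \<in> A"
    and M: "renewal A M B"
    and m: "renewal A m (\<lambda>as. t *\<^sub>R irreducible_part \<iota> m B as)"
  shows "renewal A (splits (\<lambda>p q. selection \<iota> m M [] p * m q))
    (\<lambda>as. (1 + t) *\<^sub>R irreducible_part \<iota> m B as)"
proof -
  define I where "I = irreducible_part \<iota> m B"
  define H where "H = splits (\<lambda>p q. selection \<iota> m M [] p * m q)"
  define \<psi> where "\<psi> \<beta> q = \<beta> * B q" for \<beta> q
  have \<psi>: "\<psi> (x + y) q = \<psi> x q + \<psi> y q" "\<psi> 0 q = 0" for x y q by (simp_all add: \<psi>_def distrib_right)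
  \<comment> \<open>Left linearity of \<open>B\<close> moves the weight of the initial gap out of
    the selection.\<close>
  have mI: "selection \<iota> m B [] q = splits (\<lambda>g r. m g * I r) q" for q
  proof -
    have "m g * I r = (case r of [] \<Rightarrow> 0 | a # r \<Rightarrow> selection \<iota> m (\<lambda>xs. B (\<iota> (m g) * a # xs)) [] r)" for g r
      by (cases r) (simp_all add: I_def B selection_hom[of "\<lambda>x. m g * x"] distrib_left)
    then show ?thesis by (simp add: selection_expand_Nil[of \<iota> m B] renewal_zero[OF M])
  qed
  \<comment> \<open>Write S for the selection of \<open>M\<close>. Selecting in M = 1 + M * B gives
    S = 1 + S * m * I by the previous step, and S * m is \<open>H\<close>.\<close>
  have sel: "selection \<iota> m M [] as = (if as = [] then 1 else 0) + splits (\<lambda>p q. H p * I q) as" if as: "as \<in> lists A" for as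
  proof -
    have "selection \<iota> m M [] as = selection \<iota> m (\<lambda>as. (if as = [] then 1 else 0) + splits (\<lambda>p q. M p * B q) as) [] as"
      by (rule selection_cong[where A = A]) (use renewalD[OF M] A as in auto)
    also have "\<dots> = (if as = [] then 1 else 0) + selection \<iota> m (splits (\<lambda>p. \<psi> (M p))) [] as"
      by (simp add: selection_add selection_delta \<psi>_def[abs_def])
    also have "selection \<iota> m (splits (\<lambda>p. \<psi> (M p))) [] as =
        splits (\<lambda>p q. selection \<iota> m M [] p * splits (\<lambda>g r. m g * I r) q) as"
      unfolding selection_splits[of \<psi>, OF \<psi>]
    proof (rule splits_cong)
      fix p q
      have "selection \<iota> m (\<psi> \<beta>) [] q = \<beta> * splits (\<lambda>g r. m g * I r) q" for \<beta> q
        unfolding mI[symmetric] \<psi>_def by (rule selection_hom) (simp_all add: distrib_left)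
      then show "(if p = [] then selection \<iota> m (\<psi> (M [])) [] q else selection \<iota> m (\<psi> (selection \<iota> m M [] p)) [] q) =
         selection \<iota> m M [] p * splits (\<lambda>g r. m g * I r) q" by simp
    qed
    also have "\<dots> = splits (\<lambda>p q. splits (\<lambda>g r. selection \<iota> m M [] p * m g * I r) q) as"
      by (rule splits_cong) (simp add: splits_hom[where h = "\<lambda>x. y * x" for y] distrib_left mult.assoc)
    also have "\<dots> = splits (\<lambda>p q. H p * I q) as"
      unfolding splits_assoc H_def
      by (rule splits_cong) (simp add: splits_hom[where h = "\<lambda>x. x * y" for y] distrib_right)
    finally show ?thesis .
  qed
  \<comment> \<open>Inserting m = 1 + m * t I into H = S * m gives H = S + H * t I; with S = 1 + H *
    I this is the claim.\<close>
  have "H as = (if as = [] then 1 else 0) + splits (\<lambda>p q. H p * ((1 + t) *\<^sub>R I q)) as" if as: "as \<in> lists A" for as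
  proof -
    have "H as = splits (\<lambda>p q. selection \<iota> m M [] p * (if q = [] then 1 else 0) +
        splits (\<lambda>g r. selection \<iota> m M [] p * m g * (t *\<^sub>R I r)) q) as"
      unfolding H_def
    proof (rule splits_cong)
      fix p q assume "as = p @ q"
      then have q: "q \<in> lists A" using as by simp
      show "selection \<iota> m M [] p * m q = selection \<iota> m M [] p * (if q = [] then 1 else 0) +
        splits (\<lambda>g r. selection \<iota> m M [] p * m g * (t *\<^sub>R I r)) q"
        by (subst renewalD[OF m q])
          (simp add: splits_hom[where h = "\<lambda>x. y * x" for y] distrib_left mult.assoc I_def)
    qed
    also have "\<dots> = splits (\<lambda>p q. selection \<iota> m M [] p * (if q = [] then 1 else 0)) as + splits (\<lambda>p q. H p * (t *\<^sub>R I q)) as"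
      unfolding splits_add splits_assoc H_def
      by (rule arg_cong2[where f = "(+)", OF refl], rule splits_cong)
        (simp add: splits_hom[where h = "\<lambda>x. x * y" for y] splits_hom[where h = "\<lambda>x. t *\<^sub>R x"] distrib_right scaleR_add_right)
    also have "splits (\<lambda>p q. selection \<iota> m M [] p * (if q = [] then 1 else 0)) as = selection \<iota> m M [] as"
      by (subst splits_right_Nil) auto
    also have "\<dots> + splits (\<lambda>p q. H p * (t *\<^sub>R I q)) as =
        (if as = [] then 1 else 0) + splits (\<lambda>p q. H p * ((1 + t) *\<^sub>R I q)) as"
      unfolding sel[OF as] add.assoc splits_add[symmetric] by (simp add: scaleR_add_left distrib_left)
    finally show ?thesis .
  qed
  moreover have "I [] = 0" by (simp add: I_def)
  ultimately show ?thesis by (auto simp: renewal_def H_def I_def)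
qed

text \<open>Since \<open>M\<close> determines its increments, B = I_M(F) on \<open>A\<close>, and
  composition gives I_m(B) = I_H(F). So the increments of \<open>H\<close> are (1 + t) I_H(F), which
  is the same recursive equation as that of \<open>L\<close>, and H = L.\<close>

lemma irreducible_part_semigroup:
  fixes \<iota> :: "'b::real_algebra_1 \<Rightarrow> 'a::ring_1" and t :: real
  assumes \<iota>: "\<And>x y. \<iota> (x + y) = \<iota> x + \<iota> y" "\<And>x y. \<iota> (x * y) = \<iota> x * \<iota> y"
    and A: "\<And>b a. a \<in> A \<Longrightarrow> \<iota> b * a \<in> A"
    and B: "\<And>b x xs. B (\<iota> b * x # xs) = b * B (x # xs)" and F: "multiadditive F"
    and M: "renewal A M B" "renewal A M (irreducible_part \<iota> M F)"
    and m: "renewal A m (\<lambda>as. t *\<^sub>R irreducible_part \<iota> m B as)"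
    and L: "renewal A L (\<lambda>as. (1 + t) *\<^sub>R irreducible_part \<iota> L F as)"
    and as: "as \<in> lists A"
  shows "irreducible_part \<iota> m B as = irreducible_part \<iota> L F as"
proof -
  define H where "H = splits (\<lambda>p q. selection \<iota> m M [] p * m q)"
  have I: "irreducible_part \<iota> m B as = irreducible_part \<iota> H F as" if "as \<in> lists A" for as
  proof -
    have "irreducible_part \<iota> m B as = irreducible_part \<iota> m (irreducible_part \<iota> M F) as"
      by (rule irreducible_part_cong[where A = A])
        (use that A renewal_increments_unique[OF M] in auto)
    then show ?thesis by (simp add: irreducible_part_irreducible_part[OF \<iota> F] H_def)
  qed
  have "H as = L as" if "as \<in> lists A" for as
  proof (rule renewal_unique[OF _ L _ that])
    show "renewal A H (\<lambda>as. (1 + t) *\<^sub>R irreducible_part \<iota> m B as)"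
      unfolding H_def by (rule renewal_composition[OF B A M(1) m])
    fix as assume "\<And>xs. xs \<in> lists A \<Longrightarrow> length xs < length as \<Longrightarrow> H xs = L xs" "as \<in> lists A"
    then show "(1 + t) *\<^sub>R irreducible_part \<iota> m B as = (1 + t) *\<^sub>R irreducible_part \<iota> L F as"
      using I A by (simp add: irreducible_part_cong[where A = A and m = H and m' = L])
  qed
  then show ?thesis using I[OF as] A as by (simp add: irreducible_part_cong[where A = A and m = H and m' = L])
qed

section \<open>Weighted sums over non-crossing partitions\<close>

text \<open>The pairs (1, 1) and (1, 0) give the free and the Boolean coefficients and (1, d/(n-1))
  those of a regular tree, so that one moment formula serves all three.\<close>

definition block_weight :: "real \<Rightarrow> real \<Rightarrow> nat set set \<Rightarrow> real" where
  "block_weight x y \<pi> = (\<Prod>V\<in>\<pi>. if \<exists>W\<in>\<pi>. nested W V then y else x)"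

lemma NC_empty: "NC {} = {{}}"
  by (auto simp: NC_def partition_on_def)

lemma NC_subset:
  assumes \<pi>: "\<pi> \<in> NC S" and \<tau>: "\<tau> \<subseteq> \<pi>"
  shows "\<tau> \<in> NC (\<Union>\<tau>)"
proof -
  note D = NC_D[OF \<pi>]
  have "partition_on (\<Union>\<tau>) \<tau>"
    using D(2,3) \<tau> by (intro partition_onI) (auto simp: disjnt_def)
  then show ?thesis
    unfolding NC_def by (intro CollectI conjI ballI allI impI) (use D(4) \<tau> in \<open>blast+\<close>)
qed

section \<open>Filling one gap of a non-crossing partition\<close>

context
  fixes A G B :: "nat set"
  assumes fin: "finite A" "finite G" "finite B"
    and order: "\<And>a g. a \<in> A \<Longrightarrow> g \<in> G \<Longrightarrow> a < g" "\<And>g b. g \<in> G \<Longrightarrow> b \<in> B \<Longrightarrow> g < b"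
      "\<And>a b. a \<in> A \<Longrightarrow> b \<in> B \<Longrightarrow> a < b"
begin

lemma gap_disjoint: "(A \<union> B) \<inter> G = {}"
  using order by fastforce

lemma not_between_gap: "g \<in> G \<Longrightarrow> g' \<in> G \<Longrightarrow> s \<in> A \<union> B \<Longrightarrow> g < s \<Longrightarrow> s < g' \<Longrightarrow> False"
  using order by (metis Un_iff order.asym)

lemma gap_blocks:
  assumes \<sigma>: "\<sigma> \<in> NC (A \<union> B)" and \<rho>: "\<rho> \<in> NC G"
  shows "W \<in> \<sigma> \<Longrightarrow> W \<noteq> {} \<and> W \<inter> G = {}" "W \<in> \<rho> \<Longrightarrow> W \<noteq> {} \<and> W \<subseteq> G"
proof -
  show "W \<noteq> {} \<and> W \<subseteq> G" if "W \<in> \<rho>" using NC_D(1,2)[OF \<rho>] that by blast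
  assume W: "W \<in> \<sigma>"
  then have "W \<noteq> {}" "W \<subseteq> A \<union> B" using NC_D(1,2)[OF \<sigma>] by auto
  then show "W \<noteq> {} \<and> W \<inter> G = {}" using gap_disjoint by blast
qed

lemma NC_gap_union:
  assumes \<sigma>: "\<sigma> \<in> NC (A \<union> B)" and \<rho>: "\<rho> \<in> NC G"
  shows "\<sigma> \<union> \<rho> \<in> NC (A \<union> B \<union> G)"
proof -
  note S = NC_D[OF \<sigma>] and R = NC_D[OF \<rho>]
  have "partition_on (A \<union> B \<union> G) (\<sigma> \<union> \<rho>)"
    using S(1-3) R(1-3) gap_blocks[OF \<sigma> \<rho>] by (intro partition_onI) (auto simp: disjnt_def, blast+)
  moreover have "V = W"
    if V: "V \<in> \<sigma> \<union> \<rho>" "W \<in> \<sigma> \<union> \<rho>" and l: "i < j" "j < k" "k < l" "i \<in> V" "k \<in> V" "j \<in> W" "l \<in> W" for V W i j k l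
  proof -
    have sub: "U \<in> \<sigma> \<Longrightarrow> U \<subseteq> A \<union> B" "U \<in> \<rho> \<Longrightarrow> U \<subseteq> G" for U using S(1) R(1) by auto
    consider "V \<in> \<sigma>" "W \<in> \<sigma>" | "V \<in> \<rho>" "W \<in> \<rho>" | "V \<in> \<sigma>" "W \<in> \<rho>" | "V \<in> \<rho>" "W \<in> \<sigma>" using V by blast
    then show ?thesis
    proof cases
      case 1 then show ?thesis using S(4) l by blast
    next
      case 2 then show ?thesis using R(4) l by blast
    next
      case 3 then show ?thesis using not_between_gap[of j l k] sub[of V] sub[of W] l by blast
    next
      case 4 then show ?thesis using not_between_gap[of i k j] sub[of V] sub[of W] l by blast
    qed
  qed
  ultimately show ?thesis unfolding NC_def by blast
qed

lemma NC_gap_split: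
  assumes \<pi>: "\<pi> \<in> NC (A \<union> B \<union> G)" and sat: "\<And>W. W \<in> \<pi> \<Longrightarrow> W \<subseteq> G \<or> W \<inter> G = {}"
  shows "{W\<in>\<pi>. W \<inter> G = {}} \<in> NC (A \<union> B)" "{W\<in>\<pi>. W \<subseteq> G} \<in> NC G"
    "{W\<in>\<pi>. W \<inter> G = {}} \<union> {W\<in>\<pi>. W \<subseteq> G} = \<pi>"
proof -
  note D = NC_D[OF \<pi>]
  have sub: "\<tau> \<subseteq> \<pi> \<Longrightarrow> \<Union>\<tau> = S \<Longrightarrow> \<tau> \<in> NC S" for \<tau> S
    using NC_subset[OF \<pi>] by metis
  have cover: "\<exists>W\<in>\<pi>. s \<in> W" if "s \<in> A \<union> B \<union> G" for s
    using that unfolding D(1)[symmetric] by (rule UnionE) blast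
  have inside: "s \<in> A \<union> B \<union> G" if "s \<in> W" "W \<in> \<pi>" for s W
    unfolding D(1)[symmetric] using that(2,1) by (rule UnionI)
  have outside: "s \<notin> G" if "s \<in> A \<union> B" for s using gap_disjoint that by blast
  show "{W\<in>\<pi>. W \<inter> G = {}} \<in> NC (A \<union> B)"
  proof (rule sub)
    show "\<Union>{W\<in>\<pi>. W \<inter> G = {}} = A \<union> B"
    proof (intro equalityI subsetI)
      fix s assume s: "s \<in> A \<union> B"
      then obtain W where W: "W \<in> \<pi>" "s \<in> W" using cover[of s] by blast
      then have "W \<inter> G = {}" using sat[OF W(1)] outside[OF s] by blast
      then show "s \<in> \<Union>{W\<in>\<pi>. W \<inter> G = {}}" using W by blast
    next
      fix s assume "s \<in> \<Union>{W\<in>\<pi>. W \<inter> G = {}}"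
      then obtain W where "W \<in> \<pi>" "s \<in> W" "W \<inter> G = {}" by blast
      then show "s \<in> A \<union> B" using inside[of s W] by blast
    qed
  qed blast
  show "{W\<in>\<pi>. W \<subseteq> G} \<in> NC G"
  proof (rule sub)
    show "\<Union>{W\<in>\<pi>. W \<subseteq> G} = G"
    proof (intro equalityI subsetI)
      fix s assume s: "s \<in> G"
      then obtain W where W: "W \<in> \<pi>" "s \<in> W" using cover[of s] by blast
      then have "W \<subseteq> G" using sat[OF W(1)] s by blast
      then show "s \<in> \<Union>{W\<in>\<pi>. W \<subseteq> G}" using W by blast
    qed blast
  qed blast
  show "{W\<in>\<pi>. W \<inter> G = {}} \<union> {W\<in>\<pi>. W \<subseteq> G} = \<pi>" using sat by blast
qed

text \<open>No point of \<open>A \<union> B\<close> lies between two points of \<open>G\<close>, so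
  a partition outside the gap and one inside never cross and may be chosen independently. The
  predicate \<open>Q\<close> carries the condition on the block around the gap.\<close>

lemma sum_NC_gap:
  fixes f :: "nat set set \<Rightarrow> 'b::comm_monoid_add"
  shows "(\<Sum>\<pi> | \<pi> \<in> NC (A \<union> B \<union> G) \<and> (\<forall>W\<in>\<pi>. W \<subseteq> G \<or> W \<inter> G = {}) \<and> Q {W\<in>\<pi>. W \<inter> G = {}}. f \<pi>) =
    (\<Sum>\<rho>\<in>NC G. \<Sum>\<sigma> | \<sigma> \<in> NC (A \<union> B) \<and> Q \<sigma>. f (\<sigma> \<union> \<rho>))"
proof -
  have out: "{W\<in>\<sigma> \<union> \<rho>. W \<inter> G = {}} = \<sigma>" "{W\<in>\<sigma> \<union> \<rho>. W \<subseteq> G} = \<rho>"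
    if "\<sigma> \<in> NC (A \<union> B)" "\<rho> \<in> NC G" for \<sigma> \<rho>
    using gap_blocks[OF that] by auto
  have sat: "W \<subseteq> G \<or> W \<inter> G = {}" if "\<sigma> \<in> NC (A \<union> B)" "\<rho> \<in> NC G" "W \<in> \<sigma> \<union> \<rho>" for \<sigma> \<rho> W
    using gap_blocks[OF that(1,2)] that(3) by blast
  define L where "L = {\<pi> \<in> NC (A \<union> B \<union> G). (\<forall>W\<in>\<pi>. W \<subseteq> G \<or> W \<inter> G = {}) \<and> Q {W\<in>\<pi>. W \<inter> G = {}}}"
  define R where "R = NC G \<times> {\<sigma> \<in> NC (A \<union> B). Q \<sigma>}"
  have "sum f L = (\<Sum>(\<rho>, \<sigma>)\<in>R. f (\<sigma> \<union> \<rho>))"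
  proof (rule sum.reindex_bij_witness[where i = "\<lambda>(\<rho>, \<sigma>). \<sigma> \<union> \<rho>"
          and j = "\<lambda>\<pi>. ({W\<in>\<pi>. W \<subseteq> G}, {W\<in>\<pi>. W \<inter> G = {}})"])
    fix \<pi> assume "\<pi> \<in> L"
    then have \<pi>: "\<pi> \<in> NC (A \<union> B \<union> G)" "\<And>W. W \<in> \<pi> \<Longrightarrow> W \<subseteq> G \<or> W \<inter> G = {}" "Q {W\<in>\<pi>. W \<inter> G = {}}"
      unfolding L_def by blast+
    note split = NC_gap_split[OF \<pi>(1,2)]
    show "(\<lambda>(\<rho>, \<sigma>). \<sigma> \<union> \<rho>) ({W\<in>\<pi>. W \<subseteq> G}, {W\<in>\<pi>. W \<inter> G = {}}) = \<pi>"
      unfolding prod.case by (rule split(3))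
    show "({W\<in>\<pi>. W \<subseteq> G}, {W\<in>\<pi>. W \<inter> G = {}}) \<in> R" unfolding R_def using split(1,2) \<pi>(3) by blast
    show "(case ({W\<in>\<pi>. W \<subseteq> G}, {W\<in>\<pi>. W \<inter> G = {}}) of (\<rho>, \<sigma>) \<Rightarrow> f (\<sigma> \<union> \<rho>)) = f \<pi>"
      unfolding prod.case by (rule arg_cong[OF split(3)])
  next
    fix b assume "b \<in> R"
    then obtain \<rho> \<sigma> where b: "b = (\<rho>, \<sigma>)" "\<rho> \<in> NC G" "\<sigma> \<in> NC (A \<union> B)" "Q \<sigma>" unfolding R_def by blast
    show "({W\<in>case b of (\<rho>, \<sigma>) \<Rightarrow> \<sigma> \<union> \<rho>. W \<subseteq> G}, {W\<in>case b of (\<rho>, \<sigma>) \<Rightarrow> \<sigma> \<union> \<rho>. W \<inter> G = {}}) = b"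
      unfolding b(1) prod.case out[OF b(3,2)] ..
    show "(case b of (\<rho>, \<sigma>) \<Rightarrow> \<sigma> \<union> \<rho>) \<in> L"
      unfolding L_def b(1) prod.case mem_Collect_eq out[OF b(3,2)]
      using NC_gap_union[OF b(3,2)] sat[OF b(3,2)] b(4) by blast
  qed
  then have "sum f L = (\<Sum>(\<rho>, \<sigma>)\<in>NC G \<times> {\<sigma> \<in> NC (A \<union> B). Q \<sigma>}. f (\<sigma> \<union> \<rho>))"
    unfolding R_def .
  also have "\<dots> = (\<Sum>\<rho>\<in>NC G. \<Sum>\<sigma> | \<sigma> \<in> NC (A \<union> B) \<and> Q \<sigma>. f (\<sigma> \<union> \<rho>))"
    using finite_NC fin by (simp add: sum.cartesian_product)
  finally show ?thesis unfolding L_def .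
qed

text \<open>A block inside the gap nests no block outside, so the weights of \<open>\<sigma>\<close>
  are unchanged. A block that meets both sides makes all of \<open>\<rho>\<close> inner; with
  nothing on the left, no block of \<open>\<sigma>\<close> nests one of \<open>\<rho>\<close> and
  outer blocks stay outer.\<close>

lemma block_weight_gap:
  assumes \<sigma>: "\<sigma> \<in> NC (A \<union> B)" and \<rho>: "\<rho> \<in> NC G"
  shows "\<exists>C\<in>\<sigma>. C \<inter> A \<noteq> {} \<and> C \<inter> B \<noteq> {} \<Longrightarrow>
      block_weight x y (\<sigma> \<union> \<rho>) = block_weight x y \<sigma> * block_weight y y \<rho>"
    and "A = {} \<Longrightarrow> block_weight x y (\<sigma> \<union> \<rho>) = block_weight x y \<sigma> * block_weight x y \<rho>"
proof -
  note S = NC_D[OF \<sigma>] and R = NC_D[OF \<rho>]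
  have disj: "\<sigma> \<inter> \<rho> = {}" using gap_blocks[OF \<sigma> \<rho>] by blast
  have f: "finite \<sigma>" "finite \<rho>" using NC_finite(1)[OF \<sigma>] NC_finite(1)[OF \<rho>] fin by auto
  have up: "(\<exists>W\<in>\<sigma> \<union> \<rho>. nested W V) \<longleftrightarrow> (\<exists>W\<in>\<sigma>. nested W V)" if V: "V \<in> \<sigma>" for V
  proof -
    have "\<not> nested W V" if "W \<in> \<rho>" for W
    proof
      assume "nested W V"
      then obtain j k where jk: "j \<in> W" "k \<in> W" "\<And>v. v \<in> V \<Longrightarrow> j < v \<and> v < k" unfolding nested_def by blast
      obtain v where "v \<in> V" using S(2) V by (metis ex_in_conv)
      then show False using not_between_gap[of j k v] jk that V S(1) R(1) by blast
    qed
    then show ?thesis by blast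
  qed
  have prod: "block_weight x y (\<sigma> \<union> \<rho>) = block_weight x y \<sigma> * (\<Prod>V\<in>\<rho>. if \<exists>W\<in>\<sigma> \<union> \<rho>. nested W V then y else x)"
    unfolding block_weight_def prod.union_disjoint[OF f disj] using up by simp
  show "block_weight x y (\<sigma> \<union> \<rho>) = block_weight x y \<sigma> * block_weight y y \<rho>"
    if "\<exists>C\<in>\<sigma>. C \<inter> A \<noteq> {} \<and> C \<inter> B \<noteq> {}"
  proof -
    from that obtain C c c' where "C \<in> \<sigma>" "c \<in> C" "c \<in> A" "c' \<in> C" "c' \<in> B" by blast
    then have "\<exists>W\<in>\<sigma> \<union> \<rho>. nested W V" if "V \<in> \<rho>" for V
      using order R(1) that unfolding nested_def by blast
    then show ?thesis unfolding prod by (simp add: block_weight_def)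
  qed
  show "block_weight x y (\<sigma> \<union> \<rho>) = block_weight x y \<sigma> * block_weight x y \<rho>" if "A = {}"
  proof -
    have "\<not> nested W V" if V: "V \<in> \<rho>" and W: "W \<in> \<sigma>" for V W
    proof
      assume "nested W V"
      then obtain j where j: "j \<in> W" "\<And>v. v \<in> V \<Longrightarrow> j < v" unfolding nested_def by blast
      obtain v where v: "v \<in> V" using R(2) V by (metis ex_in_conv)
      have "j \<in> B" "v \<in> G" using W V S(1) R(1) j v \<open>A = {}\<close> by auto
      then show False using order(2) j(2)[OF v] by fastforce
    qed
    then have "(\<exists>W\<in>\<sigma> \<union> \<rho>. nested W V) \<longleftrightarrow> (\<exists>W\<in>\<rho>. nested W V)" if "V \<in> \<rho>" for V using that by blast
    then show ?thesis unfolding prod by (simp add: block_weight_def)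
  qed
qed

end

text \<open>Interval blocks of \<open>\<rho>\<close> are interval blocks of the union, so
  \<open>\<rho>\<close> can be removed first. A removed block multiplies the next argument inside
  the gap, or the one at \<open>Min B\<close> if nothing of the gap lies above it; there the value
  of \<open>\<rho>\<close> is collected.\<close>

lemma eval_partition_gap:
  fixes \<iota> :: "'b::star_algebra_1 \<Rightarrow> 'a::star_algebra_1" and A G B :: "nat set"
  assumes fin: "finite A" "finite G" "finite B"
    and order: "\<And>a g. a \<in> A \<Longrightarrow> g \<in> G \<Longrightarrow> a < g" "\<And>g b. g \<in> G \<Longrightarrow> b \<in> B \<Longrightarrow> g < b"
      "\<And>a b. a \<in> A \<Longrightarrow> b \<in> B \<Longrightarrow> a < b"
    and \<iota>: "star_hom \<iota>" and \<Lambda>: "quasi_multilinear \<iota> \<Lambda>"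
    and \<sigma>: "\<sigma> \<in> NC (A \<union> B)" and \<rho>: "\<rho> \<in> NC G" and B: "B \<noteq> {}"
  shows "eval_partition \<iota> \<Lambda> (\<sigma> \<union> \<rho>) a =
    eval_partition \<iota> \<Lambda> \<sigma> (a(Min B := \<iota> (eval_partition \<iota> \<Lambda> \<rho> a) * a (Min B)))"
  using \<rho> fin(2) order(1,2)
proof (induction "card \<rho>" arbitrary: \<rho> G a rule: less_induct)
  case less
  note S = NC_D[OF \<sigma>] and R = NC_D[OF less.prems(1)]
  note \<iota>_simps = \<iota>_simps[OF \<iota> \<Lambda>]
  have mB: "Min B \<in> B" "\<And>b. b \<in> B \<Longrightarrow> Min B \<le> b" using fin(3) B by auto
  have disj: "(A \<union> B) \<inter> G = {}" using less.prems(3,4) by fastforce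
  have un: "\<Union>(\<sigma> \<union> \<rho>) = A \<union> B \<union> G" using S(1) R(1) by simp
  have NCu: "\<sigma> \<union> \<rho> \<in> NC (A \<union> B \<union> G)" and fu: "finite (A \<union> B \<union> G)"
    using NC_gap_union[OF fin(1) less.prems(2) fin(3) less.prems(3,4) order(3) \<sigma> less.prems(1)] fin less.prems(2)
    by auto
  show ?case
  proof (cases "\<rho> = {}")
    case True
    then show ?thesis by (simp add: eval_partition_empty \<iota>_simps)
  next
    case False
    have iv: "interval_block (\<sigma> \<union> \<rho>) V" if "interval_block \<rho> V" for V
    proof -
      have V: "V \<in> \<rho>" "V \<subseteq> G" using that R(1) by (auto simp: interval_block_def)
      have "j \<in> V" if "i \<in> V" "k \<in> V" "j \<in> A \<union> B \<union> G" "i < j" "j < k" for i j k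
      proof -
        have "j \<in> G" using that V(2) less.prems(3,4) by (metis UnE in_mono order.asym)
        then show ?thesis using \<open>interval_block \<rho> V\<close> that R(1) unfolding interval_block_def by blast
      qed
      then show ?thesis unfolding interval_block_def un using V by blast
    qed
    have rem: "(\<sigma> \<union> \<rho>) - {V} = \<sigma> \<union> (\<rho> - {V})" if V: "V \<in> \<rho>" for V
    proof -
      have "V \<noteq> {}" "V \<subseteq> G" using R(1,2) V by auto
      moreover have "V \<subseteq> A \<union> B" if "V \<in> \<sigma>" using S(1) that by auto
      ultimately have "V \<notin> \<sigma>" using disj by blast
      then show ?thesis by auto
    qed
    have above: "above_block (\<sigma> \<union> \<rho>) V = above_block \<rho> V \<union> B" if V: "V \<in> \<rho>" for V
    proof -
      have VG: "V \<subseteq> G" "V \<noteq> {}" using V R(1,2) by auto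
      have "s \<notin> A" if "\<forall>v\<in>V. v < s" for s
        using that VG less.prems(3) by (metis all_not_in_conv in_mono order.asym)
      moreover have "\<forall>v\<in>V. v < s" if "s \<in> B" for s using that VG less.prems(4) by blast
      ultimately show ?thesis unfolding above_block_def un R(1) by blast
    qed
    from less.prems(1,2) False show ?thesis
    proof (cases rule: NC_cases[where \<iota> = \<iota>])
      case (1 V n)
      have nG: "n \<in> G" using 1(10) by blast
      have fa: "finite (above_block \<rho> V)"
        using less.prems(2) R(1) by (auto simp: above_block_def intro: finite_subset[of _ G])
      then have na: "n \<in> above_block \<rho> V" "\<And>s. s \<in> above_block \<rho> V \<Longrightarrow> n \<le> s"
        unfolding 1(9) using 1(8) by (auto intro: Min_in)
      have "Min (above_block (\<sigma> \<union> \<rho>) V) = n"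
        unfolding above[OF 1(1)]
        by (intro Min_eqI) (use na fa fin(3) less.prems(4)[OF nG] in \<open>auto intro: less_imp_le\<close>)
      moreover have "above_block (\<sigma> \<union> \<rho>) V \<noteq> {}" using above[OF 1(1)] B by blast
      ultimately have "eval_partition \<iota> \<Lambda> (\<sigma> \<union> \<rho>) a =
          eval_partition \<iota> \<Lambda> (\<sigma> \<union> (\<rho> - {V})) (a(n := \<iota> (arg_block \<Lambda> a V) * a n))"
        unfolding eval_partition_interval[OF \<iota> \<Lambda> NCu fu iv[OF 1(2)]] remove_block_def rem[OF 1(1)] by simp
      also have "\<dots> = eval_partition \<iota> \<Lambda> \<sigma> ((a(n := \<iota> (arg_block \<Lambda> a V) * a n))(Min B := \<iota> (eval_partition \<iota> \<Lambda> \<rho> a) * a (Min B)))"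
      proof -
        have "Min B \<noteq> n" using less.prems(4)[OF nG mB(1)] by simp
        then show ?thesis using less.hyps[OF 1(7,6), of "a(n := \<iota> (arg_block \<Lambda> a V) * a n)"] less.prems by (simp add: 1(13))
      qed
      also have "\<dots> = eval_partition \<iota> \<Lambda> \<sigma> (a(Min B := \<iota> (eval_partition \<iota> \<Lambda> \<rho> a) * a (Min B)))"
        by (rule eval_NC_cong[OF \<sigma>]) (use fin nG disj in auto)
      finally show ?thesis .
    next
      case (2 V)
      define u where "u = arg_block \<Lambda> a V"
      have "above_block \<rho> V = {}"
      proof -
        have "False" if s: "s \<in> G" "\<forall>v\<in>V. v < s" for s
        proof -
          obtain v where v: "v \<in> V" using 2(3) by blast
          then have "s \<notin> V" using s(2) by blast
          then show False using 2(8)[of s v] s v by (auto dest: order.asym)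
        qed
        then show ?thesis unfolding above_block_def R(1) by blast
      qed
      then have "eval_partition \<iota> \<Lambda> (\<sigma> \<union> \<rho>) a =
          eval_partition \<iota> \<Lambda> (\<sigma> \<union> (\<rho> - {V})) (a(Min B := \<iota> u * a (Min B)))"
        unfolding eval_partition_interval[OF \<iota> \<Lambda> NCu fu iv[OF 2(2)]] remove_block_def rem[OF 2(1)] above[OF 2(1)] u_def
        using B by simp
      also have "\<dots> = eval_partition \<iota> \<Lambda> \<sigma> (a(Min B := \<iota> (eval_partition \<iota> \<Lambda> (\<rho> - {V}) (a(Min B := \<iota> u * a (Min B)))) * (\<iota> u * a (Min B))))"
        using less.hyps[OF 2(7,6)] less.prems by simp
      \<comment> \<open>\<open>Min B\<close> is outside the gap, so the remaining blocks of
        \<open>\<rho>\<close> do not see the changed argument.\<close>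
      also have "eval_partition \<iota> \<Lambda> (\<rho> - {V}) (a(Min B := \<iota> u * a (Min B))) = eval_partition \<iota> \<Lambda> (\<rho> - {V}) a"
        by (rule eval_NC_cong[OF 2(6)]) (use less.prems(2) mB(1) disj in auto)
      finally show ?thesis unfolding 2(9) by (simp only: u_def \<iota>_simps mult.assoc fun_upd_upd)
    qed
  qed
qed

section \<open>Weighted moment sums, decomposed along one block\<close>

definition moment_sum ::
    "('b \<Rightarrow> 'a) \<Rightarrow> ('a::star_algebra_1 list \<Rightarrow> 'b::cstar_algebra_1) \<Rightarrow> real \<Rightarrow> real \<Rightarrow> nat set \<Rightarrow> (nat \<Rightarrow> 'a) \<Rightarrow> 'b" where
  "moment_sum \<iota> K x y S a = (\<Sum>\<pi>\<in>NC S. block_weight x y \<pi> *\<^sub>R eval_partition \<iota> K \<pi> a)"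

definition nc_moment ::
    "('b \<Rightarrow> 'a) \<Rightarrow> ('a::star_algebra_1 list \<Rightarrow> 'b::cstar_algebra_1) \<Rightarrow> real \<Rightarrow> real \<Rightarrow> 'a list \<Rightarrow> 'b" where
  "nc_moment \<iota> K x y as = moment_sum \<iota> K x y {1..length as} (\<lambda>i. as ! (i - 1))"

lemma NC_containing_all:
  assumes "finite P" "P \<noteq> {}"
  shows "{\<pi>\<in>NC P. \<exists>V\<in>\<pi>. P \<subseteq> V} = {{P}}"
proof -
  have "\<pi> = {P}" if \<pi>: "\<pi> \<in> NC P" and V: "V \<in> \<pi>" "P \<subseteq> V" for \<pi> V
  proof -
    note D = NC_D[OF \<pi>]
    have VP: "V = P" using NC_finite(3)[OF \<pi> assms(1) V(1)] V(2) by blast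
    have "W = P" if W: "W \<in> \<pi>" for W
    proof (rule ccontr)
      assume "W \<noteq> P"
      then have "W \<inter> P = {}" using D(3)[OF W V(1)] VP by simp
      then show False using NC_finite(3)[OF \<pi> assms(1) W] D(2) W by (metis inf.absorb1)
    qed
    then show ?thesis using V VP by blast
  qed
  moreover have "{P} \<in> NC P" by (rule NC_top[OF assms(2)])
  ultimately show ?thesis by blast
qed

lemma block_weight_single: "block_weight x y {P} = x"
  by (auto simp: block_weight_def nested_def)

lemma eval_partition_single:
  assumes "star_hom \<iota>" "quasi_multilinear \<iota> K" "finite P" "P \<noteq> {}"
  shows "eval_partition \<iota> K {P} a = K (map a (sorted_list_of_set P))"
proof -
  have "above_block {P} P = {}" by (auto simp: above_block_def)
  then show ?thesis
    using eval_partition_interval[OF assms(1,2) NC_top[OF assms(4)] assms(3), of P a]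
    by (simp add: interval_block_def remove_block_def arg_block_def eval_partition_empty)
qed

text \<open>A block that meets \<open>G\<close> without being contained in it would have a point
  before \<open>Min R\<close> and another strictly between \<open>Min R\<close> and
  \<open>Max R\<close>, hence would cross \<open>V\<close>. So a block that closes the gap
  automatically separates the partition of the gap from the rest.\<close>

lemma first_element_cases:
  assumes fin: "finite P" "finite G" "finite R" and R: "R \<noteq> {}"
    and order: "\<And>a g. a \<in> P \<Longrightarrow> g \<in> G \<Longrightarrow> a < g" "\<And>g b. g \<in> G \<Longrightarrow> b \<in> R \<Longrightarrow> g < b"
      "\<And>a b. a \<in> P \<Longrightarrow> b \<in> R \<Longrightarrow> a < b"
  shows "{\<pi> \<in> NC (P \<union> R \<union> G). \<exists>V\<in>\<pi>. insert (Min R) P \<subseteq> V \<and> V \<inter> G = {} \<and> Max R \<in> V} =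
    {\<pi>. \<pi> \<in> NC (P \<union> R \<union> G) \<and> (\<forall>W\<in>\<pi>. W \<subseteq> G \<or> W \<inter> G = {}) \<and>
      (\<exists>V\<in>{W\<in>\<pi>. W \<inter> G = {}}. insert (Min R) P \<subseteq> V \<and> Max R \<in> V)}"
proof -
  have "W \<subseteq> G \<or> W \<inter> G = {}"
    if \<pi>: "\<pi> \<in> NC (P \<union> R \<union> G)" and V: "V \<in> \<pi>" "insert (Min R) P \<subseteq> V" "V \<inter> G = {}" "Max R \<in> V" and W: "W \<in> \<pi>" for \<pi> V W
  proof (rule ccontr)
    assume "\<not> (W \<subseteq> G \<or> W \<inter> G = {})"
    then obtain w w' where w: "w \<in> W" "w \<in> G" "w' \<in> W" "w' \<notin> G" by blast
    note D = NC_D[OF \<pi>]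
    have "W \<noteq> V" using w V(3) by blast
    then have WV: "W \<inter> V = {}" using D(3)[OF W V(1)] by simp
    have "w' \<in> P \<union> R" using NC_finite(3)[OF \<pi> _ W] fin w(3,4) by blast
    moreover have "w' \<notin> P" "w' \<noteq> Min R" "w' \<noteq> Max R" using V(2,4) WV w(3) by auto
    ultimately have w'R: "w' \<in> R" "Min R < w'" "w' < Max R" using fin(3) by (auto simp: le_neq_implies_less)
    have "w < Min R" using order(2)[OF w(2)] fin(3) R by simp
    then have "W = V" using D(4)[OF W V(1), of w "Min R" w' "Max R"] w'R w V(2,4) by blast
    then show False using \<open>W \<noteq> V\<close> by simp
  qed
  then show ?thesis by blast
qed

lemma sorted_list_of_set_Min:
  assumes "finite R" "R \<noteq> {}"
  shows "sorted_list_of_set R = Min R # sorted_list_of_set (R - {Min R :: nat})"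
proof -
  have "{v\<in>R. v < Min R} = {}" "{v\<in>R. Min R < v} = R - {Min R}"
    using assms(1) by (auto simp: less_le intro!: antisym Min_le)
  then show ?thesis using sorted_list_of_set_split[OF assms(1) Min_in[OF assms]] by simp
qed

lemma sorted_list_of_set_snoc:
  assumes "finite G" "\<And>g. g \<in> G \<Longrightarrow> g < (j::nat)"
  shows "sorted_list_of_set (insert j G) = sorted_list_of_set G @ [j]"
  using sorted_list_of_set_append[of G "{j}"] assms by simp

context
  fixes \<iota> :: "'b::cstar_algebra_1 \<Rightarrow> 'a::star_algebra_1" and K
  assumes \<iota>: "star_hom \<iota>" and K: "quasi_multilinear \<iota> K"
begin

text \<open>Lets a sum over the partitions of a gap pass into the selection, where the value of the
  gap stands to the left of an argument.\<close>

lemma selection_linear: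
  "linear (\<lambda>\<beta>. selection \<iota> m (\<lambda>xs. K (P @ (\<iota> \<beta> * c) # xs)) g as)"
proof (rule linearI)
  show "selection \<iota> m (\<lambda>xs. K (P @ (\<iota> (x + y) * c) # xs)) g as =
      selection \<iota> m (\<lambda>xs. K (P @ (\<iota> x * c) # xs)) g as + selection \<iota> m (\<lambda>xs. K (P @ (\<iota> y * c) # xs)) g as" for x y
    by (simp add: \<iota>_simps[OF \<iota> K] distrib_right quasi_D(1)[OF \<iota> K] selection_add)
  show "selection \<iota> m (\<lambda>xs. K (P @ (\<iota> (r *\<^sub>R x) * c) # xs)) g as =
      r *\<^sub>R selection \<iota> m (\<lambda>xs. K (P @ (\<iota> x * c) # xs)) g as" for r x
    by (simp add: scaleR_scaleC \<iota>_simps[OF \<iota> K] mult_scaleC_left quasi_D(2)[OF \<iota> K]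
        selection_hom[of "scaleC z" for z] scaleC_add_right scaleC_zero_right)
qed

text \<open>One step of a scan along \<open>R\<close>. The distinguished block either skips
  \<open>Min R\<close>, which then joins the pending gap \<open>G\<close>, or contains it and closes
  the gap, whose partitions are summed independently. For \<open>P = {}\<close> the gap precedes the
  block and its outer blocks keep the weight \<open>x\<close>; otherwise the block nests them and
  they weigh \<open>y\<close>.\<close>

lemma sum_first_gap:
  assumes fin: "finite P" "finite G" "finite R" and R: "R \<noteq> {}"
    and order: "\<And>a g. a \<in> P \<Longrightarrow> g \<in> G \<Longrightarrow> a < g" "\<And>g b. g \<in> G \<Longrightarrow> b \<in> R \<Longrightarrow> g < b"
      "\<And>a b. a \<in> P \<Longrightarrow> b \<in> R \<Longrightarrow> a < b"
  shows "(\<Sum>\<pi> | \<pi> \<in> NC (P \<union> G \<union> R) \<and> (\<exists>V\<in>\<pi>. P \<subseteq> V \<and> V \<inter> G = {} \<and> Max (P \<union> G \<union> R) \<in> V).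
        block_weight x y \<pi> *\<^sub>R eval_partition \<iota> K \<pi> a) =
      (\<Sum>\<pi> | \<pi> \<in> NC (P \<union> insert (Min R) G \<union> (R - {Min R})) \<and> (\<exists>V\<in>\<pi>. P \<subseteq> V \<and> V \<inter> insert (Min R) G = {} \<and>
          Max (P \<union> insert (Min R) G \<union> (R - {Min R})) \<in> V). block_weight x y \<pi> *\<^sub>R eval_partition \<iota> K \<pi> a) +
      (\<Sum>\<rho>\<in>NC G. block_weight (if P = {} then x else y) y \<rho> *\<^sub>R
        (\<Sum>\<sigma> | \<sigma> \<in> NC (insert (Min R) P \<union> {} \<union> (R - {Min R})) \<and> (\<exists>V\<in>\<sigma>. insert (Min R) P \<subseteq> V \<and> V \<inter> {} = {} \<and>
          Max (insert (Min R) P \<union> {} \<union> (R - {Min R})) \<in> V). block_weight x y \<sigma> *\<^sub>R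
            eval_partition \<iota> K \<sigma> (a(Min R := \<iota> (eval_partition \<iota> K \<rho> a) * a (Min R)))))"
proof -
  define j where "j = Min R"
  define S where "S = P \<union> R \<union> G"
  have j: "j \<in> R" unfolding j_def using fin(3) R by simp
  have S: "P \<union> G \<union> R = S" "P \<union> insert j G \<union> (R - {j}) = S" "insert j P \<union> {} \<union> (R - {j}) = P \<union> R"
    using j by (auto simp: S_def)
  have finS: "finite S" using fin by (simp add: S_def)
  have MR: "Max R \<in> R" using fin(3) R by simp
  have Max: "Max S = Max R" "Max (P \<union> R) = Max R"
    using fin MR order(2,3) by (auto simp: S_def intro!: Max_eqI intro: less_imp_le)
  define Q where "Q \<sigma> \<longleftrightarrow> (\<exists>V\<in>\<sigma>. insert j P \<subseteq> V \<and> Max R \<in> V)" for \<sigma>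
  define f where "f \<pi> = block_weight x y \<pi> *\<^sub>R eval_partition \<iota> K \<pi> a" for \<pi>
  define E where "E = {\<pi>. \<pi> \<in> NC S \<and> (\<exists>V\<in>\<pi>. P \<subseteq> V \<and> V \<inter> G = {} \<and> Max R \<in> V)}"
  define E1 where "E1 = {\<pi>. \<pi> \<in> NC S \<and> (\<exists>V\<in>\<pi>. insert j P \<subseteq> V \<and> V \<inter> G = {} \<and> Max R \<in> V)}"
  define E2 where "E2 = {\<pi>. \<pi> \<in> NC S \<and> (\<exists>V\<in>\<pi>. P \<subseteq> V \<and> V \<inter> insert j G = {} \<and> Max R \<in> V)}"
  have "P \<subseteq> V \<and> V \<inter> G = {} \<and> Max R \<in> V \<longleftrightarrow>
      (P \<subseteq> V \<and> V \<inter> insert j G = {} \<and> Max R \<in> V) \<or> (insert j P \<subseteq> V \<and> V \<inter> G = {} \<and> Max R \<in> V)" for V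
    by auto
  then have "E = E2 \<union> E1"
    unfolding E_def E1_def E2_def by (simp only: bex_disj_distrib conj_disj_distribL Collect_disj_eq)
  moreover have "E2 \<inter> E1 = {}"
  proof -
    have False if "\<pi> \<in> NC S" "V \<in> \<pi>" "W \<in> \<pi>" "Max R \<in> V" "Max R \<in> W" "j \<in> V" "j \<notin> W" for \<pi> V W
      using NC_D(3)[OF that(1-3)] that by blast
    then show ?thesis unfolding E1_def E2_def by blast
  qed
  moreover have "finite E1" "finite E2" using finite_NC[OF finS] by (simp_all add: E1_def E2_def)
  ultimately have "sum f E = sum f E2 + sum f E1" by (simp add: sum.union_disjoint)
  moreover have "sum f E1 = (\<Sum>\<rho>\<in>NC G. block_weight (if P = {} then x else y) y \<rho> *\<^sub>R
        (\<Sum>\<sigma> | \<sigma> \<in> NC (P \<union> R) \<and> Q \<sigma>. block_weight x y \<sigma> *\<^sub>R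
            eval_partition \<iota> K \<sigma> (a(j := \<iota> (eval_partition \<iota> K \<rho> a) * a j))))"
  proof -
    have E1: "E1 = {\<pi>. \<pi> \<in> NC S \<and> (\<forall>W\<in>\<pi>. W \<subseteq> G \<or> W \<inter> G = {}) \<and> Q {W\<in>\<pi>. W \<inter> G = {}}}"
      using first_element_cases[OF fin R order] unfolding E1_def Q_def S_def j_def by simp
    have f: "f (\<sigma> \<union> \<rho>) = block_weight (if P = {} then x else y) y \<rho> *\<^sub>R (block_weight x y \<sigma> *\<^sub>R
            eval_partition \<iota> K \<sigma> (a(j := \<iota> (eval_partition \<iota> K \<rho> a) * a j)))"
      if \<sigma>: "\<sigma> \<in> NC (P \<union> R)" "Q \<sigma>" and \<rho>: "\<rho> \<in> NC G" for \<sigma> \<rho>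
    proof -
      have "block_weight x y (\<sigma> \<union> \<rho>) = block_weight x y \<sigma> * block_weight (if P = {} then x else y) y \<rho>"
      proof (cases "P = {}")
        case True
        then show ?thesis using block_weight_gap(2)[OF fin order \<sigma>(1) \<rho>] by simp
      next
        case False
        then obtain p where "p \<in> P" by blast
        then have "\<exists>C\<in>\<sigma>. C \<inter> P \<noteq> {} \<and> C \<inter> R \<noteq> {}" using \<sigma>(2) MR unfolding Q_def by blast
        then show ?thesis using block_weight_gap(1)[OF fin order \<sigma>(1) \<rho>] False by simp
      qed
      then show ?thesis
        using eval_partition_gap[OF fin order \<iota> K \<sigma>(1) \<rho> R, of a]
        unfolding f_def j_def by (simp add: mult.commute del: fun_upd_apply)
    qed
    have "sum f E1 = (\<Sum>\<rho>\<in>NC G. \<Sum>\<sigma> | \<sigma> \<in> NC (P \<union> R) \<and> Q \<sigma>. f (\<sigma> \<union> \<rho>))"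
      unfolding E1 S_def by (rule sum_NC_gap[OF fin order])
    also have "\<dots> = (\<Sum>\<rho>\<in>NC G. \<Sum>\<sigma> | \<sigma> \<in> NC (P \<union> R) \<and> Q \<sigma>. block_weight (if P = {} then x else y) y \<rho> *\<^sub>R (block_weight x y \<sigma> *\<^sub>R
            eval_partition \<iota> K \<sigma> (a(j := \<iota> (eval_partition \<iota> K \<rho> a) * a j))))"
      by (intro sum.cong refl f) auto
    finally show ?thesis unfolding scaleR_sum_right .
  qed
  ultimately show ?thesis
    unfolding j_def[symmetric] S Max E_def E2_def f_def Q_def Int_empty_right simp_thms
    by (simp only:)
qed

text \<open>The scan mirrors the recursion of \<open>selection\<close>, with \<open>P\<close> the
  part selected so far and \<open>G\<close> the pending gap. The distinguished block contains the
  least point, hence is outer and gives the factor \<open>x\<close>. The bound \<open>n\<close>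
  allows a use inside an induction on the size, where the sums over gaps are known for smaller sets
  only.\<close>

lemma sum_block_containing:
  assumes m: "\<And>G a. finite G \<Longrightarrow> card G < n \<Longrightarrow> moment_sum \<iota> K y y G a = m (map a (sorted_list_of_set G))"
    and fin: "finite P" "finite G" "finite R" and P: "P \<noteq> {}"
    and order: "\<And>a g. a \<in> P \<Longrightarrow> g \<in> G \<Longrightarrow> a < g" "\<And>g b. g \<in> G \<Longrightarrow> b \<in> R \<Longrightarrow> g < b"
      "\<And>a b. a \<in> P \<Longrightarrow> b \<in> R \<Longrightarrow> a < b"
    and n: "card (P \<union> G \<union> R) \<le> n"
  shows "(\<Sum>\<pi> | \<pi> \<in> NC (P \<union> G \<union> R) \<and> (\<exists>V\<in>\<pi>. P \<subseteq> V \<and> V \<inter> G = {} \<and> Max (P \<union> G \<union> R) \<in> V).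
        block_weight x y \<pi> *\<^sub>R eval_partition \<iota> K \<pi> a) =
    x *\<^sub>R selection \<iota> m (\<lambda>xs. K (map a (sorted_list_of_set P) @ xs))
      (map a (sorted_list_of_set G)) (map a (sorted_list_of_set R))"
  using fin P order n
proof (induction "card R" arbitrary: P G R a rule: less_induct)
  case less
  note fin = less.prems(1-3) and order = less.prems(5-7)
  show ?case
  proof (cases "R = {}")
    case True
    show ?thesis
    proof (cases "G = {}")
      case G: True
      have "{\<pi>. \<pi> \<in> NC P \<and> (\<exists>V\<in>\<pi>. P \<subseteq> V \<and> Max P \<in> V)} = {{P}}"
      proof -
        have "P \<subseteq> V \<and> Max P \<in> V \<longleftrightarrow> P \<subseteq> V" for V using Max_in[OF fin(1) less.prems(4)] by blast
        then show ?thesis using NC_containing_all[OF fin(1) less.prems(4)] by simp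
      qed
      then show ?thesis using less.prems(4) fin
        by (simp add: True G block_weight_single eval_partition_single[OF \<iota> K])
    next
      case G: False
      \<comment> \<open>A pending gap at the end contains the maximum, which the block should
        contain: the sum is empty, just as a selection that ends in a gap is 0.\<close>
      then have "Max (P \<union> G) \<in> G"
        using fin order(1) by (metis G Max_in Max_ge UnE UnI1 UnI2 Un_empty finite_UnI leD order.strict_trans1)
      then have e: "{\<pi>. \<pi> \<in> NC (P \<union> G) \<and> (\<exists>V\<in>\<pi>. P \<subseteq> V \<and> V \<inter> G = {} \<and> Max (P \<union> G) \<in> V)} = {}" by blast
      show ?thesis using G fin by (simp add: True e)
    qed
  next
    case False
    define j where "j = Min R"
    define R' where "R' = R - {j}"
    have j: "j \<in> R" unfolding j_def using fin(3) False by simp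
    have jR: "j < r" if "r \<in> R'" for r using that fin(3) unfolding R'_def j_def by (auto simp: less_le)
    have card: "card R' < card R" unfolding R'_def using fin(3) j by (simp add: card_Diff1_less del: card_Diff_insert)
    have fin': "finite R'" "finite (insert j P)" "finite (insert j G)" using fin by (auto simp: R'_def)
    have R: "map a (sorted_list_of_set R) = a j # map a (sorted_list_of_set R')"
      unfolding R'_def j_def by (subst sorted_list_of_set_Min[OF fin(3) False]) simp
    have sP: "sorted_list_of_set (insert j P) = sorted_list_of_set P @ [j]"
      by (rule sorted_list_of_set_snoc) (use fin order(3) j in auto)
    have sG: "sorted_list_of_set (insert j G) = sorted_list_of_set G @ [j]"
      by (rule sorted_list_of_set_snoc) (use fin order(2) j in auto)
    have R'R: "r \<in> R" if "r \<in> R'" for r using that by (simp add: R'_def)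
    have un: "P \<union> insert j G \<union> R' = P \<union> G \<union> R" "insert j P \<union> {} \<union> R' = P \<union> R" using j by (auto simp: R'_def)
    define f where "f \<beta> = selection \<iota> m (\<lambda>xs. K (map a (sorted_list_of_set P) @ (\<iota> \<beta> * a j) # xs)) [] (map a (sorted_list_of_set R'))" for \<beta>
    have lin: "linear f" unfolding f_def by (rule selection_linear)
    have card2: "card (insert j P \<union> {} \<union> R') \<le> n"
    proof -
      have "card (P \<union> R) \<le> card (P \<union> G \<union> R)" using fin by (intro card_mono) auto
      then show ?thesis unfolding un using less.prems(8) by simp
    qed
    have IH1: "(\<Sum>\<pi> | \<pi> \<in> NC (P \<union> insert j G \<union> R') \<and> (\<exists>V\<in>\<pi>. P \<subseteq> V \<and> V \<inter> insert j G = {} \<and>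
          Max (P \<union> insert j G \<union> R') \<in> V). block_weight x y \<pi> *\<^sub>R eval_partition \<iota> K \<pi> a) =
       x *\<^sub>R selection \<iota> m (\<lambda>xs. K (map a (sorted_list_of_set P) @ xs)) (map a (sorted_list_of_set G) @ [a j]) (map a (sorted_list_of_set R'))"
    proof (rule trans[OF less.hyps[OF card fin(1) fin'(3,1) less.prems(4)]])
      show "card (P \<union> insert j G \<union> R') \<le> n" unfolding un by (rule less.prems(8))
    qed (use order jR j in \<open>auto simp: sG R'_def\<close>)
    have IH2: "(\<Sum>\<sigma> | \<sigma> \<in> NC (insert j P \<union> {} \<union> R') \<and> (\<exists>V\<in>\<sigma>. insert j P \<subseteq> V \<and> V \<inter> {} = {} \<and>
          Max (insert j P \<union> {} \<union> R') \<in> V). block_weight x y \<sigma> *\<^sub>R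
            eval_partition \<iota> K \<sigma> (a(j := \<iota> e * a j))) = x *\<^sub>R f e" for e
    proof -
      have eq: "map (a(j := c)) (sorted_list_of_set P) = map a (sorted_list_of_set P)"
        "map (a(j := c)) (sorted_list_of_set R') = map a (sorted_list_of_set R')" for c
        using order(3)[OF _ j] fin fin' by (auto simp: R'_def)
      show ?thesis
        by (subst less.hyps[OF card fin'(2) finite.emptyI fin'(1) insert_not_empty])
          (use order(3) jR card2 R'R in \<open>auto simp: sP eq f_def\<close>)
    qed
    have cG: "card G < n"
    proof -
      have "G \<subset> P \<union> G \<union> R" using j order(2) by force
      then have "card G < card (P \<union> G \<union> R)" using fin by (intro psubset_card_mono) auto
      then show ?thesis using less.prems(8) by simp
    qed
    \<comment> \<open>Linearity collects the partitions of the closed gap into a single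
      coefficient.\<close>
    have "(\<Sum>\<rho>\<in>NC G. block_weight y y \<rho> *\<^sub>R (x *\<^sub>R f (eval_partition \<iota> K \<rho> a))) = x *\<^sub>R f (moment_sum \<iota> K y y G a)"
      unfolding moment_sum_def linear_sum[OF lin] linear_scale[OF lin] by (simp add: scaleR_sum_right mult.commute)
    also have "moment_sum \<iota> K y y G a = m (map a (sorted_list_of_set G))" by (rule m[OF fin(2) cG])
    finally show ?thesis
      using sum_first_gap[OF fin False order, of x y a] less.prems(4)
      unfolding j_def[symmetric] R'_def[symmetric] IH1 IH2 R
      by (simp add: f_def scaleR_add_right add.commute)
  qed
qed

text \<open>The same scan before the block has started. The points below its first one form a prefix
  that is partitioned freely, with outer weight \<open>x\<close> again; from its first point on the
  block contributes an irreducible part. It contains the maximum, hence is outer.\<close>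

lemma sum_last_block:
  assumes m: "\<And>G a. finite G \<Longrightarrow> card G < n \<Longrightarrow> moment_sum \<iota> K y y G a = m (map a (sorted_list_of_set G))"
    and M: "\<And>G a. finite G \<Longrightarrow> card G < n \<Longrightarrow> moment_sum \<iota> K x y G a = M (map a (sorted_list_of_set G))"
    and fin: "finite G" "finite R" and ne: "G \<union> R \<noteq> {}"
    and order: "\<And>g b. g \<in> G \<Longrightarrow> b \<in> R \<Longrightarrow> g < b"
    and n: "card (G \<union> R) \<le> n"
  shows "(\<Sum>\<pi> | \<pi> \<in> NC (G \<union> R) \<and> (\<exists>V\<in>\<pi>. V \<inter> G = {} \<and> Max (G \<union> R) \<in> V).
        block_weight x y \<pi> *\<^sub>R eval_partition \<iota> K \<pi> a) =
    splits (\<lambda>p q. M (map a (sorted_list_of_set G) @ p) * (x *\<^sub>R irreducible_part \<iota> m K q)) (map a (sorted_list_of_set R))"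
  using fin ne order n
proof (induction "card R" arbitrary: G R rule: less_induct)
  case less
  note fin = less.prems(1-2) and order = less.prems(4)
  show ?case
  proof (cases "R = {}")
    case True
    then have "Max G \<in> G" using less.prems by simp
    then have e: "{\<pi>. \<pi> \<in> NC G \<and> (\<exists>V\<in>\<pi>. V \<inter> G = {} \<and> Max G \<in> V)} = {}" by blast
    show ?thesis by (simp add: True e)
  next
    case False
    define j where "j = Min R"
    define R' where "R' = R - {j}"
    have j: "j \<in> R" unfolding j_def using fin False by simp
    have jR: "j < r" if "r \<in> R'" for r using that fin unfolding R'_def j_def by (auto simp: less_le)
    have card: "card R' < card R" unfolding R'_def using fin j by (simp add: card_Diff1_less del: card_Diff_insert)
    have fin': "finite R'" "finite (insert j G)" using fin by (auto simp: R'_def)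
    have R: "map a (sorted_list_of_set R) = a j # map a (sorted_list_of_set R')"
      unfolding R'_def j_def by (subst sorted_list_of_set_Min[OF fin(2) False]) simp
    have sG: "sorted_list_of_set (insert j G) = sorted_list_of_set G @ [j]"
      by (rule sorted_list_of_set_snoc) (use fin order j in auto)
    have un: "insert j G \<union> R' = G \<union> R" using j by (auto simp: R'_def)
    define I where "I = irreducible_part \<iota> m K (map a (sorted_list_of_set R))"
    have IH: "(\<Sum>\<pi> | \<pi> \<in> NC ({} \<union> insert j G \<union> R') \<and> (\<exists>V\<in>\<pi>. {} \<subseteq> V \<and> V \<inter> insert j G = {} \<and>
          Max ({} \<union> insert j G \<union> R') \<in> V). block_weight x y \<pi> *\<^sub>R eval_partition \<iota> K \<pi> a) =
       splits (\<lambda>p q. M ((map a (sorted_list_of_set G) @ [a j]) @ p) * (x *\<^sub>R irreducible_part \<iota> m K q)) (map a (sorted_list_of_set R'))"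
      unfolding Un_empty_left
    proof (simp only: empty_subsetI simp_thms, rule trans[OF less.hyps[OF card fin'(2,1)]])
      show "card (insert j G \<union> R') \<le> n" unfolding un by (rule less.prems(5))
    qed (use order jR j in \<open>auto simp: sG R'_def\<close>)
    have T: "(\<Sum>\<sigma> | \<sigma> \<in> NC (insert j {} \<union> {} \<union> R') \<and> (\<exists>V\<in>\<sigma>. insert j {} \<subseteq> V \<and> V \<inter> {} = {} \<and>
          Max (insert j {} \<union> {} \<union> R') \<in> V). block_weight x y \<sigma> *\<^sub>R
            eval_partition \<iota> K \<sigma> (a(j := \<iota> e * a j))) = x *\<^sub>R (e * I)" for e
    proof -
      have eq: "map (a(j := c)) (sorted_list_of_set R') = map a (sorted_list_of_set R')" for c
        using fin' by (auto simp: R'_def)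
      have "insert j R' = R" using j by (auto simp: R'_def)
      moreover have "card R \<le> card (G \<union> R)" using fin by (intro card_mono) auto
      ultimately have c: "card (insert j {} \<union> {} \<union> R') \<le> n" using less.prems(5) by simp
      show ?thesis
        by (subst sum_block_containing[OF m _ _ fin'(1) insert_not_empty _ _ _ c])
          (use jR in \<open>auto simp: eq I_def R quasi_D(3)[OF \<iota> K] selection_hom[of "\<lambda>x. e * x"] distrib_left\<close>)
    qed
    have cG: "card G < n"
    proof -
      have "G \<subset> G \<union> R" using j order by force
      then have "card G < card (G \<union> R)" using fin by (intro psubset_card_mono) auto
      then show ?thesis using less.prems(5) by simp
    qed
    have "(\<Sum>\<rho>\<in>NC G. block_weight x y \<rho> *\<^sub>R (x *\<^sub>R (eval_partition \<iota> K \<rho> a * I))) = moment_sum \<iota> K x y G a * (x *\<^sub>R I)"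
      unfolding moment_sum_def by (simp add: sum_distrib_right scaleR_sum_right mult.commute)
    also have "moment_sum \<iota> K x y G a = M (map a (sorted_list_of_set G))" by (rule M[OF fin(1) cG])
    finally show ?thesis
      using sum_first_gap[of "{}" G R x y a, OF finite.emptyI fin False _ order]
      unfolding j_def[symmetric] R'_def[symmetric] IH T by (simp add: R I_def add.commute)
  qed
qed

text \<open>Sorting the partitions by the block of the last argument gives M = 1 + M * x I: the
  prefix before that block yields M, and the gaps inside it have weight \<open>y\<close> on all
  their blocks.\<close>

lemma nc_moment_renewal:
  "renewal A (nc_moment \<iota> K x y) (\<lambda>as. x *\<^sub>R irreducible_part \<iota> (nc_moment \<iota> K y y) K as)"
proof -
  define R where "R x as = (if as = [] then 1 else 0) +
    splits (\<lambda>p q. nc_moment \<iota> K x y p * (x *\<^sub>R irreducible_part \<iota> (nc_moment \<iota> K y y) K q)) as" for x as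
  have step: "moment_sum \<iota> K x y S a = R x (map a (sorted_list_of_set S))"
    if lower: "\<And>x G a. finite G \<Longrightarrow> card G < card S \<Longrightarrow> moment_sum \<iota> K x y G a = nc_moment \<iota> K x y (map a (sorted_list_of_set G))"
      and S: "finite S" for S a x
  proof (cases "S = {}")
    case True
    then show ?thesis by (simp add: moment_sum_def R_def NC_empty block_weight_def eval_partition_empty)
  next
    case False
    have "Max S \<in> \<Union>\<pi>" if "\<pi> \<in> NC S" for \<pi> using NC_D(1)[OF that] S False by simp
    then have "{\<pi>. \<pi> \<in> NC ({} \<union> S) \<and> (\<exists>V\<in>\<pi>. V \<inter> {} = {} \<and> Max ({} \<union> S) \<in> V)} = NC S" by auto
    moreover have "sorted_list_of_set S \<noteq> []" using False S by simp
    ultimately show ?thesis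
      using sum_last_block[OF lower lower finite.emptyI S, where x = x and a = a] False
      by (simp add: R_def moment_sum_def)
  qed
  \<comment> \<open>Gaps are arbitrary sets of positions, whereas \<open>nc_moment\<close> uses an
    initial segment. No relabelling is done: by induction on the size both sums equal
    \<open>R\<close>, which sees only the list of arguments.\<close>
  have main: "moment_sum \<iota> K x y S a = nc_moment \<iota> K x y (map a (sorted_list_of_set S)) \<and>
      moment_sum \<iota> K x y S a = R x (map a (sorted_list_of_set S))" if "finite S" for S a x
    using that
  proof (induction "card S" arbitrary: S a x rule: less_induct)
    case less
    define as where "as = map a (sorted_list_of_set S)"
    have len: "length as = card S" by (simp add: as_def)
    have "map (\<lambda>i. as ! (i - 1)) [1..<Suc (length as)] = as"
      by (rule nth_equalityI) (auto simp del: upt_Suc)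
    moreover have "sorted_list_of_set {1..length as} = [1..<Suc (length as)]"
      by (metis atLeastLessThanSuc_atLeastAtMost sorted_list_of_set_range)
    ultimately have "nc_moment \<iota> K x y as = R x as"
      unfolding nc_moment_def using step[of "{1..length as}" x "\<lambda>i. as ! (i - 1)"] less.hyps len by simp
    then show ?case using step[of S x a] less unfolding as_def by simp
  qed
  have eq: "nc_moment \<iota> K x y as = R x as" for as
  proof -
    have "map (\<lambda>i. as ! (i - 1)) [1..<Suc (length as)] = as"
      by (rule nth_equalityI) (auto simp del: upt_Suc)
    moreover have "sorted_list_of_set {1..length as} = [1..<Suc (length as)]"
      by (metis atLeastLessThanSuc_atLeastAtMost sorted_list_of_set_range)
    ultimately show ?thesis using main[of "{1..length as}" x "\<lambda>i. as ! (i - 1)"] by (simp add: nc_moment_def)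
  qed
  show "renewal A (nc_moment \<iota> K x y) (\<lambda>as. x *\<^sub>R irreducible_part \<iota> (nc_moment \<iota> K y y) K as)"
    unfolding renewal_def
  proof (intro conjI ballI)
    show "x *\<^sub>R irreducible_part \<iota> (nc_moment \<iota> K y y) K [] = 0" by simp
  qed (rule eq[unfolded R_def])
qed

end

section \<open>Bimodule maps with prescribed moments\<close>

text \<open>A family of multilinear forms \<open>\<phi>\<close> stands for the linear functional on \<open>\<B>\<langle>X\<rangle>\<close> whose value at
  \<open>b\<^sub>0 X b\<^sub>1 \<cdots> X b\<^sub>l\<close> is \<open>\<phi> [b\<^sub>l, \<dots>, b\<^sub>0]\<close>; \<open>nc_act p False \<phi>\<close> is the functional \<open>q \<mapsto> \<phi>(q p)\<close>
  and \<open>nc_act p True \<phi>\<close> is \<open>q \<mapsto> \<phi>(q p\<^sup>*)\<close>.\<close>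

primrec nc_act :: "'b::star_algebra_1 ncterm \<Rightarrow> bool \<Rightarrow> ('b list \<Rightarrow> 'b) \<Rightarrow> 'b list \<Rightarrow> 'b" where
  "nc_act (TConst b) s \<phi> = (\<lambda>bs. case bs of [] \<Rightarrow> 0 | c # cs \<Rightarrow> \<phi> (c * (if s then star b else b) # cs))"
| "nc_act TVar s \<phi> = (\<lambda>bs. if bs = [] then 0 else \<phi> (1 # bs))"
| "nc_act (TPlus p q) s \<phi> = (\<lambda>bs. nc_act p s \<phi> bs + nc_act q s \<phi> bs)"
| "nc_act (TTimes p q) s \<phi> = (if s then nc_act q s (nc_act p s \<phi>) else nc_act p s (nc_act q s \<phi>))"
| "nc_act (TScale z p) s \<phi> = (\<lambda>bs. scaleC (if s then cnj z else z) (nc_act p s \<phi> bs))"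
| "nc_act (TStar p) s \<phi> = nc_act p (\<not> s) \<phi>"

text \<open>Words without X correspond to lists of length one, so the empty list encodes no word and
  gets a default value.\<close>

definition multilinear_family :: "('b::star_algebra_1 list \<Rightarrow> 'b) \<Rightarrow> bool" where
  "multilinear_family \<phi> \<longleftrightarrow> \<phi> [] = 0 \<and>
     (\<forall>xs x y ys. \<phi> (xs @ (x + y) # ys) = \<phi> (xs @ x # ys) + \<phi> (xs @ y # ys)) \<and>
     (\<forall>xs z x ys. \<phi> (xs @ scaleC z x # ys) = scaleC z (\<phi> (xs @ x # ys)))"

lemma multilinear_familyD:
  assumes "multilinear_family \<phi>"
  shows "\<phi> [] = 0" "\<phi> (xs @ (x + y) # ys) = \<phi> (xs @ x # ys) + \<phi> (xs @ y # ys)"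
    "\<phi> (xs @ scaleC z x # ys) = scaleC z (\<phi> (xs @ x # ys))"
    "\<phi> ((x + y) # ys) = \<phi> (x # ys) + \<phi> (y # ys)" "\<phi> (scaleC z x # ys) = scaleC z (\<phi> (x # ys))"
    "\<phi> (0 # ys) = 0"
proof -
  show *: "\<phi> [] = 0" "\<phi> (xs @ (x + y) # ys) = \<phi> (xs @ x # ys) + \<phi> (xs @ y # ys)"
    "\<phi> (xs @ scaleC z x # ys) = scaleC z (\<phi> (xs @ x # ys))" for xs x y ys z
    using assms unfolding multilinear_family_def by blast+
  show **: "\<phi> ((x + y) # ys) = \<phi> (x # ys) + \<phi> (y # ys)" "\<phi> (scaleC z x # ys) = scaleC z (\<phi> (x # ys))" for x y
    using *(2)[of "[]" x y ys] *(3)[of "[]" z x ys] by simp_all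
  show "\<phi> (0 # ys) = 0" using **(1)[of 0 0] by simp
qed

lemma multilinear_family_nc_act: "multilinear_family \<phi> \<Longrightarrow> multilinear_family (nc_act p s \<phi>)"
proof (induction p arbitrary: s \<phi>)
  case (TConst b)
  note m = multilinear_familyD[OF TConst]
  have "nc_act (TConst b) s \<phi> (xs @ (x + y) # ys) =
      nc_act (TConst b) s \<phi> (xs @ x # ys) + nc_act (TConst b) s \<phi> (xs @ y # ys)" for xs x y ys
    by (cases xs) (simp_all add: distrib_right m(4) m(2)[of "u # us" for u us, simplified])
  moreover have "nc_act (TConst b) s \<phi> (xs @ scaleC z x # ys) = scaleC z (nc_act (TConst b) s \<phi> (xs @ x # ys))" for xs z x ys
    by (cases xs) (simp_all add: mult_scaleC_left m(5) m(3)[of "u # us" for u us, simplified])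
  ultimately show ?case unfolding multilinear_family_def by simp
next
  case TVar
  note m = multilinear_familyD(2,3)[OF TVar, of "1 # xs" for xs, simplified]
  show ?case unfolding multilinear_family_def by (simp add: m)
qed (auto simp: multilinear_family_def scaleC_add_right scaleC_scaleC scaleC_zero_right mult.commute algebra_simps)

lemma nc_act_add: "nc_act p s (\<lambda>bs. \<phi> bs + \<psi> bs) = (\<lambda>bs. nc_act p s \<phi> bs + nc_act p s \<psi> bs)"
proof (induction p arbitrary: s \<phi> \<psi>)
  case (TConst b)
  show ?case by (rule ext) (simp split: list.split)
next
  case TVar
  show ?case by (rule ext) simp
qed (simp_all add: scaleC_add_right ac_simps)

lemma nc_act_scaleC: "nc_act p s (\<lambda>bs. scaleC z (\<phi> bs)) = (\<lambda>bs. scaleC z (nc_act p s \<phi> bs))"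
proof (induction p arbitrary: s \<phi>)
  case (TConst b)
  show ?case by (rule ext) (simp add: scaleC_zero_right split: list.split)
next
  case TVar
  show ?case by (rule ext) (simp add: scaleC_zero_right)
qed (simp_all add: scaleC_add_right scaleC_scaleC mult.commute)

lemma nc_act_mult_right: "nc_act p s (\<lambda>bs. \<phi> bs * c) = (\<lambda>bs. nc_act p s \<phi> bs * c)"
proof (induction p arbitrary: s \<phi>)
  case (TConst b)
  show ?case by (rule ext) (simp split: list.split)
next
  case TVar
  show ?case by (rule ext) simp
qed (simp_all add: distrib_right mult_scaleC_left)

text \<open>Terms act on a word from the right, and the last list entry is the leftmost coefficient
  of the word. Left linearity in it therefore survives, also for a list with one entry.\<close>

lemma nc_act_mult_left:
  assumes "\<And>bs b. \<phi> (bs @ [c * b]) = c * \<phi> (bs @ [b])"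
  shows "nc_act p s \<phi> (bs @ [c * b]) = c * nc_act p s \<phi> (bs @ [b])"
  using assms
proof (induction p arbitrary: s \<phi> bs b)
  case (TConst a)
  show ?case
    using TConst[of "[]"] TConst[of "u # us" for u us] by (cases bs) (simp_all add: mult.assoc)
next
  case TVar
  show ?case using TVar[of "1 # bs"] by simp
qed (simp_all add: distrib_left mult_scaleC_right)

lemma star_one: "star (1::'a::star_algebra_1) = 1"
  by (metis mult.right_neutral mult_1 star_mult star_star)

text \<open>A map out of the quotient has to be given on terms and to respect every generating rule.
  The rules for constants use multilinearity; \<open>\<phi>\<close> is kept general because a
  product feeds one acted family into the next action.\<close>

lemma nc_act_cong:
  assumes "p \<simeq> q" "multilinear_family \<phi>"
  shows "nc_act p s \<phi> = nc_act q s \<phi>"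
  using assms
proof (induction arbitrary: s \<phi>)
  case (nc_times p p' q q')
  note ml = multilinear_family_nc_act[OF nc_times.prems]
  show ?case by (simp add: nc_times.IH(1)[OF ml] nc_times.IH(2)[OF ml] nc_times.IH(1,2)[OF nc_times.prems])
next
  case (nc_add_zero p)
  note m = multilinear_familyD[OF nc_add_zero] multilinear_familyD[OF multilinear_family_nc_act[OF nc_add_zero]]
  show ?case by (rule ext) (simp add: m star_zero split: list.split)
next
  case (nc_add_inverse p)
  note m = multilinear_familyD[OF nc_add_inverse] multilinear_familyD[OF multilinear_family_nc_act[OF nc_add_inverse]]
  show ?case by (rule ext) (simp add: m star_zero scaleC_minus_one split: list.split)
next
  case (nc_mult_one_left p)
  note m = multilinear_familyD[OF multilinear_family_nc_act[OF nc_mult_one_left]]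
  have "nc_act (TConst 1) s \<psi> = \<psi>" if "\<psi> [] = 0" for s \<psi>
    by (rule ext) (simp add: star_one that split: list.split)
  from this[of \<phi> s] this[of "nc_act p s \<phi>" s] show ?case
    using m(1) multilinear_familyD(1)[OF nc_mult_one_left] by (cases s) (simp_all del: nc_act.simps(1))
next
  case (nc_mult_one_right p)
  note m = multilinear_familyD[OF multilinear_family_nc_act[OF nc_mult_one_right]]
  have "nc_act (TConst 1) s \<psi> = \<psi>" if "\<psi> [] = 0" for s \<psi>
    by (rule ext) (simp add: star_one that split: list.split)
  from this[of \<phi> s] this[of "nc_act p s \<phi>" s] show ?case
    using m(1) multilinear_familyD(1)[OF nc_mult_one_right] by (cases s) (simp_all del: nc_act.simps(1))
next
  case (nc_const_add a b)
  note m = multilinear_familyD[OF nc_const_add]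
  show ?case by (rule ext) (simp add: m star_add distrib_left split: list.split)
next
  case (nc_const_mult a b)
  show ?case by (rule ext) (simp add: star_mult mult.assoc split: list.split)
next
  case (nc_const_scale z a)
  note m = multilinear_familyD[OF nc_const_scale]
  show ?case by (rule ext) (simp add: m star_scaleC mult_scaleC_right scaleC_zero_right split: list.split)
next
  case nc_var_star
  show ?case by simp
qed (simp_all add: fun_eq_iff nc_act_add nc_act_scaleC scaleC_add_right scaleC_add_left scaleC_scaleC
    scaleC_one star_star algebra_simps split: list.split)

definition nc_functional :: "('b::star_algebra_1 list \<Rightarrow> 'b) \<Rightarrow> 'b ncpoly \<Rightarrow> 'b list \<Rightarrow> 'b" where
  "nc_functional \<phi> p = nc_act (rep_ncpoly p) False \<phi>"

lemma nc_functional_simps: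
  fixes \<phi> :: "'b::star_algebra_1 list \<Rightarrow> 'b"
  assumes \<phi>: "multilinear_family \<phi>"
  shows "nc_functional \<phi> (nc_const b) (c # cs) = \<phi> (c * b # cs)"
    "nc_functional \<phi> nc_X (c # cs) = \<phi> (1 # c # cs)"
    "nc_functional \<phi> (p + q) bs = nc_functional \<phi> p bs + nc_functional \<phi> q bs"
    "nc_functional \<phi> (p * q) = nc_functional (nc_functional \<phi> q) p"
    "nc_functional \<phi> (scaleC z p) bs = scaleC z (nc_functional \<phi> p bs)"
    "nc_functional \<phi> 1 (c # cs) = \<phi> (c # cs)"
proof -
  have abs: "nc_functional \<phi> (abs_ncpoly t) = nc_act t False \<phi>" for t
    unfolding nc_functional_def
    by (rule nc_act_cong[OF _ \<phi>]) (metis Quotient3_ncpoly Quotient3_def nc_refl rep_abs_rsp_left nc_sym)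
  have rep: "abs_ncpoly (rep_ncpoly p) = p" for p :: "'b ncpoly"
    by (rule Quotient3_abs_rep[OF Quotient3_ncpoly])
  show "nc_functional \<phi> (nc_const b) (c # cs) = \<phi> (c * b # cs)"
    "nc_functional \<phi> nc_X (c # cs) = \<phi> (1 # c # cs)" "nc_functional \<phi> 1 (c # cs) = \<phi> (c # cs)"
    by (simp_all add: nc_const_def nc_X_def one_ncpoly_def abs)
  show "nc_functional \<phi> (p + q) bs = nc_functional \<phi> p bs + nc_functional \<phi> q bs"
    using abs[of "TPlus (rep_ncpoly p) (rep_ncpoly q)"]
    by (simp add: nc_functional_def[of \<phi> p] nc_functional_def[of \<phi> q] plus_ncpoly.abs_eq[symmetric] rep)
  show "nc_functional \<phi> (p * q) = nc_functional (nc_functional \<phi> q) p"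
    using abs[of "TTimes (rep_ncpoly p) (rep_ncpoly q)"]
    by (simp add: nc_functional_def[of _ p] nc_functional_def[of \<phi> q] times_ncpoly.abs_eq[symmetric] rep)
  show "nc_functional \<phi> (scaleC z p) bs = scaleC z (nc_functional \<phi> p bs)"
    using abs[of "TScale z (rep_ncpoly p)"]
    by (simp add: nc_functional_def[of \<phi> p] scaleC_ncpoly.abs_eq[symmetric] rep)
qed

lemma multilinear_family_nc_functional: "multilinear_family \<phi> \<Longrightarrow> multilinear_family (nc_functional \<phi> p)"
  unfolding nc_functional_def by (rule multilinear_family_nc_act)

lemma quasi_multilinear_moments:
  fixes \<iota> :: "'b::cstar_algebra_1 \<Rightarrow> 'a::star_algebra_1"
  assumes "star_hom \<iota>" "bimodule_map \<iota> E"
  shows "quasi_multilinear \<iota> (\<lambda>as. E (prod_list as))"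
proof -
  note E = bimodule_map_D[OF assms]
  have "E (prod_list (xs @ [x * \<iota> b])) = E (prod_list (xs @ [x])) * b" for xs x b
    using E(4)[of "prod_list xs * x" b] by (simp add: mult.assoc)
  then show ?thesis
    unfolding quasi_multilinear_def
    by (simp add: E distrib_left distrib_right mult_scaleC_left mult_scaleC_right mult.assoc)
qed

text \<open>The functional sends the word b0 X b1 ... X bl to b0 times the value of
  \<open>\<Phi>\<close> at [X b1, ..., X bl]. Agreement with \<open>\<Phi>\<close> has to be checked
  only at lists X b1, ..., X bl, X, to which all lists of letters reduce.\<close>

lemma bimodule_map_with_moments:
  fixes \<Phi> :: "'b::cstar_algebra_1 ncpoly list \<Rightarrow> 'b"
  assumes \<Phi>: "quasi_multilinear nc_const \<Phi>"
  obtains \<nu> where "bimodule_map nc_const \<nu>" "\<nu> 1 = 1"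
    "\<And>as. as \<noteq> [] \<Longrightarrow> \<forall>a\<in>set as. nc_letter a \<Longrightarrow> \<nu> (prod_list as) = \<Phi> as"
proof -
  note q = quasi_D[OF star_hom_nc_const \<Phi>]
  \<comment> \<open>\<open>word\<close> takes the coefficients from left to right;
    \<open>\<phi>\<close> reverses them, so that multiplication from the right acts on the
    head.\<close>
  define word where "word bs = (case bs of [] \<Rightarrow> 0 | b # cs \<Rightarrow>
    (if cs = [] then b else b * \<Phi> (map (\<lambda>c. nc_X * nc_const c) cs)))" for bs
  define \<phi> where "\<phi> bs = word (rev bs)" for bs
  have c_add: "nc_const (x + y) = nc_const x + nc_const y" for x y :: 'b
    using star_hom_nc_const unfolding star_hom_def clinear_map_def by blast
  have add: "word (xs @ (x + y) # ys) = word (xs @ x # ys) + word (xs @ y # ys)" for xs x y ys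
    by (cases xs) (simp_all add: word_def distrib_right distrib_left c_add q(1))
  have scale: "word (xs @ scaleC z x # ys) = scaleC z (word (xs @ x # ys))" for xs z x ys
    by (cases xs) (simp_all add: word_def mult_scaleC_left mult_scaleC_right nc_const_simps q(2))
  have right: "\<phi> (c * d # cs) = \<phi> (c # cs) * d" for c d cs
  proof (cases "rev cs")
    case (Cons b bs)
    then show ?thesis
      using q(4)[of "map (\<lambda>c. nc_X * nc_const c) bs" "nc_X * nc_const c" d]
      by (simp add: \<phi>_def word_def nc_const_simps mult.assoc)
  qed (simp add: \<phi>_def word_def)
  have left: "\<phi> (bs @ [c * b]) = c * \<phi> (bs @ [b])" for bs b c
    by (simp add: \<phi>_def word_def mult.assoc)
  have \<phi>: "multilinear_family \<phi>"
    unfolding multilinear_family_def \<phi>_def by (simp add: add scale word_def[of "[]"])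
  note s = nc_functional_simps[OF \<phi>] and ml = multilinear_family_nc_functional[OF \<phi>]
  \<comment> \<open>The list \<open>[1]\<close> encodes the word 1, so this is the functional at 1 *
    p.\<close>
  define \<nu> where "\<nu> p = nc_functional \<phi> p [1]" for p
  have const: "nc_functional \<phi> (nc_const d) = (\<lambda>bs. \<phi> bs * d)" for d
  proof
    show "nc_functional \<phi> (nc_const d) bs = \<phi> bs * d" for bs
      using multilinear_familyD(1)[OF \<phi>] multilinear_familyD(1)[OF ml]
      by (cases bs) (simp_all add: s right)
  qed
  have "\<nu> (nc_const c * p * nc_const d) = c * \<nu> p * d" for c p d
  proof -
    have "\<nu> (nc_const c * p * nc_const d) = nc_functional (nc_functional \<phi> (nc_const d)) p [c]"
      unfolding \<nu>_def mult.assoc s(4) nc_functional_simps(4)[OF ml]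
      by (simp add: nc_functional_simps(1)[OF multilinear_family_nc_functional[OF ml]])
    also have "\<dots> = nc_functional \<phi> p [c] * d"
      unfolding const unfolding nc_functional_def nc_act_mult_right by (rule refl)
    also have "nc_functional \<phi> p [c] = c * \<nu> p"
      using nc_act_mult_left[of \<phi> c, OF left, of "rep_ncpoly p" False "[]" 1]
      by (simp add: \<nu>_def nc_functional_def)
    finally show ?thesis .
  qed
  moreover have "\<nu> (x + y) = \<nu> x + \<nu> y" "\<nu> (scaleC z x) = scaleC z (\<nu> x)" for x y z
    unfolding \<nu>_def by (rule s)+
  ultimately have bim: "bimodule_map nc_const \<nu>"
    unfolding bimodule_map_def clinear_map_def by blast
  have "\<nu> 1 = 1" by (simp add: \<nu>_def s \<phi>_def word_def)
  moreover have "\<nu> (prod_list as) = \<Phi> as" if as: "as \<noteq> []" "\<forall>a\<in>set as. nc_letter a" for as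
  proof (rule letters_agree[OF quasi_multilinear_moments[OF star_hom_nc_const bim] \<Phi> _ as])
    fix bs :: "'b list"
    have "nc_functional \<psi> (prod_list (map (\<lambda>b. nc_X * nc_const b) bs)) (c # cs) = \<psi> (rev bs @ c # cs)"
      if "multilinear_family \<psi>" for \<psi> c cs
    proof (induction bs arbitrary: c cs)
      case Nil
      show ?case using that by (simp add: nc_functional_simps)
    next
      case (Cons b bs)
      note m = multilinear_family_nc_functional[OF that]
      show ?case
        using Cons.IH[of b "c # cs"]
        by (simp add: nc_functional_simps(4)[OF that] nc_functional_simps(4)[OF m] nc_functional_simps(1)[OF m]
            nc_functional_simps(2)[OF multilinear_family_nc_functional[OF m]])
    qed
    from this[OF ml, of nc_X 1 "[]"]
    have "\<nu> (prod_list (map (\<lambda>b. nc_X * nc_const b) bs @ [nc_X])) = nc_functional \<phi> nc_X (rev bs @ [1])"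
      by (simp add: \<nu>_def s(4))
    also have "\<dots> = \<phi> (1 # rev bs @ [1])" by (cases "rev bs") (simp_all add: s)
    also have "\<dots> = \<Phi> (map (\<lambda>b. nc_X * nc_const b) bs @ [nc_X])"
      by (simp add: \<phi>_def word_def nc_const_simps)
    finally show "\<nu> (prod_list (map (\<lambda>b. nc_X * nc_const b) bs @ [nc_X])) =
      \<Phi> (map (\<lambda>b. nc_X * nc_const b) bs @ [nc_X])" .
  qed
  ultimately show ?thesis using that bim by blast
qed

section \<open>From moments on letters to cumulants on letters\<close>

definition moments_of_cumulants ::
    "(nat set set \<Rightarrow> real) \<Rightarrow> ('b \<Rightarrow> 'a) \<Rightarrow> ('a::star_algebra_1 list \<Rightarrow> 'b::cstar_algebra_1) \<Rightarrow> 'a list \<Rightarrow> 'b" where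
  "moments_of_cumulants \<alpha> \<iota> K as = (\<Sum>\<pi>\<in>NC {1..length as}. \<alpha> \<pi> *\<^sub>R eval_list \<iota> K \<pi> as)"

lemma quasi_multilinear_moments_of_cumulants:
  assumes \<iota>: "star_hom \<iota>" and K: "quasi_multilinear \<iota> K"
  shows "quasi_multilinear \<iota> (moments_of_cumulants \<alpha> \<iota> K)"
proof -
  define M where "M = moments_of_cumulants \<alpha> \<iota> K"
  have "M (xs @ (x + y) # ys) = M (xs @ x # ys) + M (xs @ y # ys)" for xs x y ys
  proof -
    have M: "M (xs @ u # ys) = (\<Sum>\<pi>\<in>NC {1..length (xs @ x # ys)}. \<alpha> \<pi> *\<^sub>R eval_list \<iota> K \<pi> (xs @ u # ys))" for u
      by (simp add: M_def moments_of_cumulants_def)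
    show ?thesis
      unfolding M sum.distrib[symmetric] scaleR_add_right[symmetric]
      by (rule sum.cong[OF refl]) (simp add: eval_list_add[OF \<iota> K])
  qed
  moreover have "M (xs @ scaleC z x # ys) = scaleC z (M (xs @ x # ys))" for xs z x ys
    unfolding M_def moments_of_cumulants_def scaleC_sum
    by (rule sum.cong) (auto simp: eval_list_scale[OF \<iota> K] scaleC_scaleR)
  moreover have "M (\<iota> b * x # xs) = b * M (x # xs)" for b x xs
    unfolding M_def moments_of_cumulants_def sum_distrib_left
    by (rule sum.cong) (auto simp: eval_list_left[OF \<iota> K])
  moreover have "M (xs @ [x * \<iota> b]) = M (xs @ [x]) * b" for xs x b
    unfolding M_def moments_of_cumulants_def sum_distrib_right
    by (rule sum.cong) (auto simp: eval_list_right[OF \<iota> K])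
  moreover have "M (xs @ x * \<iota> b # y # ys) = M (xs @ x # \<iota> b * y # ys)" for xs x b y ys
    unfolding M_def moments_of_cumulants_def
    by (rule sum.cong) (auto simp: eval_list_middle[OF \<iota> K])
  ultimately show ?thesis unfolding quasi_multilinear_def M_def by blast
qed

text \<open>A cumulant is a moment minus terms in cumulants of shorter lists. Evaluating a partition
  only multiplies letters from the left by coefficients, which gives letters again, so the recursion
  never leaves them.\<close>

lemma cumulants_of_moments:
  assumes \<alpha>: "\<And>l. l \<ge> 1 \<Longrightarrow> \<alpha> {{1..l}} = 1"
    and \<nu>: "bimodule_map nc_const \<nu>" and K: "quasi_multilinear nc_const K"
    and mom: "\<And>as. as \<noteq> [] \<Longrightarrow> \<forall>a\<in>set as. nc_letter a \<Longrightarrow> \<nu> (prod_list as) = moments_of_cumulants \<alpha> nc_const K as"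
    and as: "as \<noteq> []" "\<forall>a\<in>set as. nc_letter a"
  shows "cumulants \<alpha> nc_const \<nu> as = K as"
  using as
proof (induction "length as" arbitrary: as rule: less_induct)
  case less
  define L where "L = cumulants \<alpha> nc_const \<nu>"
  have L: "is_cumulants \<alpha> nc_const \<nu> L"
    unfolding L_def by (rule is_cumulants_cumulants[where \<alpha> = \<alpha>, OF star_hom_nc_const \<nu> \<alpha>])
  have l: "1 \<le> length as" using less.prems by (simp add: Suc_le_eq)
  note split = moment_split[where as = as and \<alpha> = \<alpha> and \<iota> = nc_const, OF less.prems(1) \<alpha>[OF l]]
  \<comment> \<open>Comparing partition sums calls for agreement on all nonempty lists of letters,
    while the induction provides it below the current length. Cutting off at that length removes the
    difference and leaves the lower terms unchanged.\<close>
  define trunc where "trunc \<Lambda> bs = (if length bs < length as then \<Lambda> bs else 0)" for \<Lambda> :: "'a ncpoly list \<Rightarrow> 'a" and bs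
  have "L as + lower_terms \<alpha> nc_const L as = K as + lower_terms \<alpha> nc_const K as"
    using mom[OF less.prems] L less.prems(1)
    unfolding is_cumulants_def split[symmetric] moments_of_cumulants_def eval_list_def by simp
  moreover have "lower_terms \<alpha> nc_const L as = lower_terms \<alpha> nc_const K as"
  proof -
    have tr: "lower_terms \<alpha> nc_const \<Lambda> as = lower_terms \<alpha> nc_const (trunc \<Lambda>) as" for \<Lambda>
      by (rule lower_cong) (simp add: trunc_def)
    have "eval_partition nc_const (trunc L) \<pi> (\<lambda>i. as ! (i - 1)) = eval_partition nc_const (trunc K) \<pi> (\<lambda>i. as ! (i - 1))"
      if "\<pi> \<in> NC {1..length as}" for \<pi>
      by (rule eval_partition_letters[OF _ that])
        (use less in \<open>auto simp: trunc_def L_def Suc_le_eq\<close>)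
    then have "lower_terms \<alpha> nc_const (trunc L) as = lower_terms \<alpha> nc_const (trunc K) as"
      unfolding lower_terms_def eval_list_def by (intro sum.cong refl) (simp only: Diff_iff)
    then show ?thesis unfolding tr[of L] tr[of K] .
  qed
  ultimately show ?case by (simp add: L_def)
qed

lemma law_with_cumulants_eq:
  fixes K :: "'b::cstar_algebra_1 ncpoly list \<Rightarrow> 'b"
  assumes \<alpha>: "\<And>l. l \<ge> 1 \<Longrightarrow> \<alpha> {{1..l}} = 1"
    and \<nu>: "bimodule_map nc_const \<nu>" "\<nu> 1 = 1" and K: "quasi_multilinear nc_const K"
    and \<kappa>: "\<And>bs. \<kappa> bs = K (map (\<lambda>b. nc_X * nc_const b) bs @ [nc_X])"
    and mom: "\<And>as. as \<noteq> [] \<Longrightarrow> \<forall>a\<in>set as. nc_letter a \<Longrightarrow> \<nu> (prod_list as) = moments_of_cumulants \<alpha> nc_const K as"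
  shows "law_with_cumulants \<alpha> \<kappa> = \<nu>"
proof -
  have "nc_letter nc_X" "nc_letter (nc_X * nc_const b)" for b :: 'b
    unfolding nc_letter_def by (metis mult.left_neutral mult.right_neutral nc_const_simps(3))+
  then have *: "law_cumulants \<alpha> \<nu> bs = \<kappa> bs" for bs
    unfolding law_cumulants_def \<kappa> by (intro cumulants_of_moments[where \<alpha> = \<alpha>, OF \<alpha> \<nu>(1) K mom]) auto
  show ?thesis
    unfolding law_with_cumulants_def
  proof (rule the_equality)
    show "bimodule_map nc_const \<nu> \<and> \<nu> 1 = 1 \<and> (\<forall>bs. law_cumulants \<alpha> \<nu> bs = \<kappa> bs)" using \<nu> * by blast
    show "\<mu> = \<nu>" if "bimodule_map nc_const \<mu> \<and> \<mu> 1 = 1 \<and> (\<forall>bs. law_cumulants \<alpha> \<mu> bs = \<kappa> bs)" for \<mu>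
      using that * \<nu> by (intro law_determined_by_cumulants[where \<alpha> = \<alpha>, OF \<alpha>]) auto
  qed
qed

text \<open>Makes the definite description computable: on letters its moments are the partition sums
  of \<open>K\<close>.\<close>

lemma law_with_cumulants_exists:
  fixes K :: "'b::cstar_algebra_1 ncpoly list \<Rightarrow> 'b"
  assumes \<alpha>: "\<And>l. l \<ge> 1 \<Longrightarrow> \<alpha> {{1..l}} = 1" and K: "quasi_multilinear nc_const K"
    and \<kappa>: "\<And>bs. \<kappa> bs = K (map (\<lambda>b. nc_X * nc_const b) bs @ [nc_X])"
  shows "bimodule_map nc_const (law_with_cumulants \<alpha> \<kappa>)" "law_with_cumulants \<alpha> \<kappa> 1 = 1"
    "\<And>as. as \<noteq> [] \<Longrightarrow> \<forall>a\<in>set as. nc_letter a \<Longrightarrow>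
      law_with_cumulants \<alpha> \<kappa> (prod_list as) = moments_of_cumulants \<alpha> nc_const K as"
proof -
  obtain \<nu> where \<nu>: "bimodule_map nc_const \<nu>" "\<nu> 1 = 1"
    "\<And>as. as \<noteq> [] \<Longrightarrow> \<forall>a\<in>set as. nc_letter a \<Longrightarrow> \<nu> (prod_list as) = moments_of_cumulants \<alpha> nc_const K as"
    by (rule bimodule_map_with_moments[OF quasi_multilinear_moments_of_cumulants[OF star_hom_nc_const K, where \<alpha> = \<alpha>]])
      (rule that)
  have "law_with_cumulants \<alpha> \<kappa> = \<nu>"
    by (rule law_with_cumulants_eq[where \<alpha> = \<alpha>, OF \<alpha> \<nu>(1,2) K \<kappa> \<nu>(3)])
  then show "bimodule_map nc_const (law_with_cumulants \<alpha> \<kappa>)" "law_with_cumulants \<alpha> \<kappa> 1 = 1"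
    "\<And>as. as \<noteq> [] \<Longrightarrow> \<forall>a\<in>set as. nc_letter a \<Longrightarrow>
      law_with_cumulants \<alpha> \<kappa> (prod_list as) = moments_of_cumulants \<alpha> nc_const K as"
    using \<nu> by simp_all
qed

section \<open>The coefficients of a regular tree\<close>

lemma nested_trans: "nested U W \<Longrightarrow> nested W V \<Longrightarrow> nested U V"
  unfolding nested_def by (meson order.strict_trans)

lemma nested_irrefl: "V \<noteq> {} \<Longrightarrow> \<not> nested V V"
  unfolding nested_def by (meson less_irrefl)

lemma nested_asym: "V \<noteq> {} \<Longrightarrow> nested V W \<Longrightarrow> \<not> nested W V"
  using nested_trans nested_irrefl by blast

text \<open>If the heads differed, each would occur in the tail of the other list and
  \<open>R\<close> would hold both ways.\<close>

lemma sorted_wrt_asym_unique: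
  assumes "sorted_wrt R xs" "sorted_wrt R ys" "set xs = set ys"
    and "\<And>x y. x \<in> set xs \<Longrightarrow> y \<in> set xs \<Longrightarrow> R x y \<Longrightarrow> \<not> R y x"
  shows "xs = ys"
  using assms
proof (induction xs arbitrary: ys)
  case (Cons x xs)
  obtain y ys' where ys: "ys = y # ys'" using Cons.prems(3) by (cases ys) simp_all
  have mem: "x \<in> set ys" "y \<in> set (x # xs)"
    by (simp add: Cons.prems(3)[symmetric], simp only: Cons.prems(3) ys list.set_intros)
  have xy: "x = y"
  proof (rule ccontr)
    assume "x \<noteq> y"
    then have xy: "x \<in> set ys'" "y \<in> set xs" using mem ys by auto
    have "R y x" using xy(1) Cons.prems(2) ys by simp
    moreover have "R x y" using xy(2) Cons.prems(1) by simp
    ultimately show False using Cons.prems(4)[of x y] mem by simp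
  qed
  have irrefl: "\<not> R x x" using Cons.prems(4)[of x x] by auto
  have "x \<notin> set xs" using irrefl Cons.prems(1) by auto
  moreover have "y \<notin> set ys'" using irrefl Cons.prems(2) ys xy by auto
  moreover have "insert x (set xs) = insert x (set ys')" using Cons.prems(3) ys xy by simp
  ultimately have eq: "set xs = set ys'" using insert_ident[of x "set xs" "set ys'"] unfolding xy by blast
  have "xs = ys'"
  proof (rule Cons.IH[OF _ _ eq])
    show "sorted_wrt R xs" "sorted_wrt R ys'" using Cons.prems(1,2) ys by simp_all
  qed (rule Cons.prems(4); simp)
  then show ?case by (simp add: ys xy)
qed simp

definition parent_block :: "nat set set \<Rightarrow> nat set \<Rightarrow> nat set \<Rightarrow> bool" where
  "parent_block \<pi> P V \<longleftrightarrow> P \<in> \<pi> \<and> V \<in> \<pi> \<and> nested P V \<and> \<not> (\<exists>U\<in>\<pi>. nested P U \<and> nested U V)"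

lemma graph_adjacent_parent: "graph_adjacent \<pi> V W \<longleftrightarrow> parent_block \<pi> V W \<or> parent_block \<pi> W V"
  unfolding graph_adjacent_def parent_block_def by blast

context
  fixes \<pi> :: "nat set set" and S
  assumes \<pi>: "\<pi> \<in> NC S" and finS: "finite S"
begin

lemma block_nonempty: "V \<in> \<pi> \<Longrightarrow> V \<noteq> {}"
  using NC_D(2)[OF \<pi>] by blast

text \<open>Take points of both blocks on either side of \<open>V\<close>. If the left point of one
  block comes first, any point of the other block outside the span of the first pair would create a
  crossing. Hence the blocks around \<open>V\<close> form a chain and parents are unique.\<close>

lemma ancestors_linear:
  assumes W: "W1 \<in> \<pi>" "W2 \<in> \<pi>" "W1 \<noteq> W2" and V: "nested W1 V" "nested W2 V" "V \<noteq> {}"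
  shows "nested W1 W2 \<or> nested W2 W1"
proof -
  note cross = NC_D(4)[OF \<pi>]
  have main: "nested U1 U2"
    if U: "U1 \<in> \<pi>" "U2 \<in> \<pi>" "U1 \<noteq> U2" and e: "j1 \<in> U1" "k1 \<in> U1" "j2 \<in> U2" "k2 \<in> U2" "j1 < j2" "j2 < k1" "v < k2"
    for U1 U2 j1 j2 k1 k2 v
  proof -
    have disj: "U1 \<inter> U2 = {}" using NC_D(3)[OF \<pi> U] .
    have "j1 < w \<and> w < k1" if w: "w \<in> U2" for w
    proof -
      have "w \<noteq> j1" "w \<noteq> k1" using disj w e by auto
      moreover have "\<not> w < j1" using cross[OF U(2,1), of w j1 j2 k1] w e U(3) by auto
      moreover have "\<not> k1 < w" using cross[OF U(1,2), of j1 j2 k1 w] w e U(3) by auto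
      ultimately show ?thesis by linarith
    qed
    then show ?thesis using e unfolding nested_def by blast
  qed
  obtain v where v: "v \<in> V" using V(3) by blast
  obtain j1 k1 where 1: "j1 \<in> W1" "k1 \<in> W1" "j1 < v" "v < k1" using V(1) v unfolding nested_def by blast
  obtain j2 k2 where 2: "j2 \<in> W2" "k2 \<in> W2" "j2 < v" "v < k2" using V(2) v unfolding nested_def by blast
  have "j1 \<noteq> j2" using NC_D(3)[OF \<pi> W] 1 2 by blast
  then consider "j1 < j2" | "j2 < j1" by linarith
  then show ?thesis
  proof cases
    case 1
    then show ?thesis using main[OF W, of j1 k1 j2 k2 v] \<open>j1 \<in> W1\<close> \<open>k1 \<in> W1\<close> 2 \<open>v < k1\<close> by auto
  next
    case 2
    then show ?thesis using main[OF W(2,1) W(3)[symmetric], of j2 k2 j1 k1 v] 1 \<open>j2 \<in> W2\<close> \<open>k2 \<in> W2\<close> \<open>v < k2\<close> by auto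
  qed
qed

lemma parent_block_exists:
  assumes "V \<in> \<pi>" "W \<in> \<pi>" "nested W V"
  obtains P where "parent_block \<pi> P V"
proof -
  define A where "A = {W\<in>\<pi>. nested W V}"
  have A: "finite A" "A \<noteq> {}" using NC_finite(1)[OF \<pi> finS] assms by (auto simp: A_def)
  define P where "P = arg_min_on Max A"
  have P: "P \<in> A" "\<And>U. U \<in> A \<Longrightarrow> Max P \<le> Max U"
    unfolding P_def using arg_min_if_finite(1)[OF A] arg_min_least[OF A] by auto
  have "\<not> (nested P U \<and> nested U V)" if U: "U \<in> \<pi>" for U
  proof
    assume n: "nested P U \<and> nested U V"
    have fin: "finite P" "finite U" using NC_finite(2)[OF \<pi> finS] P(1) U by (auto simp: A_def)
    obtain k where "k \<in> P" "\<And>u. u \<in> U \<Longrightarrow> u < k" using n unfolding nested_def by blast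
    then have "Max U < Max P"
      using fin block_nonempty[OF U] by (metis Max_ge Max_in order.strict_trans2)
    moreover have "Max P \<le> Max U" using P(2) U n by (simp add: A_def)
    ultimately show False by simp
  qed
  then show thesis using that[of P] P(1) assms(1) unfolding parent_block_def A_def by blast
qed

lemma parent_block_ancestors:
  assumes "parent_block \<pi> P V"
  shows "{W\<in>\<pi>. nested W V} = insert P {W\<in>\<pi>. nested W P}"
proof -
  have P: "P \<in> \<pi>" "V \<in> \<pi>" "nested P V" "\<And>U. U \<in> \<pi> \<Longrightarrow> nested P U \<Longrightarrow> \<not> nested U V"
    using assms unfolding parent_block_def by blast+
  have "W = P \<or> nested W P" if "W \<in> \<pi>" "nested W V" for W
    using ancestors_linear[OF that(1) P(1) _ that(2) P(3) block_nonempty[OF P(2)]] P(4)[OF that(1)] that by blast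
  then show ?thesis using P(1,3) nested_trans by blast
qed

lemma parent_block_unique: "parent_block \<pi> P V \<Longrightarrow> parent_block \<pi> P' V \<Longrightarrow> P = P'"
  using ancestors_linear block_nonempty unfolding parent_block_def by blast

lemma chain_eqI:
  assumes "V \<in> \<pi>" "set Vs = insert V {W\<in>\<pi>. nested W V}" "sorted_wrt (\<lambda>U W. nested W U) Vs"
  shows "chain \<pi> V = Vs"
  unfolding chain_def
proof (rule the_equality)
  show "set Vs = insert V {W\<in>\<pi>. nested W V} \<and> sorted_wrt (\<lambda>U W. nested W U) Vs" using assms by simp
  fix Ws assume Ws: "set Ws = insert V {W\<in>\<pi>. nested W V} \<and> sorted_wrt (\<lambda>U W. nested W U) Ws"
  show "Ws = Vs"
  proof (rule sorted_wrt_asym_unique)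
    show "\<not> nested x y" if "x \<in> set Ws" "nested y x" for x y
    proof -
      have "x \<in> \<pi>" using that(1) Ws assms(1) by auto
      then show ?thesis using nested_asym[OF block_nonempty] that(2) by blast
    qed
  qed (use Ws assms in auto)
qed

lemma chain_spec:
  assumes "V \<in> \<pi>"
  shows "set (chain \<pi> V) = insert V {W\<in>\<pi>. nested W V}" "sorted_wrt (\<lambda>U W. nested W U) (chain \<pi> V)"
proof -
  have "\<exists>Vs. set Vs = insert V {W\<in>\<pi>. nested W V} \<and> sorted_wrt (\<lambda>U W. nested W U) Vs"
    using assms
  proof (induction "card {W\<in>\<pi>. nested W V}" arbitrary: V rule: less_induct)
    case less
    show ?case
    proof (cases "\<exists>W\<in>\<pi>. nested W V")
      case False
      then have anc: "{W\<in>\<pi>. nested W V} = {}" by blast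
      show ?thesis unfolding anc by (intro exI[of _ "[V]"]) simp
    next
      case True
      then obtain P where P: "parent_block \<pi> P V" using parent_block_exists less.prems by blast
      then have P\<pi>: "P \<in> \<pi>" "nested P V" by (auto simp: parent_block_def)
      note anc = parent_block_ancestors[OF P]
      have fin: "finite {W\<in>\<pi>. nested W P}" using NC_finite(1)[OF \<pi> finS] by simp
      have "P \<notin> {W\<in>\<pi>. nested W P}" using nested_irrefl[OF block_nonempty[OF P\<pi>(1)]] by simp
      then have "card {W\<in>\<pi>. nested W P} < card {W\<in>\<pi>. nested W V}" unfolding anc using fin by simp
      then obtain Vs where Vs: "set Vs = insert P {W\<in>\<pi>. nested W P}" "sorted_wrt (\<lambda>U W. nested W U) Vs"
        using less.hyps P\<pi>(1) by blast
      have "nested W V" if "W \<in> set Vs" for W using that unfolding Vs(1) anc[symmetric] by simp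
      then show ?thesis using Vs unfolding anc by (intro exI[of _ "V # Vs"]) simp
    qed
  qed
  then obtain Vs where Vs: "set Vs = insert V {W\<in>\<pi>. nested W V}" "sorted_wrt (\<lambda>U W. nested W U) Vs" by blast
  then show "set (chain \<pi> V) = insert V {W\<in>\<pi>. nested W V}" "sorted_wrt (\<lambda>U W. nested W U) (chain \<pi> V)"
    using chain_eqI[OF assms Vs] by simp_all
qed

lemma chain_parent:
  assumes "parent_block \<pi> P V"
  shows "chain \<pi> V = V # chain \<pi> P"
proof -
  have P: "P \<in> \<pi>" "V \<in> \<pi>" using assms by (auto simp: parent_block_def)
  note spec = chain_spec[OF P(1)] and anc = parent_block_ancestors[OF assms]
  have "nested W V" if "W \<in> set (chain \<pi> P)" for W using that unfolding spec(1) anc[symmetric] by simp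
  then show ?thesis
    using spec by (intro chain_eqI[OF P(2)]) (simp_all add: anc)
qed

lemma chain_root:
  assumes "V \<in> \<pi>" "\<not> (\<exists>W\<in>\<pi>. nested W V)"
  shows "chain \<pi> V = [V]"
proof (rule chain_eqI[OF assms(1)])
  have anc: "{W\<in>\<pi>. nested W V} = {}" using assms(2) by blast
  show "set [V] = insert V {W\<in>\<pi>. nested W V}" unfolding anc by simp
qed simp

lemma chain_Cons: "V \<in> \<pi> \<Longrightarrow> \<exists>Us. chain \<pi> V = V # Us"
  using chain_parent chain_root parent_block_exists by metis

text \<open>If the parent is missing or has another colour, a path of one colour that starts at
  \<open>V\<close> never climbs above \<open>V\<close>, and its component consists of
  \<open>V\<close> and blocks nested in it.\<close>

lemma component_has_parent:
  assumes V: "V \<in> \<pi>" and W: "(V, W) \<in> (same_colour \<pi> \<chi>)\<^sup>*" "nested W V"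
  shows "\<exists>P. parent_block \<pi> P V \<and> \<chi> P = \<chi> V"
proof (rule ccontr)
  assume no: "\<not> ?thesis"
  have "U \<in> \<pi> \<and> \<chi> U = \<chi> V \<and> (U = V \<or> nested V U)" if "(V, U) \<in> (same_colour \<pi> \<chi>)\<^sup>*" for U
    using that
  proof induction
    case (step U U')
    from step(2) have adj: "parent_block \<pi> U U' \<or> parent_block \<pi> U' U" and c: "\<chi> U = \<chi> U'"
      by (auto simp: same_colour_def graph_adjacent_parent)
    have U': "U' \<in> \<pi>" "U \<in> \<pi>" using adj by (auto simp: parent_block_def)
    have "U' = V \<or> nested V U'"
      using adj
    proof
      assume "parent_block \<pi> U U'"
      then have "nested U U'" by (simp add: parent_block_def)
      then show ?thesis using step(3) nested_trans by blast
    next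
      assume p: "parent_block \<pi> U' U"
      show ?thesis
      proof (cases "U = V")
        case True
        then show ?thesis using no p c by auto
      next
        case False
        then have "nested V U" using step(3) by blast
        moreover have "nested U' U" "\<And>X. X \<in> \<pi> \<Longrightarrow> nested U' X \<Longrightarrow> \<not> nested X U" using p by (auto simp: parent_block_def)
        ultimately show ?thesis
          using ancestors_linear[OF V U'(1) _ _ _ block_nonempty[OF U'(2)]] V by blast
      qed
    qed
    then show ?case using step(3) c U' by auto
  qed (use V in simp)
  from this[OF W(1)] show False
    using W(2) nested_asym[OF block_nonempty[OF V]] nested_irrefl[OF block_nonempty[OF V]] by blast
qed

text \<open>A block is inner in its component exactly if its parent in \<open>\<pi>\<close> has the
  same colour. The product over components thus becomes a product of local factors, from which a
  single block can be removed.\<close>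

lemma prod_components:
  "(\<Prod>C\<in>colour_components \<pi> \<chi>. block_weight 1 t C) =
    (\<Prod>V\<in>\<pi>. if \<exists>P. parent_block \<pi> P V \<and> \<chi> P = \<chi> V then t else 1)"
proof -
  define g where "g V = (if \<exists>P. parent_block \<pi> P V \<and> \<chi> P = \<chi> V then t else 1)" for V
  define cls where "cls V = {W. (V, W) \<in> (same_colour \<pi> \<chi>)\<^sup>*}" for V
  have comps: "colour_components \<pi> \<chi> = cls ` \<pi>" unfolding colour_components_alt cls_def ..
  have cls_eq: "cls W = cls V" if "W \<in> cls V" for V W
    using that symD[OF same_colour_sym[of \<pi> \<chi>]] unfolding cls_def by (auto intro: rtrancl_trans)
  have sub: "cls V \<subseteq> \<pi>" if "V \<in> \<pi>" for V using same_colour_rtrancl that unfolding cls_def by blast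
  have finp: "finite \<pi>" by (rule NC_finite(1)[OF \<pi> finS])
  have bw: "block_weight 1 t C = prod g C" if C: "C \<in> cls ` \<pi>" for C
    unfolding block_weight_def
  proof (rule prod.cong[OF refl])
    fix V assume V: "V \<in> C"
    obtain U where "U \<in> \<pi>" "C = cls U" using C by blast
    then have CV: "C = cls V" "V \<in> \<pi>" using cls_eq[of V U] sub[of U] V by auto
    have "(\<exists>W\<in>C. nested W V) \<longleftrightarrow> (\<exists>P. parent_block \<pi> P V \<and> \<chi> P = \<chi> V)"
    proof
      assume "\<exists>W\<in>C. nested W V"
      then show "\<exists>P. parent_block \<pi> P V \<and> \<chi> P = \<chi> V"
        using component_has_parent[OF CV(2)] unfolding CV(1) cls_def by blast
    next
      assume "\<exists>P. parent_block \<pi> P V \<and> \<chi> P = \<chi> V"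
      then obtain P where P: "parent_block \<pi> P V" "\<chi> P = \<chi> V" by blast
      then have "(V, P) \<in> same_colour \<pi> \<chi>" by (auto simp: same_colour_def graph_adjacent_parent)
      then have "P \<in> C" unfolding CV(1) cls_def by blast
      moreover have "nested P V" using P(1) by (simp add: parent_block_def)
      ultimately show "\<exists>W\<in>C. nested W V" by blast
    qed
    then show "(if \<exists>W\<in>C. nested W V then t else 1) = g V" by (simp add: g_def)
  qed
  have "prod (prod g) (cls ` \<pi>) = prod g (\<Union>(cls ` \<pi>))"
  proof (rule prod.Union_disjoint[symmetric, unfolded comp_def])
    show "\<forall>A\<in>cls ` \<pi>. finite A" using sub finp finite_subset by blast
    show "\<forall>A\<in>cls ` \<pi>. \<forall>B\<in>cls ` \<pi>. A \<noteq> B \<longrightarrow> A \<inter> B = {}"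
    proof (intro ballI impI)
      fix A B assume "A \<in> cls ` \<pi>" "B \<in> cls ` \<pi>" "A \<noteq> B"
      then obtain U V where "A = cls U" "B = cls V" by blast
      then show "A \<inter> B = {}" using cls_eq \<open>A \<noteq> B\<close> by blast
    qed
  qed
  moreover have "\<Union>(cls ` \<pi>) = \<pi>" using sub unfolding cls_def by blast
  ultimately show ?thesis unfolding comps using bw by (simp add: g_def)
qed

text \<open>A block that nests no other occurs in no chain but its own, so its colour is restricted
  only by the colours of the blocks around it.\<close>

lemma sum_colourings_remove:
  fixes F :: "(nat set \<Rightarrow> nat) \<Rightarrow> real"
  assumes V: "V \<in> \<pi>" and leaf: "\<And>W. W \<in> \<pi> \<Longrightarrow> \<not> nested V W"
  shows "(\<Sum>\<chi>\<in>colourings N T \<pi>. F \<chi>) =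
    (\<Sum>\<chi>\<in>colourings N T (\<pi> - {V}).
       \<Sum>c | c \<in> {1..N} \<and> remdups_adj (c # map \<chi> (tl (chain \<pi> V))) \<in> T. F (\<chi>(V := c)))"
proof -
  have chain0: "chain (\<pi> - {V}) W = chain \<pi> W" if "W \<in> \<pi>" for W
  proof -
    have "{U\<in>\<pi> - {V}. nested U W} = {U\<in>\<pi>. nested U W}" using leaf[OF that] by blast
    then show ?thesis unfolding chain_def by simp
  qed
  have not: "V \<notin> set (chain \<pi> W)" if "W \<in> \<pi> - {V}" for W
    using chain_spec(1)[of W] that leaf by auto
  obtain Us where Us: "chain \<pi> V = V # Us" using chain_Cons[OF V] by blast
  have VUs: "V \<notin> set Us"
  proof
    assume "V \<in> set Us"
    then have "nested V V" using chain_spec(2)[OF V] Us by simp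
    then show False using leaf[OF V] by simp
  qed
  have upd: "map (\<chi>(V := c)) (chain \<pi> V) = c # map \<chi> Us"
    "W \<in> \<pi> - {V} \<Longrightarrow> map (\<chi>(V := c)) (chain \<pi> W) = map \<chi> (chain \<pi> W)" for \<chi> :: "nat set \<Rightarrow> nat" and c W
    using VUs not[of W] by (auto simp: Us)
  have col: "\<chi>(V := c) \<in> colourings N T \<pi> \<longleftrightarrow>
      \<chi> \<in> colourings N T (\<pi> - {V}) \<and> c \<in> {1..N} \<and> remdups_adj (c # map \<chi> Us) \<in> T"
    if \<chi>: "\<chi> V = undefined" for \<chi> c
  proof -
    have "\<chi>(V := c) \<in> \<pi> \<rightarrow>\<^sub>E {1..N} \<longleftrightarrow> \<chi> \<in> (\<pi> - {V}) \<rightarrow>\<^sub>E {1..N} \<and> c \<in> {1..N}"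
      using V \<chi> unfolding PiE_iff extensional_def by auto
    moreover have "(\<forall>W\<in>\<pi>. remdups_adj (map (\<chi>(V := c)) (chain \<pi> W)) \<in> T) \<longleftrightarrow>
       (\<forall>W\<in>\<pi> - {V}. remdups_adj (map \<chi> (chain (\<pi> - {V}) W)) \<in> T) \<and> remdups_adj (c # map \<chi> Us) \<in> T"
    proof -
      have "(\<forall>W\<in>\<pi>. remdups_adj (map (\<chi>(V := c)) (chain \<pi> W)) \<in> T) \<longleftrightarrow>
         (\<forall>W\<in>\<pi> - {V}. remdups_adj (map (\<chi>(V := c)) (chain \<pi> W)) \<in> T) \<and>
         remdups_adj (map (\<chi>(V := c)) (chain \<pi> V)) \<in> T" using V by blast
      also have "(\<forall>W\<in>\<pi> - {V}. remdups_adj (map (\<chi>(V := c)) (chain \<pi> W)) \<in> T) \<longleftrightarrow>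
         (\<forall>W\<in>\<pi> - {V}. remdups_adj (map \<chi> (chain (\<pi> - {V}) W)) \<in> T)"
      proof (rule ball_cong[OF refl])
        fix W assume W: "W \<in> \<pi> - {V}"
        then have "W \<in> \<pi>" by blast
        then show "remdups_adj (map (\<chi>(V := c)) (chain \<pi> W)) \<in> T \<longleftrightarrow>
            remdups_adj (map \<chi> (chain (\<pi> - {V}) W)) \<in> T"
          unfolding upd(2)[OF W] by (simp only: chain0)
      qed
      finally show ?thesis unfolding upd(1) .
    qed
    ultimately show ?thesis unfolding colourings_def mem_Collect_eq by blast
  qed
  \<comment> \<open>Extensional colourings are \<open>undefined\<close> off the partition; resetting
    \<open>V\<close> to that value inverts the update.\<close>
  have und: "\<chi> V = undefined" if "\<chi> \<in> colourings N T (\<pi> - {V})" for \<chi>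
    using that unfolding colourings_def by (auto simp: PiE_def extensional_def)
  define opts where "opts \<chi> = {c. c \<in> {1..N} \<and> remdups_adj (c # map \<chi> Us) \<in> T}" for \<chi>
  have "(\<Sum>\<chi>\<in>colourings N T \<pi>. F \<chi>) = (\<Sum>(\<chi>, c)\<in>Sigma (colourings N T (\<pi> - {V})) opts. F (\<chi>(V := c)))"
  proof (rule sum.reindex_bij_witness[where j = "\<lambda>\<chi>. (\<chi>(V := undefined), \<chi> V)" and i = "\<lambda>(\<chi>, c). \<chi>(V := c)"])
    fix \<chi> assume \<chi>: "\<chi> \<in> colourings N T \<pi>"
    show "(\<lambda>(\<chi>, c). \<chi>(V := c)) (\<chi>(V := undefined), \<chi> V) = \<chi>" by simp
    show "(\<chi>(V := undefined), \<chi> V) \<in> Sigma (colourings N T (\<pi> - {V})) opts"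
      using col[of "\<chi>(V := undefined)" "\<chi> V"] \<chi> by (simp add: opts_def)
    show "(case (\<chi>(V := undefined), \<chi> V) of (\<chi>, c) \<Rightarrow> F (\<chi>(V := c))) = F \<chi>" by simp
  next
    fix b assume b: "b \<in> Sigma (colourings N T (\<pi> - {V})) opts"
    then obtain \<chi> c where bc: "b = (\<chi>, c)" "\<chi> \<in> colourings N T (\<pi> - {V})" "c \<in> opts \<chi>" by blast
    note u = und[OF bc(2)]
    show "((case b of (\<chi>, c) \<Rightarrow> \<chi>(V := c))(V := undefined), (case b of (\<chi>, c) \<Rightarrow> \<chi>(V := c)) V) = b"
      using u by (auto simp: bc(1))
    show "(case b of (\<chi>, c) \<Rightarrow> \<chi>(V := c)) \<in> colourings N T \<pi>"
      using col[of \<chi>, OF u, of c] bc by (simp add: opts_def)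
  qed
  also have "\<dots> = (\<Sum>\<chi>\<in>colourings N T (\<pi> - {V}). \<Sum>c\<in>opts \<chi>. F (\<chi>(V := c)))"
    by (rule sum.Sigma[symmetric]) (use finite_colourings[of "\<pi> - {V}"] NC_finite(1)[OF \<pi> finS] in \<open>auto simp: opts_def\<close>)
  finally show ?thesis by (simp add: Us opts_def)
qed

end

section \<open>Colourings by a regular tree\<close>

lemma regular_tree_root_degree:
  assumes "regular_tree n d T"
  shows "root_degree T = n"
proof -
  have "children T [] = (\<lambda>j. [j]) ` {j. [j] \<in> T}" unfolding children_def by auto
  then have "card (children T []) = root_degree T" by (simp add: card_image inj_on_def)
  then show ?thesis using assms by (simp add: regular_tree_def)
qed

lemma regular_tree_children:
  assumes T: "T \<in> Tree N" and reg: "regular_tree n d T" and s: "s \<in> T" "s \<noteq> []"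
  shows "card {c. c # s \<in> T} = d" "{c. c # s \<in> T} \<subseteq> {1..N} - {hd s}"
proof -
  have "children T s = (\<lambda>j. j # s) ` {j. j # s \<in> T}" unfolding children_def by auto
  then have "card (children T s) = card {c. c # s \<in> T}" by (simp add: card_image inj_on_def)
  then show "card {c. c # s \<in> T} = d" using reg s by (simp add: regular_tree_def)
  have "alternating N (c # s)" if "c # s \<in> T" for c using T that by (simp add: Tree_def)
  then show "{c. c # s \<in> T} \<subseteq> {1..N} - {hd s}"
    using s(2) by (cases s) (force simp: alternating_def)+
qed

text \<open>Whatever the colours of the other blocks are, the removed innermost block contributes
  \<open>n\<close> times its own weight, so the sum factorises block by block.\<close>

lemma regular_tree_colourings_sum:
  assumes T: "T \<in> Tree N" and reg: "regular_tree n d T" and t: "t + real d = real n * t"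
    and \<pi>: "\<pi> \<in> NC S" "finite S"
  shows "(\<Sum>\<chi>\<in>colourings N T \<pi>. \<Prod>V\<in>\<pi>. if \<exists>P. parent_block \<pi> P V \<and> \<chi> P = \<chi> V then t else 1) =
    real n ^ card \<pi> * block_weight 1 t \<pi>"
  using \<pi>
proof (induction "card \<pi>" arbitrary: \<pi> S rule: less_induct)
  case less
  note \<pi> = less.prems
  have finp: "finite \<pi>" by (rule NC_finite(1)[OF \<pi>])
  show ?case
  proof (cases "\<pi> = {}")
    case True
    then show ?thesis by (simp add: colourings_def block_weight_def)
  next
    case False
    then obtain V where iV: "interval_block \<pi> V" using interval_block_exists[OF \<pi>] by blast
    then have V: "V \<in> \<pi>" by (simp add: interval_block_def)
    have leaf: "\<not> nested V W" if W: "W \<in> \<pi>" for W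
    proof
      assume n: "nested V W"
      then obtain j k where jk: "j \<in> V" "k \<in> V" "\<And>w. w \<in> W \<Longrightarrow> j < w \<and> w < k" unfolding nested_def by blast
      then have "W \<subseteq> V" using iV W unfolding interval_block_def by blast
      moreover have "W \<noteq> V" using n nested_irrefl[OF block_nonempty[OF \<pi> V]] by blast
      ultimately show False using NC_D(3)[OF \<pi>(1) W V] block_nonempty[OF \<pi> W] by blast
    qed
    define \<pi>0 where "\<pi>0 = \<pi> - {V}"
    have \<pi>0: "\<pi>0 \<in> NC (S - V)" unfolding \<pi>0_def by (rule NC_remove[OF \<pi>(1) V])
    have ins: "\<pi> = insert V \<pi>0" "V \<notin> \<pi>0" "finite \<pi>0" using V finp by (auto simp: \<pi>0_def)
    have card: "card \<pi> = Suc (card \<pi>0)" using ins by simp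
    define u where "u = (if \<exists>W\<in>\<pi>. nested W V then t else 1)"
    have bw: "block_weight 1 t \<pi> = u * block_weight 1 t \<pi>0"
    proof -
      have "block_weight 1 t \<pi> = u * (\<Prod>W\<in>\<pi>0. if \<exists>U\<in>\<pi>. nested U W then t else 1)"
        unfolding block_weight_def u_def using ins by (subst (2) ins(1)) simp
      also have "(\<Prod>W\<in>\<pi>0. if \<exists>U\<in>\<pi>. nested U W then t else 1) = block_weight 1 t \<pi>0"
        unfolding block_weight_def
      proof (rule prod.cong[OF refl])
        fix W assume "W \<in> \<pi>0"
        then have "(\<exists>U\<in>\<pi>. nested U W) \<longleftrightarrow> (\<exists>U\<in>\<pi>0. nested U W)" using leaf[of W] ins(1) by blast
        then show "(if \<exists>U\<in>\<pi>. nested U W then t else 1) = (if \<exists>U\<in>\<pi>0. nested U W then t else 1)" by simp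
      qed
      finally show ?thesis .
    qed
    define g where "g \<pi> \<chi> W = (if \<exists>P. parent_block \<pi> P W \<and> \<chi> P = \<chi> W then t else 1)" for \<pi> and \<chi> :: "nat set \<Rightarrow> nat" and W
    have g0: "g \<pi> (\<chi>(V := c)) W = g \<pi>0 \<chi> W" if W: "W \<in> \<pi>0" for \<chi> c W
    proof -
      have "parent_block \<pi> P W \<longleftrightarrow> parent_block \<pi>0 P W" for P
        using W leaf[of W] ins(1,2) unfolding parent_block_def by blast
      moreover have "P \<noteq> V" if "parent_block \<pi>0 P W" for P using that ins(2) by (auto simp: parent_block_def)
      moreover have "W \<noteq> V" using W ins(2) by blast
      ultimately have "(\<exists>P. parent_block \<pi> P W \<and> (\<chi>(V := c)) P = (\<chi>(V := c)) W) \<longleftrightarrow> (\<exists>P. parent_block \<pi>0 P W \<and> \<chi> P = \<chi> W)"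
        by (metis fun_upd_apply)
      then show ?thesis by (simp add: g_def)
    qed
    have prod: "prod (g \<pi> (\<chi>(V := c))) \<pi> = g \<pi> (\<chi>(V := c)) V * prod (g \<pi>0 \<chi>) \<pi>0" for \<chi> c
    proof -
      have "prod (g \<pi> (\<chi>(V := c))) \<pi> = g \<pi> (\<chi>(V := c)) V * prod (g \<pi> (\<chi>(V := c))) \<pi>0"
        by (subst (2) ins(1)) (use ins in simp)
      then show ?thesis using g0 by simp
    qed
    have opts: "(\<Sum>c | c \<in> {1..N} \<and> remdups_adj (c # map \<chi> (tl (chain \<pi> V))) \<in> T. g \<pi> (\<chi>(V := c)) V) = real n * u"
      if \<chi>: "\<chi> \<in> colourings N T \<pi>0" for \<chi>
    proof (cases "\<exists>W\<in>\<pi>. nested W V")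
      case False
      have "chain \<pi> V = [V]" by (rule chain_root[OF \<pi> V False])
      moreover have "{c. c \<in> {1..N} \<and> [c] \<in> T} = {c. [c] \<in> T}"
        using T unfolding Tree_def alternating_def by fastforce
      moreover have "g \<pi> (\<chi>(V := c)) V = 1" for c using False by (auto simp: g_def parent_block_def)
      ultimately show ?thesis using False regular_tree_root_degree[OF reg] by (simp add: u_def)
    next
      case True
      then obtain P where P: "parent_block \<pi> P V" using parent_block_exists[OF \<pi> V] by blast
      have PV: "P \<in> \<pi>0" "P \<in> \<pi>"
        using P leaf[OF V] by (auto simp: parent_block_def \<pi>0_def)
      define s where "s = remdups_adj (map \<chi> (chain \<pi> P))"
      have "{U\<in>\<pi>0. nested U P} = {U\<in>\<pi>. nested U P}" using leaf[OF PV(2)] unfolding \<pi>0_def by blast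
      then have "chain \<pi>0 P = chain \<pi> P" unfolding chain_def by simp
      then have sT: "s \<in> T" using \<chi> PV(1) unfolding colourings_def s_def by auto
      obtain Us where Us: "chain \<pi> P = P # Us" using chain_Cons[OF \<pi> PV(2)] by blast
      have "\<exists>s'. s = \<chi> P # s'"
        unfolding s_def Us by (auto simp: remdups_adj_Cons split: list.split)
      then obtain s' where s': "s = \<chi> P # s'" by blast
      \<comment> \<open>Repeating the colour of the parent leaves the reduced word \<open>s\<close>
        as it is; a new colour moves to a child of the vertex \<open>s\<close>, which is not the
        root.\<close>
      have red: "remdups_adj (c # map \<chi> (tl (chain \<pi> V))) = (if c = \<chi> P then s else c # s)" for c
        using chain_parent[OF \<pi> P] s' by (simp add: remdups_adj_Cons s_def[symmetric])
      have PN: "\<chi> P \<in> {1..N}" using \<chi> PV(1) by (auto simp: colourings_def)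
      note ch = regular_tree_children[OF T reg sT, unfolded s', simplified, folded s']
      have set: "{c. c \<in> {1..N} \<and> remdups_adj (c # map \<chi> (tl (chain \<pi> V))) \<in> T} = insert (\<chi> P) {c. c # s \<in> T}"
        unfolding red using PN sT ch(2) by auto
      have g: "g \<pi> (\<chi>(V := c)) V = (if c = \<chi> P then t else 1)" for c
      proof -
        have "(\<exists>P'. parent_block \<pi> P' V \<and> (\<chi>(V := c)) P' = (\<chi>(V := c)) V) \<longleftrightarrow> \<chi> P = c"
          using P parent_block_unique[OF \<pi> _ P] PV(1) ins(2) by (metis fun_upd_apply)
        then show ?thesis by (auto simp: g_def)
      qed
      have fin: "finite {c. c # s \<in> T}" "\<chi> P \<notin> {c. c # s \<in> T}" using ch(2) finite_subset by auto
      have "(\<Sum>c\<in>{c. c # s \<in> T}. if c = \<chi> P then t else 1) = (\<Sum>c\<in>{c. c # s \<in> T}. 1)"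
        by (rule sum.cong[OF refl]) (use fin(2) in auto)
      then have "(\<Sum>c\<in>insert (\<chi> P) {c. c # s \<in> T}. g \<pi> (\<chi>(V := c)) V) = t + (\<Sum>c\<in>{c. c # s \<in> T}. 1)"
        unfolding g by (subst sum.insert[OF fin]) simp
      then show ?thesis unfolding set using ch(1) t True by (simp add: u_def)
    qed
    have "(\<Sum>\<chi>\<in>colourings N T \<pi>. prod (g \<pi> \<chi>) \<pi>) = (\<Sum>\<chi>\<in>colourings N T \<pi>0.
        \<Sum>c | c \<in> {1..N} \<and> remdups_adj (c # map \<chi> (tl (chain \<pi> V))) \<in> T. prod (g \<pi> (\<chi>(V := c))) \<pi>)"
      unfolding \<pi>0_def by (rule sum_colourings_remove[OF \<pi> V leaf])
    also have "\<dots> = (\<Sum>\<chi>\<in>colourings N T \<pi>0. real n * u * prod (g \<pi>0 \<chi>) \<pi>0)"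
      unfolding prod sum_distrib_right[symmetric] by (rule sum.cong[OF refl]) (simp only: opts)
    also have "\<dots> = real n * u * (real n ^ card \<pi>0 * block_weight 1 t \<pi>0)"
      unfolding sum_distrib_left[symmetric]
      using less.hyps[OF _ \<pi>0] \<pi>(2) card by (simp add: g_def)
    finally show ?thesis unfolding g_def bw card by simp
  qed
qed

text \<open>The power of \<open>n\<close> in the colouring sum cancels the normalisation of the
  recursion, so the block weights solve it, and the solution is unique.\<close>

lemma tree_coeff_regular:
  assumes T: "T \<in> Tree N" and reg: "regular_tree n d T" and n: "n \<ge> 2"
    and \<pi>: "\<pi> \<in> NC S" "finite S"
  shows "tree_coeff N T \<pi> = block_weight 1 (real d / (real n - 1)) \<pi>"
proof -
  define t where "t = real d / (real n - 1)"
  have t: "t + real d = real n * t" using n by (simp add: t_def field_simps)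
  \<comment> \<open>The value 0 elsewhere matches the convention that makes
    \<open>tree_coeff\<close> unique as a function.\<close>
  define \<alpha> where "\<alpha> \<pi> = (if \<exists>S. finite S \<and> \<pi> \<in> NC S then block_weight 1 t \<pi> else 0)" for \<pi>
  note rd = regular_tree_root_degree[OF reg]
  have "tree_coefficients N T \<alpha>"
    unfolding tree_coefficients_def
  proof (intro allI impI ballI conjI)
    fix S \<pi> assume S: "finite S" "\<pi> \<in> NC S"
    then have \<alpha>\<pi>: "\<alpha> \<pi> = block_weight 1 t \<pi>" by (auto simp: \<alpha>_def)
    show "\<alpha> \<pi> = 1" if "card \<pi> = 1"
      unfolding \<alpha>\<pi> using that by (auto simp: card_1_singleton_iff block_weight_single)
    have "(\<Sum>\<chi>\<in>colourings N T \<pi>. \<Prod>C\<in>colour_components \<pi> \<chi>. \<alpha> C) =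
      (\<Sum>\<chi>\<in>colourings N T \<pi>. \<Prod>C\<in>colour_components \<pi> \<chi>. block_weight 1 t C)"
    proof (intro sum.cong prod.cong refl)
      fix \<chi> C assume "C \<in> colour_components \<pi> \<chi>"
      then have "C \<subseteq> \<pi>" by (rule component_subset)
      then have "C \<in> NC (\<Union>C)" "finite (\<Union>C)"
        using NC_subset[OF S(2)] NC_D(1)[OF S(2)] S(1) by (auto intro: finite_subset[OF Union_mono])
      then show "\<alpha> C = block_weight 1 t C" unfolding \<alpha>_def by auto
    qed
    also have "\<dots> = real n ^ card \<pi> * block_weight 1 t \<pi>"
      unfolding prod_components[OF S(2,1)] by (rule regular_tree_colourings_sum[OF T reg t S(2,1)])
    finally show "\<alpha> \<pi> = 1 / real (root_degree T) ^ card \<pi> *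
        (\<Sum>\<chi>\<in>colourings N T \<pi>. \<Prod>C\<in>colour_components \<pi> \<chi>. \<alpha> C)"
      using n by (simp add: rd \<alpha>\<pi>)
  qed
  then have "tree_coeff N T = \<alpha>"
    unfolding tree_coeff_def using tree_coefficients_unique[OF T] n rd
    by (intro the1_equality) (auto simp: \<alpha>_def)
  then show ?thesis using \<pi> by (auto simp: \<alpha>_def t_def)
qed

section \<open>Free and Boolean cumulants\<close>

lemma free_coeff_weight: "free_coeff \<pi> = block_weight 1 1 \<pi>"
  by (simp add: free_coeff_def block_weight_def)

text \<open>By non-crossing, a block is an interval exactly if it nests no block. So all blocks are
  intervals exactly if none is inner, and any inner block brings a factor 0.\<close>

lemma boolean_coeff_weight:
  assumes \<pi>: "\<pi> \<in> NC S" "finite S"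
  shows "boolean_coeff \<pi> = block_weight 1 0 \<pi>"
proof -
  note fin = NC_finite[OF \<pi>] and D = NC_D[OF \<pi>(1)]
  have iff: "interval_block \<pi> V \<longleftrightarrow> \<not> (\<exists>W\<in>\<pi>. nested V W)" if V: "V \<in> \<pi>" for V
  proof
    assume iV: "interval_block \<pi> V"
    show "\<not> (\<exists>W\<in>\<pi>. nested V W)"
    proof
      assume "\<exists>W\<in>\<pi>. nested V W"
      then obtain W j k where W: "W \<in> \<pi>" "j \<in> V" "k \<in> V" "\<And>w. w \<in> W \<Longrightarrow> j < w \<and> w < k"
        unfolding nested_def by blast
      then have "W \<subseteq> V" using iV unfolding interval_block_def by blast
      moreover obtain w where "w \<in> W" using block_nonempty[OF \<pi> W(1)] by blast
      ultimately have "W = V" using D(3)[OF W(1) V] by blast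
      then show False using W(2) W(4)[of j] by simp
    qed
  next
    assume no: "\<not> (\<exists>W\<in>\<pi>. nested V W)"
    show "interval_block \<pi> V"
      unfolding interval_block_def
    proof (intro conjI ballI impI V)
      fix i k j assume ikj: "i \<in> V" "k \<in> V" "j \<in> \<Union>\<pi>" "i < j \<and> j < k"
      show "j \<in> V"
      proof (rule ccontr)
        assume "j \<notin> V"
        obtain W where W: "W \<in> \<pi>" "j \<in> W" using ikj(3) by blast
        have VW: "V \<noteq> W" using W \<open>j \<notin> V\<close> by blast
        have disj: "V \<inter> W = {}" using D(3)[OF V W(1) VW] .
        have "i < w \<and> w < k" if w: "w \<in> W" for w
        proof -
          have "w \<noteq> i" "w \<noteq> k" using disj w ikj by auto
          moreover have "\<not> w < i" using D(4)[OF W(1) V, of w i j k] w W(2) ikj VW by blast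
          moreover have "\<not> k < w" using D(4)[OF V W(1), of i j k w] w W(2) ikj VW by blast
          ultimately show ?thesis by linarith
        qed
        then show False using no W(1) ikj(1,2) unfolding nested_def by blast
      qed
    qed
  qed
  show ?thesis
  proof (cases "\<exists>V\<in>\<pi>. \<exists>W\<in>\<pi>. nested V W")
    case True
    then have "block_weight 1 0 \<pi> = 0" unfolding block_weight_def using fin(1) by (intro prod_zero) auto
    then show ?thesis using True iff by (auto simp: boolean_coeff_def)
  next
    case False
    then show ?thesis using iff by (auto simp: boolean_coeff_def block_weight_def intro!: prod.neutral[symmetric])
  qed
qed

lemma moments_of_cumulants_weight:
  assumes "\<And>l \<pi>. \<pi> \<in> NC {1..l} \<Longrightarrow> \<alpha> \<pi> = block_weight x y \<pi>"
  shows "moments_of_cumulants \<alpha> \<iota> K as = nc_moment \<iota> K x y as"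
  unfolding moments_of_cumulants_def nc_moment_def moment_sum_def eval_list_def
  by (rule sum.cong[OF refl]) (simp add: assms)

lemma quasi_multilinear_multiadditive: "quasi_multilinear \<iota> K \<Longrightarrow> multiadditive K"
  unfolding quasi_multilinear_def multiadditive_def by blast

lemma quasi_multilinear_scaleR:
  fixes K :: "'a::star_algebra_1 list \<Rightarrow> 'b::cstar_algebra_1"
  assumes K: "quasi_multilinear \<iota> K"
  shows "quasi_multilinear \<iota> (\<lambda>as. r *\<^sub>R K as)"
proof -
  have "K (xs @ (x + y) # ys) = K (xs @ x # ys) + K (xs @ y # ys)"
    "K (xs @ scaleC z x # ys) = scaleC z (K (xs @ x # ys))"
    "K (\<iota> b * x # xs) = b * K (x # xs)" "K (xs @ [x * \<iota> b]) = K (xs @ [x]) * b"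
    "K (xs @ x * \<iota> b # y # ys) = K (xs @ x # \<iota> b * y # ys)" for xs x y ys z b
    using K unfolding quasi_multilinear_def by blast+
  then show ?thesis unfolding quasi_multilinear_def by (simp add: scaleR_add_right scaleC_scaleR)
qed

lemma irreducible_part_scaleR:
  fixes K :: "'a::star_algebra_1 list \<Rightarrow> 'b::cstar_algebra_1"
  shows "irreducible_part \<iota> m (\<lambda>as. r *\<^sub>R K as) as = r *\<^sub>R irreducible_part \<iota> m K as"
  by (cases as) (simp_all add: selection_hom[of "\<lambda>x. r *\<^sub>R x"] scaleR_add_right)

context
  fixes \<iota> :: "'b::cstar_algebra_1 \<Rightarrow> 'a::star_algebra_1" and K
  assumes \<iota>: "star_hom \<iota>" and K: "quasi_multilinear \<iota> K" and K0: "K [] = 0"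
begin

text \<open>Inner weight 0 turns the gap series into the unit, so blocks have no gaps and the
  irreducible part is \<open>K\<close> itself. Boolean cumulants are thus the increments of the
  moments.\<close>

lemma nc_moment_boolean_renewal: "renewal A (nc_moment \<iota> K 1 0) K"
proof -
  have "nc_moment \<iota> K 0 0 = (\<lambda>as. if as = [] then 1 else 0)"
    using renewalD[OF nc_moment_renewal[OF \<iota> K, of UNIV 0 0]] by (auto simp: splits_zero)
  \<comment> \<open>A nonempty gap multiplies its argument by 0, so every entry has to be
    selected.\<close>
  moreover have "selection \<iota> (\<lambda>as. if as = [] then 1 else 0) h g as = (if g = [] then h as else 0)"
    if "multiadditive h" for h :: "'a list \<Rightarrow> 'b" and g as
    using that
  proof (induction as arbitrary: h g)
    case (Cons a as)
    have "\<iota> 1 = 1" "\<iota> 0 = 0" using \<iota> star_hom_zero[OF \<iota>] by (auto simp: star_hom_def)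
    moreover have "h (0 # as) = 0" using multiadditive_Cons(2)[OF Cons.prems, of 0 0 as] by simp
    ultimately show ?case
      using Cons.IH[OF multiadditive_Cons(1)[OF Cons.prems]] Cons.IH[OF Cons.prems] by simp
  qed simp
  ultimately have "irreducible_part \<iota> (nc_moment \<iota> K 0 0) K as = K as" for as
    by (cases as) (simp_all add: K0 multiadditive_Cons(1)[OF quasi_multilinear_multiadditive[OF K]])
  then show ?thesis using nc_moment_renewal[OF \<iota> K, of A 1 0] by simp
qed

end

lemma renewal_cong:
  assumes "renewal A M C" "\<And>as. as \<in> lists A \<Longrightarrow> M as = M' as"
  shows "renewal A M' C"
proof -
  have "M' as = (if as = [] then 1 else 0) + splits (\<lambda>p q. M' p * C q) as" if as: "as \<in> lists A" for as
  proof -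
    have "splits (\<lambda>p q. M p * C q) as = splits (\<lambda>p q. M' p * C q) as"
      by (rule splits_cong) (use as assms(2) in auto)
    then show ?thesis using renewalD[OF assms(1) as] assms(2)[OF as] by simp
  qed
  then show ?thesis using renewal_zero[OF assms(1)] unfolding renewal_def by blast
qed

lemma cumulants_nc_moment:
  fixes \<nu> :: "'b::cstar_algebra_1 ncpoly \<Rightarrow> 'b"
  assumes \<nu>: "bimodule_map nc_const \<nu>" "\<nu> 1 = 1"
    and \<alpha>: "\<And>l. l \<ge> 1 \<Longrightarrow> \<alpha> {{1..l}} = 1" "\<And>l \<pi>. \<pi> \<in> NC {1..l} \<Longrightarrow> \<alpha> \<pi> = block_weight x y \<pi>"
  defines "K \<equiv> cumulants \<alpha> nc_const \<nu>"
  shows "quasi_multilinear nc_const K" "K [] = 0" "(\<lambda>as. \<nu> (prod_list as)) = nc_moment nc_const K x y"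
proof -
  have K: "is_cumulants \<alpha> nc_const \<nu> K"
    unfolding K_def by (rule is_cumulants_cumulants[where \<alpha> = \<alpha>, OF star_hom_nc_const \<nu>(1) \<alpha>(1)])
  then show q: "quasi_multilinear nc_const K" "K [] = 0" unfolding is_cumulants_def by blast+
  show "(\<lambda>as. \<nu> (prod_list as)) = nc_moment nc_const K x y"
  proof
    fix as
    show "\<nu> (prod_list as) = nc_moment nc_const K x y as"
    proof (cases "as = []")
      case True
      then show ?thesis using renewal_Nil[OF nc_moment_renewal[OF star_hom_nc_const q(1)]] \<nu>(2) by simp
    next
      case False
      then have "\<nu> (prod_list as) = moments_of_cumulants \<alpha> nc_const K as"
        using K unfolding is_cumulants_def moments_of_cumulants_def eval_list_def by blast
      then show ?thesis using moments_of_cumulants_weight[where \<alpha> = \<alpha>, OF \<alpha>(2)] by simp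
    qed
  qed
qed

text \<open>Here the family \<open>K\<close> is prescribed and the moments follow on letters,
  whereas \<open>cumulants_nc_moment\<close> starts from a given map and holds on all lists.\<close>

lemma law_with_cumulants_moments:
  fixes K :: "'b::cstar_algebra_1 ncpoly list \<Rightarrow> 'b"
  assumes \<alpha>: "\<And>l. l \<ge> 1 \<Longrightarrow> \<alpha> {{1..l}} = 1" "\<And>l \<pi>. \<pi> \<in> NC {1..l} \<Longrightarrow> \<alpha> \<pi> = block_weight x y \<pi>"
    and K: "quasi_multilinear nc_const K"
    and \<kappa>: "\<And>bs. \<kappa> bs = K (map (\<lambda>b. nc_X * nc_const b) bs @ [nc_X])"
    and as: "as \<in> lists (Collect nc_letter)"
  shows "law_with_cumulants \<alpha> \<kappa> (prod_list as) = nc_moment nc_const K x y as"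
proof (cases "as = []")
  case True
  then show ?thesis
    using renewal_Nil[OF nc_moment_renewal[OF star_hom_nc_const K]] law_with_cumulants_exists(2)[where \<alpha> = \<alpha>, OF \<alpha>(1) K \<kappa>] by simp
next
  case False
  then show ?thesis
    using law_with_cumulants_exists(3)[where \<alpha> = \<alpha>, OF \<alpha>(1) K \<kappa>, of as] as
      moments_of_cumulants_weight[where \<alpha> = \<alpha>, OF \<alpha>(2)] by (simp add: in_lists_conv_set)
qed

lemma boolean_cumulants_nc_moment:
  fixes \<nu> :: "'b::cstar_algebra_1 ncpoly \<Rightarrow> 'b"
  assumes "bimodule_map nc_const \<nu>" "\<nu> 1 = 1"
  shows "quasi_multilinear nc_const (cumulants boolean_coeff nc_const \<nu>)"
    "cumulants boolean_coeff nc_const \<nu> [] = 0"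
    "(\<lambda>as. \<nu> (prod_list as)) = nc_moment nc_const (cumulants boolean_coeff nc_const \<nu>) 1 0"
  by (rule cumulants_nc_moment[where \<alpha> = boolean_coeff and x = 1 and y = 0, OF assms];
      erule coeff_top(2) boolean_coeff_weight[OF _ finite_atLeastAtMost])+

lemma free_cumulants_nc_moment:
  fixes \<nu> :: "'b::cstar_algebra_1 ncpoly \<Rightarrow> 'b"
  assumes "bimodule_map nc_const \<nu>" "\<nu> 1 = 1"
  shows "quasi_multilinear nc_const (cumulants free_coeff nc_const \<nu>)"
    "(\<lambda>as. \<nu> (prod_list as)) = nc_moment nc_const (cumulants free_coeff nc_const \<nu>) 1 1"
  by (rule cumulants_nc_moment[where \<alpha> = free_coeff and x = 1 and y = 1, OF assms];
      rule coeff_top(1) free_coeff_weight; assumption)+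

text \<open>Each of the two powers rescales one kind of cumulants, and
  \<open>renewal_increments_unique\<close> translates between the kinds at the level of moments. The
  free power enters through its moments \<open>L\<close> alone.\<close>

lemma boolean_cumulants_BN:
  fixes \<mu> :: "'b::cstar_algebra_1 ncpoly \<Rightarrow> 'b" and t :: real
  assumes \<mu>: "bimodule_map nc_const \<mu>" "\<mu> 1 = 1" and t: "t \<ge> 0"
  shows "bimodule_map nc_const (BN t \<mu>)" "BN t \<mu> 1 = 1"
    and "as \<in> lists (Collect nc_letter) \<Longrightarrow>
      BN t \<mu> (prod_list as) = nc_moment nc_const (cumulants boolean_coeff nc_const \<mu>) 1 t as"
proof -
  note hom = star_hom_nc_const[where 'a = 'b]
  have \<iota>: "nc_const (x + y) = nc_const x + nc_const y" "nc_const (x * y) = nc_const x * nc_const y" for x y :: 'b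
    using hom unfolding star_hom_def clinear_map_def by blast+
  define A where "A = (Collect nc_letter :: 'b ncpoly set)"
  have A: "nc_const b * a \<in> A" if "a \<in> A" for b a using that nc_letter_left by (simp add: A_def)
  define B where "B = cumulants boolean_coeff nc_const \<mu>"
  define F where "F = cumulants free_coeff nc_const \<mu>"
  note B = boolean_cumulants_nc_moment[OF \<mu>, folded B_def]
  note F = free_cumulants_nc_moment[OF \<mu>, folded F_def]
  define L where "L = nc_moment nc_const (\<lambda>as. (1 + t) *\<^sub>R F as) 1 1"
  define m where "m = nc_moment nc_const B t t"
  note sF = quasi_multilinear_scaleR[OF F(1), of "1 + t"]
  have L: "renewal A L (\<lambda>as. (1 + t) *\<^sub>R irreducible_part nc_const L F as)"
    using nc_moment_renewal[OF hom sF, of A 1 1] unfolding L_def irreducible_part_scaleR by simp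
  have semigroup: "irreducible_part nc_const m B as = irreducible_part nc_const L F as" if "as \<in> lists A" for as
  proof (rule irreducible_part_semigroup[OF \<iota> A _ _ _ _ _ L that])
    show "B (nc_const b * x # xs) = b * B (x # xs)" for b x xs by (rule quasi_D(3)[OF hom B(1)])
    show "multiadditive F" by (rule quasi_multilinear_multiadditive[OF F(1)])
    show "renewal A (\<lambda>as. \<mu> (prod_list as)) B"
      by (subst B(3)) (rule nc_moment_boolean_renewal[OF hom B(1,2)])
    show "renewal A (\<lambda>as. \<mu> (prod_list as)) (irreducible_part nc_const (\<lambda>as. \<mu> (prod_list as)) F)"
      by (subst (1 2) F(2)) (use nc_moment_renewal[OF hom F(1), of A 1 1] in simp)
    show "renewal A m (\<lambda>as. t *\<^sub>R irreducible_part nc_const m B as)"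
      unfolding m_def by (rule nc_moment_renewal[OF hom B(1)])
  qed
  define \<nu>1 where "\<nu>1 = free_power (1 + t) \<mu>"
  have \<kappa>1: "(1 + t) *\<^sub>R law_cumulants free_coeff \<mu> bs = (1 + t) *\<^sub>R F (map (\<lambda>b. nc_X * nc_const b) bs @ [nc_X])" for bs
    by (simp add: law_cumulants_def F_def)
  have \<nu>1: "bimodule_map nc_const \<nu>1" "\<nu>1 1 = 1"
    unfolding \<nu>1_def free_power_def
    by (rule law_with_cumulants_exists[where \<alpha> = free_coeff, OF _ sF \<kappa>1], erule coeff_top(1))+
  have mom1: "\<nu>1 (prod_list as) = L as" if "as \<in> lists A" for as
    unfolding \<nu>1_def free_power_def L_def
    by (rule law_with_cumulants_moments[where \<alpha> = free_coeff, OF coeff_top(1) free_coeff_weight sF \<kappa>1 that[unfolded A_def]])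
  define B1 where "B1 = cumulants boolean_coeff nc_const \<nu>1"
  note B1 = boolean_cumulants_nc_moment[OF \<nu>1, folded B1_def]
  have "renewal A L B1"
  proof (rule renewal_cong)
    show "renewal A (\<lambda>as. \<nu>1 (prod_list as)) B1"
      by (subst B1(3)) (rule nc_moment_boolean_renewal[OF hom B1(1,2)])
  qed (rule mom1)
  \<comment> \<open>Scaling the free cumulants scales the irreducible part, and the increments of
    \<open>L\<close> are the Boolean cumulants of the free power.\<close>
  then have B1_eq: "B1 as = (1 + t) *\<^sub>R irreducible_part nc_const L F as" if "as \<in> lists A" for as
    by (rule renewal_increments_unique[OF _ L that])
  define K where "K as = (1 / (1 + t)) *\<^sub>R B1 as" for as
  have K: "quasi_multilinear nc_const K" "K [] = 0"
    unfolding K_def using quasi_multilinear_scaleR[OF B1(1)] B1(2) by simp_all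
  have \<kappa>2: "(1 / (1 + t)) *\<^sub>R law_cumulants boolean_coeff \<nu>1 bs = K (map (\<lambda>b. nc_X * nc_const b) bs @ [nc_X])" for bs
    by (simp add: law_cumulants_def K_def B1_def)
  have BN: "BN t \<mu> = law_with_cumulants boolean_coeff (\<lambda>bs. (1 / (1 + t)) *\<^sub>R law_cumulants boolean_coeff \<nu>1 bs)"
    by (simp add: BN_def boolean_power_def \<nu>1_def)
  have mom2: "BN t \<mu> (prod_list as) = nc_moment nc_const K 1 0 as" if "as \<in> lists A" for as
    unfolding BN
    by (rule law_with_cumulants_moments[where \<alpha> = boolean_coeff, OF _ _ K(1) \<kappa>2 that[unfolded A_def]];
        erule coeff_top(2) boolean_coeff_weight[OF _ finite_atLeastAtMost])
  show "bimodule_map nc_const (BN t \<mu>)" "BN t \<mu> 1 = 1"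
    unfolding BN
    by (rule law_with_cumulants_exists[where \<alpha> = boolean_coeff, OF _ K(1) \<kappa>2], erule coeff_top(2))+
  assume "as \<in> lists (Collect nc_letter)"
  then have as: "as \<in> lists A" by (simp add: A_def)
  \<comment> \<open>Division by 1 + t, nonzero since \<open>t\<close> is nonnegative, leaves the
    increments I_L(F), which the semigroup property identifies with I_m(B).\<close>
  have "nc_moment nc_const K 1 0 as = nc_moment nc_const B 1 t as"
  proof (rule renewal_unique[OF nc_moment_boolean_renewal[OF hom K] nc_moment_renewal[OF hom B(1)] _ as])
    show "K as = 1 *\<^sub>R irreducible_part nc_const (nc_moment nc_const B t t) B as" if "as \<in> lists A" for as
      using t semigroup[OF that] B1_eq[OF that] by (simp add: K_def m_def)
  qed
  then show "BN t \<mu> (prod_list as) = nc_moment nc_const (cumulants boolean_coeff nc_const \<mu>) 1 t as"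
    using mom2[OF as] by (simp add: B_def)
qed

theorem corollary9p22:
  fixes N n d :: nat
    and T :: "nat list set"
    and \<mu> :: "'b::cstar_algebra_1 ncpoly \<Rightarrow> 'b"
  assumes "T \<in> Tree N"
    and "regular_tree n d T"
    and "n \<ge> 2"
    and "valued_law \<mu>"
  shows "BP_tree_Bool N T \<mu> = BN (real d / (real n - 1)) \<mu>"
proof -
  define t where "t = real d / (real n - 1)"
  have t: "t \<ge> 0" using assms(3) by (simp add: t_def)
  have \<mu>: "bimodule_map nc_const \<mu>" "\<mu> 1 = 1" using assms(4) by (simp_all add: valued_law_def)
  have rd: "root_degree T \<ge> 2" using regular_tree_root_degree[OF assms(2)] assms(3) by simp
  have \<alpha>: "tree_coeff N T {{1..l}} = 1" if "l \<ge> 1" for l by (rule coeff_top(3)[OF that assms(1) rd])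
  define B where "B = cumulants boolean_coeff nc_const \<mu>"
  have B: "quasi_multilinear nc_const B"
    unfolding B_def
    by (rule boolean_cumulants_nc_moment(1)[OF \<mu>])
  note BN = boolean_cumulants_BN[OF \<mu> t, folded B_def]
  have "BN t \<mu> (prod_list as) = moments_of_cumulants (tree_coeff N T) nc_const B as"
    if "\<forall>a\<in>set as. nc_letter a" for as
  proof -
    have "moments_of_cumulants (tree_coeff N T) nc_const B as = nc_moment nc_const B 1 t as"
      unfolding t_def
      by (rule moments_of_cumulants_weight, rule tree_coeff_regular[OF assms(1-3) _ finite_atLeastAtMost])
    then show ?thesis using BN(3)[of as] that by (simp add: in_lists_conv_set)
  qed
  \<comment> \<open>A unital bimodule map whose moments on letters are the tree sums of
    \<open>B\<close> is the one that the description with cumulants \<open>B\<close>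
    selects.\<close>
  then have "law_with_cumulants (tree_coeff N T) (law_cumulants boolean_coeff \<mu>) = BN t \<mu>"
    by (intro law_with_cumulants_eq[where \<alpha> = "tree_coeff N T" and K = B, OF \<alpha> BN(1,2) B])
      (auto simp: law_cumulants_def B_def)
  then show ?thesis by (simp add: BP_tree_Bool_def t_def)
qed

end
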